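(* An arrangement $\mathcal{QK}$ consisting of the Klein quartic and four of its bitangent lines that intersect at one quadruple point is plus-one generated with the exponents $(d_{1},d_{2},d_{3}) = (4,4,7)$.
   Context: Work over $\mathbb{C}$. The Klein quartic is the smooth plane curve in $\mathbb{P}^2_{\mathbb{C}}$ given by $x^4 + y^4 + z^4 + \lambda(x^2y^2 + x^2z^2 + y^2z^2)=0$, where $\lambda$ is either root of $\lambda^2+3\lambda+18=0$. A bitangent of a smooth plane quartic is a line tangent to the curve at two points, which are allowed to coincide (the line cuts out a divisor $2P+2P'$ on the curve). The four lines are pairwise distinct and pass through a common point. Let $S=\mathbb{C}[x,y,z]$. For a reduced curve $C: f=0$ of degree $d$ in $\mathbb{P}^2_{\mathbb{C}}$, let $J_f$ be the ideal generated by the partial derivatives of $f$ and $M(f)=S/J_f$ the Milnor algebra. $C$ is an $m$-syzygy curve if $M(f)$ has minimal graded free resolution $$0 \rightarrow \bigoplus_{i=1}^{m-2}S(-e_{i}) \rightarrow \bigoplus_{i=1}^{m}S(1-d - d_{i}) \rightarrow S^{3}(1-d)\rightarrow S \rightarrow M(f) \rightarrow 0$$ with $e_{1} \leq \dots \leq e_{m-2}$ and $1\leq d_{1} \leq \dots \leq d_{m}$; the $d_i$ are called the exponents. $C$ is plus-one generated (of level $d_3$) if it is a $3$-syzygy curve such that $d_1+d_2=d$ and $d_3>d_2$. An arrangement is called plus-one generated if the reduced curve that is the union of its members is. *)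

theory Defs
  imports
    Complex_Main
    "HOL-Library.Poly_Mapping"
    "HOL-Library.Numeral_Type"
    "HOL-Computational_Algebra.Computational_Algebra"
    "Jordan_Normal_Form.Matrix_Kernel"
begin

text \<open>
  \<open>S = \<complex>[x,y,z]\<close> is the monoid algebra of the exponent vectors \<open>3 \<Rightarrow>\<^sub>0 nat\<close>; the elements
  \<open>0, 1, 2\<close> of the three-element index type \<open>3\<close> stand for the variables \<open>x, y, z\<close>.
\<close>

type_synonym mpoly3 = "(3 \<Rightarrow>\<^sub>0 nat) \<Rightarrow>\<^sub>0 complex"

definition var :: "3 \<Rightarrow> mpoly3" where
  "var i = Poly_Mapping.single (Poly_Mapping.single i 1) 1"

definition const :: "complex \<Rightarrow> mpoly3" where
  "const c = Poly_Mapping.single 0 c"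

text \<open>An integer degree is used because of the twists below; for negative \<open>k\<close> only
  \<open>0\<close> is homogeneous of degree \<open>k\<close>.\<close>

definition homogeneous :: "int \<Rightarrow> mpoly3 \<Rightarrow> bool" where
  "homogeneous k f \<longleftrightarrow>
     (\<forall>m \<in> Poly_Mapping.keys f. int (\<Sum>i\<in>UNIV. Poly_Mapping.lookup m i) = k)"

definition partial_deriv :: "3 \<Rightarrow> mpoly3 \<Rightarrow> mpoly3" where
  "partial_deriv i f =
     (\<Sum>m \<in> Poly_Mapping.keys f.
        Poly_Mapping.single (m - Poly_Mapping.single i 1)
          (of_nat (Poly_Mapping.lookup m i) * Poly_Mapping.lookup f m))"

text \<open>Substitution of \<open>v i\<close> for the \<open>i\<close>-th variable, the coefficients being mapped along \<open>\<rho>\<close>.\<close>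

definition subst_poly ::
    "(complex \<Rightarrow> 'a::comm_ring_1) \<Rightarrow> (3 \<Rightarrow> 'a) \<Rightarrow> mpoly3 \<Rightarrow> 'a" where
  "subst_poly \<rho> v f =
     (\<Sum>m \<in> Poly_Mapping.keys f.
        \<rho> (Poly_Mapping.lookup f m) * (\<Prod>i\<in>UNIV. v i ^ Poly_Mapping.lookup m i))"

definition ideal_gen :: "mpoly3 set \<Rightarrow> mpoly3 set" where
  "ideal_gen B = Modules.module.span (*) B"

definition jacobian_ideal :: "mpoly3 \<Rightarrow> mpoly3 set" where
  "jacobian_ideal f = ideal_gen {partial_deriv i f | i. True}"

definition irrelevant_ideal :: "mpoly3 set" where
  "irrelevant_ideal = ideal_gen {var i | i. True}"


section \<open>Graded free resolutions\<close>

text \<open>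
  A list \<open>[t\<^sub>0, \<dots>, t\<^sub>n\<^sub>-\<^sub>1]\<close> of integers represents the graded free module
  \<open>S(t\<^sub>0) \<oplus> \<dots> \<oplus> S(t\<^sub>n\<^sub>-\<^sub>1)\<close>, with underlying module \<open>carrier_vec n\<close>.  As \<open>S(t)\<close> is generated in
  degree \<open>- t\<close> and \<open>S(s)\<close> has \<open>S\<^sub>s\<^sub>+\<^sub>k\<close> in degree \<open>k\<close>, a degree-preserving map \<open>S(t) \<rightarrow> S(s)\<close> is
  multiplication by a homogeneous polynomial of degree \<open>s - t\<close>.
\<close>

definition graded_map :: "int list \<Rightarrow> int list \<Rightarrow> mpoly3 mat \<Rightarrow> bool" where
  "graded_map src tgt A \<longleftrightarrow>
     A \<in> carrier_mat (length tgt) (length src) \<and>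
     (\<forall>i < length tgt. \<forall>j < length src. homogeneous (tgt ! i - src ! j) (A $$ (i, j)))"

definition mat_image :: "mpoly3 mat \<Rightarrow> mpoly3 vec set" where
  "mat_image A = {A *\<^sub>v v | v. v \<in> carrier_vec (dim_col A)}"

text \<open>
  The complex \<open>0 \<rightarrow> F\<^sub>n \<rightarrow> \<dots> \<rightarrow> F\<^sub>1 \<rightarrow> F\<^sub>0 = S \<rightarrow> S/I \<rightarrow> 0\<close>, where \<open>\<phi> ! i\<close> is the map
  \<open>F\<^sub>i\<^sub>+\<^sub>1 \<rightarrow> F\<^sub>i\<close> and \<open>S \<rightarrow> S/I\<close> is the projection, whose kernel is \<open>I\<close>.  The conditions on
  \<open>mat_image\<close> and \<open>mat_kernel\<close> are exactness at \<open>F\<^sub>0\<close>, at \<open>F\<^sub>1, \<dots>, F\<^sub>n\<^sub>-\<^sub>1\<close> and at \<open>F\<^sub>n\<close>.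
  Minimality means that every map sends \<open>F\<^sub>i\<^sub>+\<^sub>1\<close> into \<open>(x,y,z) F\<^sub>i\<close>, that is, that all matrix
  entries lie in \<open>(x,y,z)\<close>.
\<close>

definition minimal_graded_free_resolution ::
    "mpoly3 set \<Rightarrow> int list list \<Rightarrow> mpoly3 mat list \<Rightarrow> bool" where
  "minimal_graded_free_resolution I F \<phi> \<longleftrightarrow>
     \<phi> \<noteq> [] \<and> length F = Suc (length \<phi>) \<and> F ! 0 = [0] \<and>
     (\<forall>i < length \<phi>. graded_map (F ! Suc i) (F ! i) (\<phi> ! i)) \<and>
     (\<forall>i < length \<phi>. elements_mat (\<phi> ! i) \<subseteq> irrelevant_ideal) \<and>
     mat_image (\<phi> ! 0) = {v \<in> carrier_vec 1. v $ 0 \<in> I} \<and>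
     (\<forall>i. Suc i < length \<phi> \<longrightarrow> mat_image (\<phi> ! Suc i) = mat_kernel (\<phi> ! i)) \<and>
     mat_kernel (last \<phi>) = {0\<^sub>v (length (last F))}"


section \<open>Syzygy curves\<close>

definition reduced_curve :: "nat \<Rightarrow> mpoly3 \<Rightarrow> bool" where
  "reduced_curve d f \<longleftrightarrow> d \<ge> 1 \<and> f \<noteq> 0 \<and> homogeneous (int d) f \<and> squarefree f"

text \<open>The reduced curve \<open>f = 0\<close> of degree \<open>d\<close> is an \<open>m\<close>-syzygy curve with the list \<open>ds\<close> of
  exponents, where \<open>m = length ds\<close>.\<close>

definition syzygy_curve :: "nat \<Rightarrow> mpoly3 \<Rightarrow> nat list \<Rightarrow> bool" where
  "syzygy_curve d f ds \<longleftrightarrow>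
     reduced_curve d f \<and> length ds \<ge> 2 \<and> sorted ds \<and> (\<forall>k \<in> set ds. 1 \<le> k) \<and>
     (\<exists>es \<phi>. length es = length ds - 2 \<and> sorted es \<and>
        minimal_graded_free_resolution (jacobian_ideal f)
          [[0],
           replicate 3 (1 - int d),
           map (\<lambda>k. 1 - int d - int k) ds,
           map (\<lambda>e. - e) es] \<phi>)"

definition plus_one_generated :: "mpoly3 \<Rightarrow> nat \<Rightarrow> nat \<Rightarrow> nat \<Rightarrow> bool" where
  "plus_one_generated f d1 d2 d3 \<longleftrightarrow>
     (\<exists>d. syzygy_curve d f [d1, d2, d3] \<and> d1 + d2 = d \<and> d3 > d2)"


section \<open>Lines, bitangents and the Klein quartic\<close>

text \<open>Points of the projective plane are given by nonzero vectors of homogeneous coordinates;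
  zero sets are therefore sets of such vectors, closed under nonzero scaling.\<close>

definition same_point :: "(3 \<Rightarrow> complex) \<Rightarrow> (3 \<Rightarrow> complex) \<Rightarrow> bool" where
  "same_point P Q \<longleftrightarrow> (\<exists>c. c \<noteq> 0 \<and> (\<forall>i. Q i = c * P i))"

definition proj_zeros :: "mpoly3 \<Rightarrow> (3 \<Rightarrow> complex) set" where
  "proj_zeros f = {P. (\<exists>i. P i \<noteq> 0) \<and> subst_poly (\<lambda>c. c) P f = 0}"

definition is_line :: "mpoly3 \<Rightarrow> bool" where
  "is_line l \<longleftrightarrow> l \<noteq> 0 \<and> homogeneous 1 l"

text \<open>The univariate polynomial \<open>f(P + t Q)\<close> in \<open>t\<close>: for distinct points \<open>P\<close>, \<open>Q\<close> this is the
  restriction of \<open>f\<close> to the line through them in an affine coordinate vanishing at \<open>P\<close>, so its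
  order at \<open>0\<close> is the multiplicity of \<open>P\<close> in the divisor cut out by that line.\<close>

definition restrict_line :: "mpoly3 \<Rightarrow> (3 \<Rightarrow> complex) \<Rightarrow> (3 \<Rightarrow> complex) \<Rightarrow> complex poly" where
  "restrict_line f P Q = subst_poly (\<lambda>c. [:c:]) (\<lambda>i. [:P i, Q i:]) f"

text \<open>The line \<open>l = 0\<close> cuts out the divisor \<open>2P + 2P'\<close> on \<open>f = 0\<close>, where \<open>P = P'\<close> is allowed.\<close>

definition bitangent :: "mpoly3 \<Rightarrow> mpoly3 \<Rightarrow> bool" where
  "bitangent f l \<longleftrightarrow> is_line l \<and>
     (\<exists>P \<in> proj_zeros l. \<exists>P' \<in> proj_zeros l.
        \<forall>R \<in> proj_zeros l. \<forall>T \<in> proj_zeros l. \<not> same_point R T \<longrightarrow>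
          restrict_line f R T \<noteq> 0 \<and>
          Polynomial.order 0 (restrict_line f R T) =
            (if same_point R P then 2 else 0) + (if same_point R P' then 2 else 0))"

definition klein_quartic :: "complex \<Rightarrow> mpoly3" where
  "klein_quartic a =
     (let x = var 0; y = var 1; z = var 2
      in x ^ 4 + y ^ 4 + z ^ 4
         + const a * (x ^ 2 * y ^ 2 + x ^ 2 * z ^ 2 + y ^ 2 * z ^ 2))"

end

theory Submission
  imports Defs
begin

text \<open>
  Let \<open>f\<close> be the quartic and \<open>P\<close> the common point of the four bitangents.  As \<open>f\<close> is smooth, \<open>P\<close> does
  not lie on it, so in suitable coordinates \<open>P = (0,0,1)\<close> and \<open>f = z\<^sup>4 + A z\<^sup>2 + C z + B\<close> with binary
  forms \<open>A, B, C\<close> in \<open>x, y\<close> of degrees 2, 4, 3.  A line through \<open>P\<close> is bitangent iff \<open>C = 0\<close> and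
  \<open>A\<^sup>2 = 4 B\<close> on it.  The cubic \<open>C\<close> vanishes on four lines, hence \<open>C = 0\<close>, and the product of the
  four lines is \<open>G = A\<^sup>2 - 4 B\<close> up to a constant; no classification of the 28 bitangents is needed.

  For \<open>F = f G\<close> put \<open>L = 2 z\<^sup>2 + A\<close> and \<open>J = A\<^sub>x B\<^sub>y - A\<^sub>y B\<^sub>x\<close>.  Then \<open>4 f = L\<^sup>2 - G\<close>, \<open>f\<^sub>z = 2 z L\<close>
  and \<open>f\<^sub>x G\<^sub>y - f\<^sub>y G\<^sub>x = - 2 J L\<close>, and the syzygies of the gradient of \<open>F\<close> turn out to be those of
  \<open>f, J, z\<close>.  These form a regular sequence as soon as \<open>B\<close> and \<open>J\<close> have no common zero, which holds
  because \<open>f\<close> is smooth and has no hyperflex; the latter is where the specific quartic matters.  The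
  Koszul complex of \<open>f, J, z\<close> (degrees 4, 4, 1) then yields the exponents \<open>4, 4, 7\<close>.
\<close>

text \<open>The common point is off the quartic because a bitangent through a point of the curve
  must be the tangent line there, and four distinct lines cannot all be that tangent. The coordinate
  \<open>z\<close> is adapted to the polar line of the point: choosing this line as
  \<open>z = 0\<close> removes the term in \<open>z\<^sup>3\<close>, and rescaling the point makes
  the coefficient of \<open>z\<^sup>4\<close> equal to 1. The form \<open>f\<close> of the overview
  is called \<open>Q\<close> in these coordinates. A syzygy \<open>(s0, s1, s2)\<close> of the
  gradient is a derivation killing \<open>F\<close>. Its part \<open>(s0, s1)\<close> preserves the
  four lines and is \<open>m\<close> times the Hamiltonian derivation of \<open>G\<close> plus
  \<open>k\<close> times the Euler derivation. Since \<open>4 f = L\<^sup>2 - G\<close>, the forms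
  \<open>L\<close> and \<open>f\<close> share no factor, which forces \<open>k = L n\<close> and
  leaves a relation between \<open>4 f\<close>, \<open>J\<close> and \<open>z\<close>. Here
  \<open>m\<close> and \<open>n\<close> have degree 3 less than the syzygy, so the Koszul relations,
  where they have degrees 1, 1, 4, give 4, 4, 7. All divisibility arguments in \<open>S\<close> go
  through linear forms, each prime because its multiples are the kernel of a substitution.\<close>

lemma UNIV_3: "(UNIV :: 3 set) = {0, 1, 2}"
proof -
  have "card {0, 1, 2 :: 3} = CARD(3)" by simp
  then show ?thesis by (metis card_eq_UNIV_imp_eq_UNIV finite)
qed

lemma forall_3: "(\<forall>i::3. P i) \<longleftrightarrow> P 0 \<and> P 1 \<and> P 2"
  by (metis UNIV_3 UNIV_I insertE singletonD)

lemma sum_3: "(\<Sum>i\<in>(UNIV::3 set). f i) = f 0 + f 1 + (f 2 :: 'a :: comm_monoid_add)"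
  unfolding UNIV_3 by (simp add: add.assoc)

lemma prod_3: "(\<Prod>i\<in>(UNIV::3 set). f i) = f 0 * f 1 * (f 2 :: 'a :: comm_monoid_mult)"
  unfolding UNIV_3 by (simp add: mult.assoc)

section \<open>Polynomials as sums of monomials, and induction on them\<close>

interpretation const: comm_ring_hom const
  by unfold_locales (simp_all add: const_def single_add mult_single)

lemma const_eq_0_iff [simp]: "const c = 0 \<longleftrightarrow> c = 0"
  by (metis const.hom_zero const_def lookup_single_eq lookup_zero)

lemma var_power: "var i ^ n = Poly_Mapping.single (Poly_Mapping.single i n) 1"
  by (induction n) (simp_all add: var_def mult_single single_add[symmetric])

lemma monomial_expand: "m = (\<Sum>i\<in>(UNIV::3 set). Poly_Mapping.single i (Poly_Mapping.lookup m i))"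
proof (rule poly_mapping_eqI)
  fix k :: 3
  show "Poly_Mapping.lookup m k = Poly_Mapping.lookup (\<Sum>i\<in>UNIV. Poly_Mapping.single i (Poly_Mapping.lookup m i)) k"
    by (simp add: lookup_sum lookup_single when_def)
qed

lemma single_eq_const_mult:
  "Poly_Mapping.single m c = const c * (\<Prod>i\<in>UNIV. var i ^ Poly_Mapping.lookup m i)"
proof -
  have "(\<Prod>i\<in>I. var i ^ Poly_Mapping.lookup m i)
      = Poly_Mapping.single (\<Sum>i\<in>I. Poly_Mapping.single i (Poly_Mapping.lookup m i)) 1" if "finite I" for I
    using that by (induction I) (simp_all add: var_power mult_single)
  from this[of UNIV] show ?thesis
    by (simp add: const_def mult_single monomial_expand[symmetric])
qed

lemma mpoly3_sum: "f = (\<Sum>m\<in>Poly_Mapping.keys f. Poly_Mapping.single m (Poly_Mapping.lookup f m))"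
proof (rule poly_mapping_eqI)
  fix k
  show "Poly_Mapping.lookup f k = Poly_Mapping.lookup (\<Sum>m\<in>Poly_Mapping.keys f. Poly_Mapping.single m (Poly_Mapping.lookup f m)) k"
    by (simp add: lookup_sum lookup_single when_def in_keys_iff)
qed

lemma mpoly3_single_induct [case_names single add]:
  assumes "\<And>m c. P (Poly_Mapping.single m c)" and "\<And>f g. P f \<Longrightarrow> P g \<Longrightarrow> P (f + g)"
  shows "P (f :: mpoly3)"
proof -
  have "P (\<Sum>m\<in>M. Poly_Mapping.single m (Poly_Mapping.lookup f m))" if "finite M" for M
    using that
  proof (induction M)
    case empty
    show ?case using assms(1)[of 0 0] by simp
  qed (simp add: assms)
  then show ?thesis by (metis mpoly3_sum finite_keys)
qed

text \<open>Constants and variables generate \<open>S\<close> as a ring. Identities compatible with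
  sums and products, such as the chain rule, can thus be checked on these generators alone, without
  handling sets of keys.\<close>

lemma mpoly3_induct [case_names const var add mult]:
  assumes c: "\<And>c. P (const c)" and v: "\<And>i. P (var i)"
    and a: "\<And>f g. P f \<Longrightarrow> P g \<Longrightarrow> P (f + g)" and m: "\<And>f g. P f \<Longrightarrow> P g \<Longrightarrow> P (f * g)"
  shows "P (f :: mpoly3)"
proof (induction f rule: mpoly3_single_induct)
  case (single k c)
  have pow: "P (var i ^ n)" for i n
  proof (induction n)
    case 0
    show ?case using c[of 1] by simp
  qed (simp add: m v)
  show ?case unfolding single_eq_const_mult prod_3 by (intro m c pow)
qed (rule a)

section \<open>Substitution\<close>

text \<open>One set of homomorphism laws serves three substitutions: evaluation at a point
  (\<open>\<rho>\<close> the identity), change of variables (\<open>\<rho> = const\<close>) and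
  restriction to a line (\<open>\<rho>\<close> the embedding into
  \<open>complex poly\<close>).\<close>

locale coeff_hom = comm_ring_hom \<rho> for \<rho> :: "complex \<Rightarrow> 'a::comm_ring_1"
begin

text \<open>Cancellation can make the keys of \<open>f + g\<close> smaller than the union of the
  keys. A common finite superset puts all three sums over the same index set.\<close>

lemma subst_poly_superset:
  assumes "finite M" "Poly_Mapping.keys f \<subseteq> M"
  shows "subst_poly \<rho> v f = (\<Sum>m\<in>M. \<rho> (Poly_Mapping.lookup f m) * (\<Prod>i\<in>UNIV. v i ^ Poly_Mapping.lookup m i))"
  unfolding subst_poly_def using assms
  by (intro sum.mono_neutral_left) (auto simp: in_keys_iff)

lemma subst_poly_single:
  "subst_poly \<rho> v (Poly_Mapping.single m c) = \<rho> c * (\<Prod>i\<in>UNIV. v i ^ Poly_Mapping.lookup m i)"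
  using subst_poly_superset[of "{m}" "Poly_Mapping.single m c"] by simp

lemma subst_poly_add: "subst_poly \<rho> v (f + g) = subst_poly \<rho> v f + subst_poly \<rho> v g"
proof -
  let ?M = "Poly_Mapping.keys f \<union> Poly_Mapping.keys g"
  have "Poly_Mapping.keys (f + g) \<subseteq> ?M" by (rule keys_add)
  then show ?thesis
    by (simp add: subst_poly_superset[of ?M] lookup_add hom_add distrib_right sum.distrib)
qed

lemma subst_poly_mult: "subst_poly \<rho> v (f * g) = subst_poly \<rho> v f * subst_poly \<rho> v g"
proof (induction f rule: mpoly3_single_induct)
  case (single m c)
  show ?case
  proof (induction g rule: mpoly3_single_induct)
    case (single n d)
    then show ?case
      by (simp add: mult_single subst_poly_single lookup_add power_add prod.distrib hom_mult)
  qed (simp add: distrib_left subst_poly_add)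
qed (simp add: distrib_right subst_poly_add)

lemma subst_poly_const [simp]: "subst_poly \<rho> v (const c) = \<rho> c"
  by (simp add: const_def subst_poly_single)

lemma subst_poly_var [simp]: "subst_poly \<rho> v (var i) = v i"
proof -
  have "(\<Prod>j\<in>UNIV. v j ^ Poly_Mapping.lookup (Poly_Mapping.single i 1) j) = (\<Prod>j\<in>UNIV. if j = i then v j else 1)"
    by (intro prod.cong) (simp_all add: lookup_single when_def)
  then show ?thesis by (simp add: var_def subst_poly_single)
qed

sublocale subst: comm_ring_hom "subst_poly \<rho> v" for v
proof
  show "subst_poly \<rho> v 1 = 1" for v using subst_poly_const[of v 1] by simp
  show "subst_poly \<rho> v 0 = 0" for v using subst_poly_const[of v 0] by simp
qed (rule subst_poly_add subst_poly_mult)+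

end

abbreviation eval :: "(3 \<Rightarrow> complex) \<Rightarrow> mpoly3 \<Rightarrow> complex" where "eval \<equiv> subst_poly (\<lambda>c. c)"

abbreviation subst :: "(3 \<Rightarrow> mpoly3) \<Rightarrow> mpoly3 \<Rightarrow> mpoly3" where "subst \<equiv> subst_poly const"

lemma coeff_hom_id: "coeff_hom (\<lambda>c. c)"
  unfolding coeff_hom_def by standard auto

lemmas eval_add = coeff_hom.subst_poly_add[OF coeff_hom_id]
lemmas eval_mult = coeff_hom.subst_poly_mult[OF coeff_hom_id]
lemmas eval_const [simp] = coeff_hom.subst_poly_const[OF coeff_hom_id]
lemmas eval_var [simp] = coeff_hom.subst_poly_var[OF coeff_hom_id]

interpretation eval: comm_ring_hom "eval P" for P
  by standard (use eval_const[of P 0] eval_const[of P 1] in \<open>simp_all add: eval_add eval_mult\<close>)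

interpretation subst: coeff_hom const ..
interpretation line: coeff_hom "\<lambda>c::complex. [:c:]" by unfold_locales simp_all

lemma eval_subst: "eval P (subst v f) = eval (\<lambda>i. eval P (v i)) f"
  by (induction f rule: mpoly3_induct)
    (simp_all add: eval_add eval_mult subst.subst_poly_add subst.subst_poly_mult)

lemma subst_subst: "subst w (subst v f) = subst (\<lambda>i. subst w (v i)) f"
  by (induction f rule: mpoly3_induct) (simp_all add: subst.subst_poly_add subst.subst_poly_mult)

lemma subst_var [simp]: "subst var f = f"
  by (induction f rule: mpoly3_induct) (simp_all add: subst.subst_poly_add subst.subst_poly_mult)

lemma poly_restrict_line: "poly (restrict_line f P Q) t = eval (\<lambda>i. P i + t * Q i) f"
  unfolding restrict_line_def
  by (induction f rule: mpoly3_induct)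
    (simp_all add: line.subst_poly_add line.subst_poly_mult eval_add eval_mult)

section \<open>Derivatives\<close>

lemma partial_deriv_superset:
  assumes "finite M" "Poly_Mapping.keys f \<subseteq> M"
  shows "partial_deriv i f = (\<Sum>m\<in>M. Poly_Mapping.single (m - Poly_Mapping.single i 1)
          (of_nat (Poly_Mapping.lookup m i) * Poly_Mapping.lookup f m))"
  unfolding partial_deriv_def using assms
  by (intro sum.mono_neutral_left) (auto simp: in_keys_iff)

lemma partial_deriv_single:
  "partial_deriv i (Poly_Mapping.single m c) = Poly_Mapping.single (m - Poly_Mapping.single i 1)
     (of_nat (Poly_Mapping.lookup m i) * c)"
  using partial_deriv_superset[of "{m}" "Poly_Mapping.single m c"] by simp

lemma partial_deriv_add [simp]: "partial_deriv i (f + g) = partial_deriv i f + partial_deriv i g"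
proof -
  let ?M = "Poly_Mapping.keys f \<union> Poly_Mapping.keys g"
  have "Poly_Mapping.keys (f + g) \<subseteq> ?M" by (rule keys_add)
  then show ?thesis
    by (simp add: partial_deriv_superset[of ?M] lookup_add distrib_left single_add sum.distrib)
qed

text \<open>Subtraction of exponents is truncated at 0, so it commutes with addition only when the
  variable occurs in \<open>m\<close>. In the Leibniz rule the remaining monomials carry the
  coefficient 0.\<close>

lemma monomial_diff_add:
  assumes "Poly_Mapping.lookup m i \<noteq> (0::nat)"
  shows "m - Poly_Mapping.single i 1 + n = m + n - Poly_Mapping.single (i::3) 1"
  using assms by (intro poly_mapping_eqI) (auto simp: lookup_add lookup_minus lookup_single when_def)

lemma partial_deriv_mult: "partial_deriv i (f * g) = partial_deriv i f * g + f * partial_deriv i g"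
proof (induction f rule: mpoly3_single_induct)
  case (single m c)
  show ?case
  proof (induction g rule: mpoly3_single_induct)
    case (single n d)
    let ?e = "Poly_Mapping.single i (1::nat)"
    have 1: "Poly_Mapping.single (m - ?e + n) (of_nat (Poly_Mapping.lookup m i) * c * d)
       = Poly_Mapping.single (m + n - ?e) (of_nat (Poly_Mapping.lookup m i) * c * d)"
    proof (cases "Poly_Mapping.lookup m i = 0")
      case False
      show ?thesis by (simp only: monomial_diff_add[OF False])
    qed simp
    have 2: "Poly_Mapping.single (m + (n - ?e)) (of_nat (Poly_Mapping.lookup n i) * c * d)
       = Poly_Mapping.single (m + n - ?e) (of_nat (Poly_Mapping.lookup n i) * c * d)"
    proof (cases "Poly_Mapping.lookup n i = 0")
      case False
      then show ?thesis using monomial_diff_add[of n i m] by (simp add: add.commute)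
    qed simp
    show ?case
      unfolding mult_single partial_deriv_single lookup_add of_nat_add distrib_right single_add
        mult.assoc[symmetric] 1[symmetric] 2[symmetric] mult.commute[of c "of_nat _"]
      by (rule refl)
  qed (simp add: distrib_left add_ac)
qed (simp add: distrib_right add_ac)

lemma partial_deriv_const [simp]: "partial_deriv i (const c) = 0"
  by (simp add: const_def partial_deriv_single)

lemma partial_deriv_var [simp]: "partial_deriv i (var j) = (if i = j then 1 else 0)"
  by (simp add: var_def partial_deriv_single lookup_single when_def)

lemma partial_deriv_0 [simp]: "partial_deriv i 0 = 0"
  using partial_deriv_const[of i 0] by simp

lemma partial_deriv_1 [simp]: "partial_deriv i 1 = 0"
  using partial_deriv_const[of i 1] by simp

lemma partial_deriv_minus [simp]: "partial_deriv i (- f) = - partial_deriv i f"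
  by (metis add.right_inverse add_eq_0_iff partial_deriv_0 partial_deriv_add)

lemma partial_deriv_diff [simp]: "partial_deriv i (f - g) = partial_deriv i f - partial_deriv i g"
  using partial_deriv_add[of i f "- g"] by simp

lemma partial_deriv_numeral [simp]: "partial_deriv i (numeral n) = 0"
  by (metis const.hom_numeral partial_deriv_const)

lemma partial_deriv_sum [simp]: "partial_deriv i (\<Sum>j\<in>J. f j) = (\<Sum>j\<in>J. partial_deriv i (f j))"
  by (induction J rule: infinite_finite_induct) simp_all

lemma partial_deriv_power: "partial_deriv i (f ^ n) = of_nat n * f ^ (n - 1) * partial_deriv i f"
proof (induction n)
  case (Suc n)
  then show ?case by (cases n) (simp_all add: partial_deriv_mult algebra_simps)
qed simp

lemma partial_deriv_subst:
  "partial_deriv j (subst v f) = (\<Sum>i\<in>UNIV. partial_deriv j (v i) * subst v (partial_deriv i f))"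
  by (induction f rule: mpoly3_induct)
    (simp_all add: sum_3 subst.subst_poly_add subst.subst_poly_mult partial_deriv_mult algebra_simps
      if_distrib cong: if_cong, use UNIV_3 in \<open>auto simp: algebra_simps\<close>)

text \<open>These are the first two Taylor coefficients along the line. Through them tangency at
  \<open>P\<close>, which \<open>bitangent\<close> phrases as an order of vanishing, becomes a
  linear condition on the gradient at \<open>P\<close>.\<close>

lemma coeff_restrict_line:
  shows "coeff (restrict_line f P Q) 0 = eval P f"
    and "coeff (restrict_line f P Q) 1 = (\<Sum>i\<in>UNIV. Q i * eval P (partial_deriv i f))"
proof -
  show 0: "coeff (restrict_line f P Q) 0 = eval P f" for f
    using poly_restrict_line[of f P Q 0] by (simp add: poly_0_coeff_0)
  show "coeff (restrict_line f P Q) 1 = (\<Sum>i\<in>UNIV. Q i * eval P (partial_deriv i f))"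
  proof (induction f rule: mpoly3_induct)
    case (mult f g)
    have "restrict_line (f * g) P Q = restrict_line f P Q * restrict_line g P Q"
      by (simp add: restrict_line_def line.subst_poly_mult)
    then have "coeff (restrict_line (f * g) P Q) 1 = eval P f * coeff (restrict_line g P Q) 1
        + coeff (restrict_line f P Q) 1 * eval P g"
      by (simp add: coeff_mult 0[symmetric])
    then show ?case unfolding mult.IH
      by (simp add: partial_deriv_mult eval_add eval_mult sum_3 algebra_simps)
  next
    case (var i)
    have "i = 0 \<or> i = 1 \<or> i = 2" using forall_3[of "\<lambda>i. i = 0 \<or> i = 1 \<or> i = 2"] by simp
    then show ?case by (auto simp: restrict_line_def sum_3)
  qed (simp_all add: restrict_line_def line.subst_poly_add eval_add sum_3 algebra_simps)
qed

section \<open>Homogeneous polynomials\<close>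

lemma homogeneous_single: "homogeneous (int (\<Sum>i\<in>UNIV. Poly_Mapping.lookup m i)) (Poly_Mapping.single m c)"
  by (simp add: homogeneous_def)

lemma homogeneous_0 [simp, intro]: "homogeneous k 0"
  by (simp add: homogeneous_def)

lemma homogeneous_const [simp, intro]: "homogeneous 0 (const c)"
  using homogeneous_single[of 0 c] by (simp add: const_def)

lemma homogeneous_numeral [simp, intro]: "homogeneous 0 (numeral n)"
  by (metis const.hom_numeral homogeneous_const)

lemma homogeneous_var [simp, intro]: "homogeneous 1 (var i)"
proof -
  have "(\<Sum>j\<in>UNIV. Poly_Mapping.lookup (Poly_Mapping.single i 1) j) = (1::nat)"
    by (simp add: lookup_single when_def)
  then show ?thesis by (simp add: homogeneous_def var_def)
qed

lemma homogeneous_add: "homogeneous k f \<Longrightarrow> homogeneous k g \<Longrightarrow> homogeneous k (f + g)"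
  unfolding homogeneous_def using keys_add[of f g] by blast

lemma homogeneous_uminus: "homogeneous k f \<Longrightarrow> homogeneous k (- f)"
  by (simp add: homogeneous_def in_keys_iff)

lemma homogeneous_diff: "homogeneous k f \<Longrightarrow> homogeneous k g \<Longrightarrow> homogeneous k (f - g)"
  using homogeneous_add[of k f "- g"] by (simp add: homogeneous_uminus)

lemma homogeneous_sum: "(\<And>i. i \<in> I \<Longrightarrow> homogeneous k (f i)) \<Longrightarrow> homogeneous k (\<Sum>i\<in>I. f i)"
  by (induction I rule: infinite_finite_induct) (simp_all add: homogeneous_add)

lemma homogeneous_mult:
  assumes "homogeneous k f" "homogeneous l g"
  shows "homogeneous (k + l) (f * g)"
  unfolding homogeneous_def
proof
  fix m assume "m \<in> Poly_Mapping.keys (f * g)"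
  then obtain a b where "m = a + b" "a \<in> Poly_Mapping.keys f" "b \<in> Poly_Mapping.keys g"
    using keys_mult[of f g] by blast
  then show "int (\<Sum>i\<in>UNIV. Poly_Mapping.lookup m i) = k + l"
    using assms by (auto simp: homogeneous_def lookup_add sum.distrib)
qed

lemma homogeneous_power: "homogeneous k f \<Longrightarrow> homogeneous (int n * k) (f ^ n)"
proof (induction n)
  case 0
  show ?case using homogeneous_const[of 1] by simp
next
  case (Suc n)
  then show ?case using homogeneous_mult[of k f "int n * k" "f ^ n"] by (simp add: algebra_simps)
qed

lemma homogeneous_prod:
  assumes "\<And>i. i \<in> I \<Longrightarrow> homogeneous (k i) (f i)"
  shows "homogeneous (\<Sum>i\<in>I. k i) (\<Prod>i\<in>I. f i)"
  using assms
proof (induction I rule: infinite_finite_induct)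
  case (insert i I)
  then show ?case by (simp add: homogeneous_mult)
qed (metis const.hom_one homogeneous_const prod.infinite sum.infinite prod.empty sum.empty)+

lemma homogeneous_partial_deriv:
  assumes "homogeneous k f" shows "homogeneous (k - 1) (partial_deriv i f)"
  unfolding partial_deriv_def
proof (rule homogeneous_sum)
  fix m assume m: "m \<in> Poly_Mapping.keys f"
  show "homogeneous (k - 1) (Poly_Mapping.single (m - Poly_Mapping.single i 1) (of_nat (Poly_Mapping.lookup m i) * Poly_Mapping.lookup f m))"
  proof (cases "Poly_Mapping.lookup m i = 0")
    case False
    have "m - Poly_Mapping.single i 1 + Poly_Mapping.single i 1 = m"
      using monomial_diff_add[OF False, of "Poly_Mapping.single i 1"] by simp
    moreover have "(\<Sum>j\<in>UNIV. Poly_Mapping.lookup (m - Poly_Mapping.single i 1 + Poly_Mapping.single i 1) j)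
        = (\<Sum>j\<in>UNIV. Poly_Mapping.lookup (m - Poly_Mapping.single i 1) j) + 1"
      by (simp only: lookup_add sum.distrib) (simp add: lookup_single when_def)
    moreover have "int (\<Sum>j\<in>UNIV. Poly_Mapping.lookup m j) = k"
      using assms m by (simp add: homogeneous_def del: of_nat_sum)
    ultimately have "int (\<Sum>j\<in>UNIV. Poly_Mapping.lookup (m - Poly_Mapping.single i 1) j) = k - 1"
      by (metis add_diff_cancel_right' of_nat_1 of_nat_add)
    then show ?thesis by (simp add: homogeneous_def)
  qed simp
qed

lemma homogeneous_subst:
  assumes "homogeneous k f" "\<And>i. homogeneous 1 (v i)"
  shows "homogeneous k (subst v f)"
  unfolding subst_poly_def
proof (rule homogeneous_sum)
  fix m assume "m \<in> Poly_Mapping.keys f"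
  then have k: "k = (\<Sum>i\<in>UNIV. int (Poly_Mapping.lookup m i))"
    using assms(1) by (simp add: homogeneous_def)
  have "homogeneous (\<Sum>i\<in>UNIV. int (Poly_Mapping.lookup m i)) (\<Prod>i\<in>UNIV. v i ^ Poly_Mapping.lookup m i)"
    by (rule homogeneous_prod) (use homogeneous_power[OF assms(2)] in simp)
  from homogeneous_mult[OF homogeneous_const this]
  show "homogeneous k (const (Poly_Mapping.lookup f m) * (\<Prod>i\<in>UNIV. v i ^ Poly_Mapping.lookup m i))"
    by (simp add: k)
qed

lemma eval_scale:
  assumes "homogeneous (int k) f" shows "eval (\<lambda>i. c * P i) f = c ^ k * eval P f"
proof -
  have "(\<Prod>i\<in>UNIV. (c * P i) ^ Poly_Mapping.lookup m i) = c ^ k * (\<Prod>i\<in>UNIV. P i ^ Poly_Mapping.lookup m i)"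
    if "m \<in> Poly_Mapping.keys f" for m
  proof -
    have "(\<Sum>i\<in>UNIV. Poly_Mapping.lookup m i) = k"
      using assms that unfolding homogeneous_def by (metis of_nat_eq_iff)
    then show ?thesis by (auto simp: power_mult_distrib prod.distrib power_sum)
  qed
  then show ?thesis by (simp add: subst_poly_def sum_distrib_left mult_ac)
qed

section \<open>Ideals of \<open>S\<close> with three generators\<close>

lemma module_mpoly3: "Modules.module ((*) :: mpoly3 \<Rightarrow> mpoly3 \<Rightarrow> mpoly3)"
proof
  show "a * (x + y) = a * x + a * y" for a x y :: mpoly3 by (rule distrib_left)
  show "(a + b) * x = a * x + b * x" for a b x :: mpoly3 by (rule distrib_right)
  show "a * (b * x) = a * b * x" for a b x :: mpoly3 by (rule mult.assoc[symmetric])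
qed (rule mult_1_left)

text \<open>Membership becomes the existence of a coefficient vector, which is how elements of the
  image of a matrix with one row and three columns are presented.\<close>

lemma ideal_gen_triple:
  "f \<in> ideal_gen {g i | i::3. True} \<longleftrightarrow> (\<exists>a. f = (\<Sum>i\<in>UNIV. a i * g i))"
proof -
  interpret ideal: Modules.module "(*) :: mpoly3 \<Rightarrow> mpoly3 \<Rightarrow> mpoly3" by (rule module_mpoly3)
  define F where "F a = (\<Sum>i\<in>UNIV. a i * g i)" for a
  let ?T = "range F"
  have sub: "ideal.subspace ?T"
  proof (rule ideal.subspaceI)
    show "0 \<in> ?T" by (rule range_eqI[of _ _ "\<lambda>_. 0"]) (simp add: F_def)
    show "u + v \<in> ?T" if u: "u \<in> ?T" and v: "v \<in> ?T" for u v
    proof -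
      from u v obtain a b where "u = F a" "v = F b" by blast
      then have "u + v = F (\<lambda>i. a i + b i)" by (simp add: F_def distrib_right sum.distrib)
      then show ?thesis by (simp only: rangeI)
    qed
    show "c * u \<in> ?T" if u: "u \<in> ?T" for c u
    proof -
      from u obtain a where "u = F a" by blast
      then have "c * u = F (\<lambda>i. c * a i)" by (simp add: F_def sum_distrib_left)
      then show ?thesis by (simp only: rangeI)
    qed
  qed
  have "g i \<in> ?T" for i
  proof -
    have "(if j = i then 1 else 0) * g j = (if j = i then g j else 0)" for j by simp
    then have "F (\<lambda>j. if j = i then 1 else 0) = g i" by (simp add: F_def)
    then show ?thesis by (metis rangeI)
  qed
  then have "{g i | i. True} \<subseteq> ?T" by blast
  then have "ideal.span {g i | i. True} \<subseteq> ?T" using sub by (rule ideal.span_minimal)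
  moreover have "F a \<in> ideal.span {g i | i. True}" for a
    unfolding F_def by (intro ideal.span_sum ideal.span_scale ideal.span_base) blast
  ultimately show ?thesis unfolding ideal_gen_def F_def[symmetric] by blast
qed

text \<open>A monomial of positive degree contains some variable, which can be split off. Minimality
  of a resolution thereby reduces to a comparison of twists.\<close>

lemma homogeneous_in_irrelevant_ideal:
  assumes "homogeneous k f" "k > 0" shows "f \<in> irrelevant_ideal"
proof -
  interpret ideal: Modules.module "(*) :: mpoly3 \<Rightarrow> mpoly3 \<Rightarrow> mpoly3" by (rule module_mpoly3)
  let ?I = "ideal.span {var i | i. True}"
  have "Poly_Mapping.single m (Poly_Mapping.lookup f m) \<in> ?I" if m: "m \<in> Poly_Mapping.keys f" for m
  proof -
    have "int (\<Sum>i\<in>UNIV. Poly_Mapping.lookup m i) > 0"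
      using assms m by (simp add: homogeneous_def del: of_nat_sum)
    then obtain i where i: "Poly_Mapping.lookup m i \<noteq> 0"
      by (metis less_numeral_extra(3) of_nat_0 sum.neutral)
    have "m - Poly_Mapping.single i 1 + Poly_Mapping.single i 1 = m"
      using monomial_diff_add[OF i, of "Poly_Mapping.single i 1"] by simp
    then have "Poly_Mapping.single m (Poly_Mapping.lookup f m)
       = Poly_Mapping.single (m - Poly_Mapping.single i 1) (Poly_Mapping.lookup f m) * var i"
      by (simp add: var_def mult_single)
    also have "\<dots> \<in> ?I" by (intro ideal.span_scale ideal.span_base) auto
    finally show ?thesis .
  qed
  then have "(\<Sum>m\<in>Poly_Mapping.keys f. Poly_Mapping.single m (Poly_Mapping.lookup f m)) \<in> ?I"
    by (rule ideal.span_sum)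
  then show ?thesis unfolding irrelevant_ideal_def ideal_gen_def by (simp add: mpoly3_sum[symmetric])
qed

section \<open>Linear changes of coordinates\<close>

lemma ideal_gen_add: "f \<in> ideal_gen B \<Longrightarrow> g \<in> ideal_gen B \<Longrightarrow> f + g \<in> ideal_gen B"
  unfolding ideal_gen_def by (rule Modules.module.span_add[OF module_mpoly3])

lemma ideal_gen_mult: "f \<in> ideal_gen B \<Longrightarrow> g * f \<in> ideal_gen B"
  unfolding ideal_gen_def by (rule Modules.module.span_scale[OF module_mpoly3])

text \<open>An invertible linear change of variables is stored together with its inverse, both as
  substitutions. The hypotheses are symmetric, so a statement about \<open>w\<close> yields the one
  about \<open>v\<close> through \<open>swap\<close>.\<close>

locale linear_change =
  fixes v w :: "3 \<Rightarrow> mpoly3"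
  assumes homogeneous_v: "homogeneous 1 (v i)" and homogeneous_w: "homogeneous 1 (w i)"
    and subst_v_w [simp]: "subst v (w i) = var i" and subst_w_v [simp]: "subst w (v i) = var i"
begin

lemma subst_v_subst_w [simp]: "subst v (subst w f) = f"
  by (simp add: subst_subst)

lemma subst_w_subst_v [simp]: "subst w (subst v f) = f"
  by (simp add: subst_subst)

lemma swap: "linear_change w v"
  by standard (simp_all add: homogeneous_v homogeneous_w)

lemma map_vec_inverse [simp]: "map_vec (subst w) (map_vec (subst v) x) = x"
  by (intro eq_vecI) simp_all

lemma mat_image_map: "mat_image (map_mat (subst w) A) = map_vec (subst w) ` mat_image A"
proof -
  have hom: "map_mat (subst w) A *\<^sub>v map_vec (subst w) x = map_vec (subst w) (A *\<^sub>v x)"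
    if "x \<in> carrier_vec (dim_col A)" for x
    using subst.subst.mult_mat_vec_hom[of A "dim_row A" "dim_col A" x w] that by simp
  show ?thesis
  proof (intro equalityI subsetI)
    fix y assume "y \<in> mat_image (map_mat (subst w) A)"
    then obtain x where x: "x \<in> carrier_vec (dim_col A)" "y = map_mat (subst w) A *\<^sub>v x"
      by (auto simp: mat_image_def)
    then have "y = map_vec (subst w) (A *\<^sub>v map_vec (subst v) x)"
      by (simp add: hom[symmetric])
    moreover have "A *\<^sub>v map_vec (subst v) x \<in> mat_image A"
      using x by (auto simp: mat_image_def)
    ultimately show "y \<in> map_vec (subst w) ` mat_image A" by blast
  next
    fix y assume "y \<in> map_vec (subst w) ` mat_image A"
    then obtain x where "x \<in> carrier_vec (dim_col A)" "y = map_mat (subst w) A *\<^sub>v map_vec (subst w) x"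
      by (auto simp: mat_image_def hom)
    then show "y \<in> mat_image (map_mat (subst w) A)"
      by (auto simp: mat_image_def)
  qed
qed

lemma mat_kernel_map: "mat_kernel (map_mat (subst w) A) = map_vec (subst w) ` mat_kernel A"
proof -
  interpret v: linear_change w v by (rule swap)
  have hom: "map_mat (subst w) A *\<^sub>v map_vec (subst w) x = map_vec (subst w) (A *\<^sub>v x)"
    if "x \<in> carrier_vec (dim_col A)" for x
    using subst.subst.mult_mat_vec_hom[of A "dim_row A" "dim_col A" x w] that by simp
  show ?thesis
  proof (intro equalityI subsetI)
    fix y assume y: "y \<in> mat_kernel (map_mat (subst w) A)"
    then have c: "map_vec (subst v) y \<in> carrier_vec (dim_col A)" by (auto simp: mat_kernel_def)
    have "map_vec (subst w) (A *\<^sub>v map_vec (subst v) y) = 0\<^sub>v (dim_row A)"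
      using y hom[OF c] by (simp add: mat_kernel_def)
    then have "map_vec (subst v) (map_vec (subst w) (A *\<^sub>v map_vec (subst v) y)) = 0\<^sub>v (dim_row A)"
      by (simp add: subst.subst.vec_hom_zero)
    then have "map_vec (subst v) y \<in> mat_kernel A" using c by (simp add: mat_kernel_def)
    then have "map_vec (subst w) (map_vec (subst v) y) \<in> map_vec (subst w) ` mat_kernel A" by (rule imageI)
    then show "y \<in> map_vec (subst w) ` mat_kernel A" by simp
  next
    fix y assume "y \<in> map_vec (subst w) ` mat_kernel A"
    then show "y \<in> mat_kernel (map_mat (subst w) A)"
      by (auto simp: mat_kernel_def hom subst.subst.vec_hom_zero)
  qed
qed

lemma graded_map_map: "graded_map src tgt A \<Longrightarrow> graded_map src tgt (map_mat (subst w) A)"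
  by (auto simp: graded_map_def intro!: homogeneous_subst homogeneous_w)

lemma subst_in_irrelevant_ideal:
  assumes "f \<in> irrelevant_ideal" shows "subst w f \<in> irrelevant_ideal"
proof -
  obtain a where "f = (\<Sum>i\<in>UNIV. a i * var i)"
    using assms unfolding irrelevant_ideal_def ideal_gen_triple by blast
  then have "subst w f = subst w (a 0) * w 0 + subst w (a 1) * w 1 + subst w (a 2) * w 2"
    by (simp add: sum_3 subst.subst_poly_add subst.subst_poly_mult)
  moreover have "w i \<in> irrelevant_ideal" for i
    using homogeneous_in_irrelevant_ideal[OF homogeneous_w] by simp
  ultimately show ?thesis
    unfolding irrelevant_ideal_def by (auto intro!: ideal_gen_add ideal_gen_mult)
qed

text \<open>An automorphism of \<open>S\<close> applied entrywise carries images to images and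
  kernels to kernels. Being linear on the variables, it also preserves degrees and the ideal that
  the variables generate.\<close>

lemma minimal_graded_free_resolution_subst:
  assumes "minimal_graded_free_resolution I F \<phi>"
  shows "minimal_graded_free_resolution (subst w ` I) F (map (map_mat (subst w)) \<phi>)"
proof -
  note R = assms[unfolded minimal_graded_free_resolution_def]
  have ne: "\<phi> \<noteq> []" using R by blast
  have "{x \<in> carrier_vec 1. x $ 0 \<in> subst w ` I} = map_vec (subst w) ` {x \<in> carrier_vec 1. x $ 0 \<in> I}"
  proof (intro equalityI subsetI)
    fix y assume y: "y \<in> {x \<in> carrier_vec 1. x $ 0 \<in> subst w ` I}"
    then have "map_vec (subst v) y \<in> {x \<in> carrier_vec 1. x $ 0 \<in> I}" by auto
    then have "map_vec (subst w) (map_vec (subst v) y) \<in> map_vec (subst w) ` {x \<in> carrier_vec 1. x $ 0 \<in> I}"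
      by (rule imageI)
    then show "y \<in> map_vec (subst w) ` {x \<in> carrier_vec 1. x $ 0 \<in> I}" by simp
  qed auto
  moreover have "elements_mat (map_mat (subst w) A) \<subseteq> irrelevant_ideal"
    if "elements_mat A \<subseteq> irrelevant_ideal" for A
    using that by (auto simp: elements_mat_def intro!: subst_in_irrelevant_ideal)
  moreover have "map_vec (subst w) ` {0\<^sub>v n} = {0\<^sub>v n}" for n
    by (simp add: subst.subst.vec_hom_zero)
  ultimately show ?thesis
    using R ne unfolding minimal_graded_free_resolution_def
    by (simp add: last_map mat_image_map mat_kernel_map graded_map_map)
qed

text \<open>By the chain rule the derivatives of \<open>subst v f\<close> are combinations of the
  derivatives of \<open>f\<close> with \<open>v\<close> substituted, and \<open>w\<close> undoes
  that substitution.\<close>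

lemma subst_jacobian_ideal_subset: "subst w ` jacobian_ideal (subst v f) \<subseteq> jacobian_ideal f"
proof
  fix g assume "g \<in> subst w ` jacobian_ideal (subst v f)"
  then obtain h where gh: "g = subst w h" and h: "h \<in> jacobian_ideal (subst v f)" by blast
  from h obtain a where "h = (\<Sum>j\<in>UNIV. a j * partial_deriv j (subst v f))"
    unfolding jacobian_ideal_def ideal_gen_triple by blast
  with gh have g: "g = subst w (\<Sum>j\<in>UNIV. a j * partial_deriv j (subst v f))" by simp
  have "g = (\<Sum>i\<in>UNIV. (\<Sum>j\<in>UNIV. subst w (a j * partial_deriv j (v i))) * partial_deriv i f)"
    by (simp add: g partial_deriv_subst sum_3 subst.subst_poly_add subst.subst_poly_mult algebra_simps)
  then show "g \<in> jacobian_ideal f"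
    unfolding jacobian_ideal_def ideal_gen_triple
    by (rule exI[of _ "\<lambda>i. \<Sum>j\<in>UNIV. subst w (a j * partial_deriv j (v i))"])
qed

lemma subst_jacobian_ideal: "subst w ` jacobian_ideal (subst v f) = jacobian_ideal f"
proof
  interpret v: linear_change w v by (rule swap)
  have "subst v ` jacobian_ideal f \<subseteq> jacobian_ideal (subst v f)"
    using v.subst_jacobian_ideal_subset[of "subst v f"] by simp
  then have "subst w ` subst v ` jacobian_ideal f \<subseteq> subst w ` jacobian_ideal (subst v f)"
    by (rule image_mono)
  then show "jacobian_ideal f \<subseteq> subst w ` jacobian_ideal (subst v f)" by (simp add: image_image)
qed (rule subst_jacobian_ideal_subset)

lemma squarefree_subst:
  assumes "squarefree (subst v f)" shows "squarefree f"
  unfolding squarefree_def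
proof (intro allI impI)
  fix g assume "g ^ 2 dvd f"
  then have "subst v g ^ 2 dvd subst v f"
    by (metis subst.subst.hom_dvd subst.subst.hom_power)
  then have "subst v g dvd 1" using assms by (simp add: squarefree_def)
  then have "subst w (subst v g) dvd subst w 1" by (rule subst.subst.hom_dvd)
  then show "g dvd 1" by simp
qed

lemma plus_one_generated_subst:
  assumes "plus_one_generated (subst v f) d1 d2 d3" shows "plus_one_generated f d1 d2 d3"
proof -
  obtain d where d: "syzygy_curve d (subst v f) [d1, d2, d3]" "d1 + d2 = d" "d3 > d2"
    using assms by (auto simp: plus_one_generated_def)
  have "homogeneous (int d) f" if "homogeneous (int d) (subst v f)"
    using homogeneous_subst[OF that, of w] homogeneous_w by simp
  then have "reduced_curve d f"
    using d(1) squarefree_subst[of f] by (auto simp: syzygy_curve_def reduced_curve_def)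
  then have "syzygy_curve d f [d1, d2, d3]"
    using d(1) minimal_graded_free_resolution_subst[of "jacobian_ideal (subst v f)"]
    unfolding syzygy_curve_def subst_jacobian_ideal by meson
  then show ?thesis using d by (auto simp: plus_one_generated_def)
qed

end

text \<open>On a monomial, \<open>var i\<close> times the \<open>i\<close>-th derivative multiplies
  by the exponent of \<open>var i\<close>, and these exponents add up to \<open>k\<close>.\<close>

lemma euler_homogeneous:
  assumes "homogeneous k f" shows "(\<Sum>i\<in>UNIV. var i * partial_deriv i f) = of_int k * f"
proof -
  have 1: "var i * partial_deriv i (Poly_Mapping.single m c)
      = of_nat (Poly_Mapping.lookup m i) * Poly_Mapping.single m c" for i m and c :: complex
  proof (cases "Poly_Mapping.lookup m i = 0")
    case False
    have "Poly_Mapping.single i 1 + (m - Poly_Mapping.single i 1) = m"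
      using monomial_diff_add[OF False, of "Poly_Mapping.single i 1"] by (simp add: add.commute)
    then have "var i * partial_deriv i (Poly_Mapping.single m c)
        = Poly_Mapping.single m (of_nat (Poly_Mapping.lookup m i) * c)"
      by (simp add: partial_deriv_single var_def mult_single)
    then show ?thesis by (metis add_0 mult_single single_of_nat)
  qed (simp add: partial_deriv_single)
  have "(\<Sum>i\<in>UNIV. var i * partial_deriv i (Poly_Mapping.single m (Poly_Mapping.lookup f m)))
      = of_int k * Poly_Mapping.single m (Poly_Mapping.lookup f m)" if "m \<in> Poly_Mapping.keys f" for m
  proof -
    have "of_int k = (of_int (\<Sum>i\<in>UNIV. int (Poly_Mapping.lookup m i)) :: mpoly3)"
      using assms that by (simp add: homogeneous_def)
    then show ?thesis by (simp add: 1 sum_distrib_right)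
  qed
  then have "(\<Sum>m\<in>Poly_Mapping.keys f. \<Sum>i\<in>UNIV. var i * partial_deriv i (Poly_Mapping.single m (Poly_Mapping.lookup f m)))
      = of_int k * (\<Sum>m\<in>Poly_Mapping.keys f. Poly_Mapping.single m (Poly_Mapping.lookup f m))"
    by (simp add: sum_distrib_left)
  also have "(\<Sum>m\<in>Poly_Mapping.keys f. \<Sum>i\<in>UNIV. var i * partial_deriv i (Poly_Mapping.single m (Poly_Mapping.lookup f m)))
     = (\<Sum>i\<in>UNIV. var i * partial_deriv i (\<Sum>m\<in>Poly_Mapping.keys f. Poly_Mapping.single m (Poly_Mapping.lookup f m)))"
    by (subst sum.swap) (simp add: sum_distrib_left)
  finally show ?thesis by (simp add: mpoly3_sum[symmetric])
qed

section \<open>Linear primes\<close>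

text \<open>The hypothesis says that \<open>v\<close> is the identity modulo \<open>p\<close>, and
  congruence modulo \<open>p\<close> is compatible with sums and products.\<close>

lemma dvd_diff_subst:
  assumes "\<And>i. p dvd var i - v i" shows "p dvd f - subst v f"
proof (induction f rule: mpoly3_induct)
  case (add f g)
  then have "p dvd (f - subst v f) + (g - subst v g)" by (rule dvd_add)
  then show ?case by (simp add: subst.subst_poly_add algebra_simps)
next
  case (mult f g)
  then have "p dvd (f - subst v f) * g + subst v f * (g - subst v g)" by (intro dvd_add dvd_mult dvd_mult2)
  then show ?case by (simp add: subst.subst_poly_mult algebra_simps)
qed (simp_all add: assms)

lemma dvd_iff_subst_eq_0:
  assumes "\<And>i. p dvd var i - v i" "subst v p = 0"
  shows "p dvd f \<longleftrightarrow> subst v f = 0"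
proof
  assume "p dvd f"
  then have "subst v p dvd subst v f" by (rule subst.subst.hom_dvd)
  then show "subst v f = 0" using assms(2) by simp
next
  assume "subst v f = 0"
  then show "p dvd f" using dvd_diff_subst[OF assms(1), of f] by simp
qed

text \<open>The multiples of \<open>p\<close> are exactly the kernel of \<open>subst v\<close>, a
  ring homomorphism into the integral domain \<open>S\<close>; such a kernel is a prime
  ideal.\<close>

lemma prime_elem_subst:
  assumes "p \<noteq> 0" "\<And>i. p dvd var i - v i" "subst v p = 0"
  shows "prime_elem p"
  unfolding prime_elem_def using assms(1)
  by (auto simp: dvd_iff_subst_eq_0[OF assms(2,3)] subst.subst_poly_mult)

definition pt :: "complex \<Rightarrow> complex \<Rightarrow> complex \<Rightarrow> 3 \<Rightarrow> complex" where
  "pt a b c = (\<lambda>i. if i = 0 then a else if i = 1 then b else c)"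

lemma pt_simps [simp]: "pt a b c 0 = a" "pt a b c 1 = b" "pt a b c 2 = c"
  by (simp_all add: pt_def)

lemma pt_eqI: "P 0 = a \<Longrightarrow> P 1 = b \<Longrightarrow> P 2 = c \<Longrightarrow> P = pt a b c"
  using forall_3[of "\<lambda>i. P i = pt a b c i"] by auto

definition zero_z :: "3 \<Rightarrow> mpoly3" where
  "zero_z = (\<lambda>i. if i = 2 then 0 else var i)"

lemma zero_z_simps [simp]: "zero_z 0 = var 0" "zero_z 1 = var 1" "zero_z 2 = 0"
  by (simp_all add: zero_z_def)

lemma var_neq_0 [simp]: "var i \<noteq> 0"
  using eval_var[of "\<lambda>_. 1" i] by (auto simp del: eval_var)

lemma prime_elem_var: "prime_elem (var i)"
  by (rule prime_elem_subst[of _ "\<lambda>j. if j = i then 0 else var j"]) auto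

lemma var2_dvd_iff: "var 2 dvd f \<longleftrightarrow> subst zero_z f = 0"
  by (rule dvd_iff_subst_eq_0) (auto simp: zero_z_def)

text \<open>The parameters \<open>(a, b)\<close> give the direction in which the form vanishes, not
  its coefficients: this is the line joining \<open>(0, 0, 1)\<close> to
  \<open>(a, b, 0)\<close>.\<close>

definition line :: "complex \<Rightarrow> complex \<Rightarrow> mpoly3" where
  "line a b = const b * var 0 - const a * var 1"

lemma eval_line [simp]: "eval P (line a b) = b * P 0 - a * P 1"
  by (simp add: line_def eval.hom_minus eval_mult)

lemma prime_elem_line:
  assumes "a \<noteq> 0 \<or> b \<noteq> 0" shows "prime_elem (line a b)"
proof -
  have ne: "line a b \<noteq> 0"
  proof
    assume "line a b = 0"
    then have "eval (pt 1 0 0) (line a b) = 0" "eval (pt 0 1 0) (line a b) = 0" by simp_all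
    then show False using assms by simp
  qed
  show ?thesis
  proof (cases "b = 0")
    case False
    let ?v = "\<lambda>i. if i = 0 then const (a / b) * var 1 else var i"
    have b: "const (1 / b) * const b = 1" "const (1 / b) * const a = const (a / b)"
      "const b * const (a / b) = const a"
      using False by (simp_all add: const.hom_mult[symmetric])
    have "const (1 / b) * line a b = var 0 - const (a / b) * var 1"
      by (simp add: line_def right_diff_distrib mult.assoc[symmetric] b)
    then have "line a b dvd var 0 - const (a / b) * var 1" by (metis dvd_triv_right)
    then show ?thesis
      by (intro prime_elem_subst[of _ ?v] ne)
        (auto simp: line_def subst.subst.hom_minus subst.subst_poly_mult b mult.assoc[symmetric])
  next
    case True
    then have a: "a \<noteq> 0" using assms by simp
    let ?v = "\<lambda>i. if i = 1 then 0 else var i"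
    have "const (1 / a) * const a = 1" using a by (simp add: const.hom_mult[symmetric])
    then have "- const (1 / a) * line a b = var 1"
      by (simp add: line_def True mult.assoc[symmetric])
    then have "line a b dvd var 1" by (metis dvd_triv_right)
    then show ?thesis
      by (intro prime_elem_subst[of _ ?v] ne) (auto simp: line_def True subst.subst_poly_mult subst.subst.hom_uminus)
  qed
qed

lemma line_dvd_eval:
  assumes "line a b dvd f" "b * P 0 = a * P 1" shows "eval P f = 0"
proof -
  have "eval P (line a b) dvd eval P f" using assms(1) by (rule eval.hom_dvd)
  then show ?thesis using assms(2) by simp
qed

section \<open>Binary forms\<close>

text \<open>This is the homogenisation \<open>y ^ n * p (x / y)\<close>. Coding binary forms by
  univariate polynomials gives access to the fundamental theorem of algebra; a zero at
  \<open>(1, 0)\<close> shows as a drop of the degree of \<open>p\<close> below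
  \<open>n\<close>.\<close>

definition binform :: "nat \<Rightarrow> complex poly \<Rightarrow> mpoly3" where
  "binform n p = (\<Sum>i\<le>n. const (coeff p i) * var 0 ^ i * var 1 ^ (n - i))"

definition binary_form :: "nat \<Rightarrow> mpoly3 \<Rightarrow> bool" where
  "binary_form n h \<longleftrightarrow> (\<exists>p. Polynomial.degree p \<le> n \<and> h = binform n p)"

lemma binform_add: "binform n (p + q) = binform n p + binform n q"
  by (simp add: binform_def const.hom_add distrib_right sum.distrib)

lemma binform_smult: "binform n (Polynomial.smult c p) = const c * binform n p"
  by (simp add: binform_def const.hom_mult sum_distrib_left mult.assoc)

lemma binform_Suc:
  assumes "Polynomial.degree q \<le> n" shows "binform (Suc n) q = var 1 * binform n q"
proof -
  have "coeff q (Suc n) = 0" using assms by (simp add: coeff_eq_0)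
  then have "binform (Suc n) q = (\<Sum>i\<le>n. const (coeff q i) * var 0 ^ i * var 1 ^ (Suc n - i))"
    by (simp add: binform_def)
  also have "\<dots> = (\<Sum>i\<le>n. var 1 * (const (coeff q i) * var 0 ^ i * var 1 ^ (n - i)))"
    by (intro sum.cong) (simp_all add: Suc_diff_le mult_ac)
  finally show ?thesis by (simp add: binform_def sum_distrib_left)
qed

lemma binform_linear_factor:
  assumes "Polynomial.degree q \<le> n"
  shows "binform (Suc n) ([:- r, 1:] * q) = (var 0 - const r * var 1) * binform n q"
proof -
  have "coeff ([:- r, 1:] * q) i = - r * coeff q i + coeff (pCons 0 q) i" for i
    by (simp add: mult_pCons_left)
  then have "binform (Suc n) ([:- r, 1:] * q) = binform (Suc n) (Polynomial.smult (- r) q + pCons 0 q)"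
    by (simp add: binform_def)
  also have "\<dots> = const (- r) * binform (Suc n) q + binform (Suc n) (pCons 0 q)"
    by (simp only: binform_add binform_smult)
  also have "binform (Suc n) (pCons 0 q) = var 0 * binform n q"
    unfolding binform_def by (subst sum.atMost_Suc_shift) (simp add: sum_distrib_left mult_ac)
  also have "binform (Suc n) q = var 1 * binform n q" using assms by (rule binform_Suc)
  finally show ?thesis by (simp add: const.hom_uminus algebra_simps)
qed

lemma homogeneous_binform: "homogeneous (int n) (binform n p)"
  unfolding binform_def
proof (rule homogeneous_sum)
  fix i assume "i \<in> {..n}"
  then have "int n = 0 + int i * 1 + int (n - i) * 1" by simp
  then show "homogeneous (int n) (const (coeff p i) * var 0 ^ i * var 1 ^ (n - i))"
    by (metis homogeneous_const homogeneous_mult homogeneous_power homogeneous_var)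
qed

lemma binary_form_homogeneous: "binary_form n h \<Longrightarrow> homogeneous (int n) h"
  by (auto simp: binary_form_def homogeneous_binform)

lemma binary_form_0 [simp, intro]: "binary_form n 0"
  by (auto simp: binary_form_def binform_def intro!: exI[of _ 0])

lemma binary_form_add: "binary_form n g \<Longrightarrow> binary_form n h \<Longrightarrow> binary_form n (g + h)"
  unfolding binary_form_def by (metis binform_add degree_add_le)

lemma binary_form_const_mult: "binary_form n h \<Longrightarrow> binary_form n (const c * h)"
  unfolding binary_form_def by (metis binform_smult degree_smult_le order_trans)

lemma binary_form_monomial: "i \<le> n \<Longrightarrow> binary_form n (const c * var 0 ^ i * var 1 ^ (n - i))"
proof -
  assume i: "i \<le> n"
  have "const (if i = j then c else 0) * var 0 ^ j * var 1 ^ (n - j)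
     = (if i = j then const c * var 0 ^ j * var 1 ^ (n - j) else 0)" for j by simp
  then have "binform n (Polynomial.monom c i) = const c * var 0 ^ i * var 1 ^ (n - i)"
    using i by (simp add: binform_def coeff_monom)
  then show ?thesis using i unfolding binary_form_def
    by (metis degree_monom_le order_trans)
qed

lemma eval_binform: "eval P (binform n p) = (\<Sum>i\<le>n. coeff p i * P 0 ^ i * P 1 ^ (n - i))"
  by (simp add: binform_def eval.hom_sum eval_mult eval.hom_power)

lemma eval_binary_form: "binary_form n h \<Longrightarrow> eval P h = eval (pt (P 0) (P 1) c) h"
  by (auto simp: binary_form_def eval_binform)

lemma partial_deriv_binary_form: "binary_form n h \<Longrightarrow> partial_deriv 2 h = 0"
  by (auto simp: binary_form_def binform_def partial_deriv_mult partial_deriv_power)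

lemma subst_binary_form:
  assumes "binary_form n h" "v 0 = var 0" "v 1 = var 1" shows "subst v h = h"
  using assms by (auto simp: binary_form_def binform_def subst.subst.hom_sum subst.subst_poly_mult subst.subst.hom_power)

lemma binary_form_factor:
  assumes h: "binary_form (Suc n) h" and ab: "a \<noteq> 0 \<or> b \<noteq> 0" and z: "eval (pt a b c) h = 0"
  obtains g where "binary_form n g" "h = line a b * g"
proof -
  obtain p where p: "Polynomial.degree p \<le> Suc n" "h = binform (Suc n) p"
    using h by (auto simp: binary_form_def)
  show thesis
  proof (cases "b = 0")
    case False
    have "pt a b 0 = (\<lambda>i. b * pt (a / b) 1 0 i)"
      using False by (intro pt_eqI[symmetric]) simp_all
    then have "b ^ Suc n * eval (pt (a / b) 1 0) h = 0"
      using z eval_scale[of "Suc n" h b "pt (a / b) 1 0"] binary_form_homogeneous[OF h]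
        eval_binary_form[OF h, of "pt a b c" 0] by simp
    then have "(\<Sum>i\<le>Suc n. coeff p i * (a / b) ^ i) = 0"
      using False by (simp add: p(2) eval_binform)
    moreover have "poly p (a / b) = (\<Sum>i\<le>Suc n. coeff p i * (a / b) ^ i)"
      unfolding poly_altdef using p(1) by (intro sum.mono_neutral_left) (auto simp: coeff_eq_0)
    ultimately have "poly p (a / b) = 0" by simp
    then obtain q where q: "p = [:- (a / b), 1:] * q" by (auto simp: poly_eq_0_iff_dvd)
    have "Polynomial.degree q \<le> n"
    proof (cases "q = 0")
      case False
      then have "Polynomial.degree p = 1 + Polynomial.degree q"
        unfolding q by (subst degree_mult_eq) auto
      then show ?thesis using p(1) by simp
    qed simp
    then have "h = (var 0 - const (a / b) * var 1) * binform n q" "binary_form n (binform n q)"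
      using p(2) q binform_linear_factor by (auto simp: binary_form_def)
    moreover have "var 0 - const (a / b) * var 1 = line a b * const (1 / b)"
    proof -
      have "const b * const (1 / b) = 1" "const a * const (1 / b) = const (a / b)"
        using False by (simp_all add: const.hom_mult[symmetric])
      moreover have "line a b * const (1 / b) = const b * const (1 / b) * var 0 - const a * const (1 / b) * var 1"
        by (simp add: line_def algebra_simps)
      ultimately show ?thesis by simp
    qed
    ultimately show thesis
      using that[of "const (1 / b) * binform n q"] binary_form_const_mult by (simp add: mult.assoc)
  next
    \<comment> \<open>The zero is at infinity: evaluation there isolates the coefficient of degree
      \<open>Suc n\<close>, and its vanishing allows \<open>var 1\<close> to be split off.\<close>
    case True
    then have a: "a \<noteq> 0" using ab by simp
    have "(\<Sum>i\<le>Suc n. coeff p i * a ^ i * 0 ^ (Suc n - i)) = 0"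
      using z by (simp only: p(2) eval_binform pt_simps True)
    moreover have "(\<Sum>i\<le>n. coeff p i * a ^ i * 0 ^ (Suc n - i)) = 0"
      by (intro sum.neutral) auto
    ultimately have "coeff p (Suc n) = 0" using a by simp
    then have "Polynomial.degree p \<le> n"
      using p(1) by (metis degree_0 le_SucE le0 leading_coeff_0_iff)
    then have "h = var 1 * binform n p" "binary_form n (binform n p)"
      using p(2) binform_Suc by (auto simp: binary_form_def)
    moreover have "var 1 = line a b * const (- 1 / a)"
    proof -
      have "const a * const (- 1 / a) = - 1"
        using a by (simp add: const.hom_mult[symmetric] const.hom_uminus)
      moreover have "line a b * const (- 1 / a) = - (const a * const (- 1 / a) * var 1)"
        by (simp add: line_def True mult_ac)
      ultimately show ?thesis by simp
    qed
    ultimately show thesis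
      using that[of "const (- 1 / a) * binform n p"] binary_form_const_mult by (simp add: mult.assoc)
  qed
qed

lemma binary_form_root:
  assumes "binary_form (Suc n) h"
  obtains a b where "a \<noteq> 0 \<or> b \<noteq> 0" "\<And>c. eval (pt a b c) h = 0"
proof -
  obtain p where p: "Polynomial.degree p \<le> Suc n" "h = binform (Suc n) p"
    using assms by (auto simp: binary_form_def)
  show thesis
  proof (cases "Polynomial.degree p = Suc n")
    case False
    then have "Polynomial.degree p \<le> n" using p(1) by simp
    then have "h = var 1 * binform n p" using p(2) binform_Suc by simp
    then have "eval (pt 1 0 c) h = 0" for c by (simp add: eval_mult)
    then show thesis using that[of 1 0] by simp
  next
    case True
    then have "\<not> constant (poly p)" by (simp add: constant_degree)
    then obtain r where "poly p r = 0" using fundamental_theorem_of_algebra by blast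
    moreover have "poly p r = (\<Sum>i\<le>Suc n. coeff p i * r ^ i)"
      unfolding poly_altdef True ..
    ultimately have "eval (pt r 1 c) h = 0" for c by (simp add: p(2) eval_binform)
    then show thesis using that[of r 1] by simp
  qed
qed

lemma binary_form_0_const: "binary_form 0 h \<Longrightarrow> \<exists>c. h = const c"
  by (auto simp: binary_form_def binform_def)

text \<open>By induction on the degree, \<open>h\<close> loses one linear prime at a time. None of
  these primes divides \<open>p\<close>, since \<open>p\<close> is nonzero at the corresponding zero
  with \<open>z = 0\<close>, so each of them divides \<open>m\<close>.\<close>

lemma binary_form_coprime_dvd:
  assumes "binary_form n h"
    and "\<And>a b. a \<noteq> 0 \<or> b \<noteq> 0 \<Longrightarrow> eval (pt a b 0) h = 0 \<Longrightarrow> eval (pt a b 0) p \<noteq> 0"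
    and "h dvd m * p"
  shows "h dvd m"
  using assms
proof (induction n arbitrary: h m)
  case 0
  then obtain c where c: "h = const c" using binary_form_0_const by blast
  show ?case
  proof (cases "c = 0")
    case True
    \<comment> \<open>Here \<open>h = 0\<close>; the hypothesis at \<open>(1, 0)\<close> excludes
      \<open>p = 0\<close>, so \<open>h dvd m * p\<close> leaves only \<open>m = 0\<close>.\<close>
    then have "p \<noteq> 0" using 0(2)[of 1 0] c by auto
    then show ?thesis using 0(3) c True by simp
  next
    case False
    then have "h * const (1 / c) = 1" by (simp add: c const.hom_mult[symmetric])
    then have "h dvd 1" by (metis dvd_triv_left)
    then show ?thesis by (rule dvd_trans) simp
  qed
next
  case (Suc n)
  obtain a b where ab: "a \<noteq> 0 \<or> b \<noteq> 0" "\<And>c. eval (pt a b c) h = 0"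
    using binary_form_root[OF Suc.prems(1)] by blast
  obtain g where g: "binary_form n g" "h = line a b * g"
    using binary_form_factor[OF Suc.prems(1) ab] by blast
  have prime: "prime_elem (line a b)" by (rule prime_elem_line) (rule ab(1))
  have "\<not> line a b dvd p" using line_dvd_eval[of a b p "pt a b 0"] Suc.prems(2)[OF ab] by auto
  moreover have "line a b dvd m * p" using Suc.prems(3) g(2) by (metis dvd_mult_left)
  ultimately obtain m' where m: "m = line a b * m'"
    using prime prime_elem_dvd_multD by blast
  have "g dvd m' * p"
    using Suc.prems(3) prime by (simp add: g(2) m mult.assoc prime_elem_def)
  then have "g dvd m'"
  proof (rule Suc.IH[OF g(1), rotated])
    fix c d :: complex assume "c \<noteq> 0 \<or> d \<noteq> 0" "eval (pt c d 0) g = 0"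
    then show "eval (pt c d 0) p \<noteq> 0" by (intro Suc.prems(2)) (simp_all add: g(2) eval_mult)
  qed
  then show ?case by (simp add: g(2) m)
qed

lemma binary_form_prod_lines:
  assumes "binary_form (n + k) h"
    and "\<And>i. i < k \<Longrightarrow> a i \<noteq> 0 \<or> b i \<noteq> 0"
    and "\<And>i. i < k \<Longrightarrow> eval (pt (a i) (b i) 0) h = 0"
    and "\<And>i j. i < k \<Longrightarrow> j < k \<Longrightarrow> i \<noteq> j \<Longrightarrow> b i * a j \<noteq> a i * b j"
  obtains g where "binary_form n g" "h = (\<Prod>i<k. line (a i) (b i)) * g"
  using assms
proof (induction k arbitrary: n thesis)
  case 0
  then show ?case by simp
next
  case (Suc k)
  obtain g where g: "binary_form (Suc n) g" "h = (\<Prod>i<k. line (a i) (b i)) * g"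
    using Suc.IH[of "Suc n"] Suc.prems(2-5) by auto
  have "eval (pt (a k) (b k) 0) (\<Prod>i<k. line (a i) (b i)) \<noteq> 0"
    using Suc.prems(5) by (auto simp: eval.hom_prod)
  then have "eval (pt (a k) (b k) 0) g = 0"
    using Suc.prems(4)[of k] by (simp add: g(2) eval_mult)
  then obtain g' where "binary_form n g'" "g = line (a k) (b k) * g'"
    using binary_form_factor[OF g(1) Suc.prems(3)[of k]] by blast
  then show ?case using Suc.prems(1)[of g'] g(2) by (simp add: mult_ac)
qed

lemma homogeneous_z_expansion:
  assumes "homogeneous (int n) f"
  obtains h where "\<And>k. k \<le> n \<Longrightarrow> binary_form (n - k) (h k)" "f = (\<Sum>k\<le>n. var 2 ^ k * h k)"
proof -
  define D where "D = {f. \<exists>h. (\<forall>k\<le>n. binary_form (n - k) (h k)) \<and> f = (\<Sum>k\<le>n. var 2 ^ k * h k)}"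
  have D0: "0 \<in> D" unfolding D_def by (auto intro!: exI[of _ "\<lambda>_. 0"])
  have Dadd: "f + g \<in> D" if fg: "f \<in> D" "g \<in> D" for f g
  proof -
    obtain h where "\<forall>k\<le>n. binary_form (n - k) (h k)" "f = (\<Sum>k\<le>n. var 2 ^ k * h k)"
      using fg(1) unfolding D_def by blast
    moreover obtain h' where "\<forall>k\<le>n. binary_form (n - k) (h' k)" "g = (\<Sum>k\<le>n. var 2 ^ k * h' k)"
      using fg(2) unfolding D_def by blast
    ultimately have "(\<forall>k\<le>n. binary_form (n - k) (h k + h' k)) \<and> f + g = (\<Sum>k\<le>n. var 2 ^ k * (h k + h' k))"
      by (simp add: binary_form_add distrib_left sum.distrib)
    then show ?thesis unfolding D_def by (intro CollectI exI[of _ "\<lambda>k. h k + h' k"])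
  qed
  have Dsingle: "Poly_Mapping.single m (Poly_Mapping.lookup f m) \<in> D" if "m \<in> Poly_Mapping.keys f" for m
  proof -
    let ?l = "Poly_Mapping.lookup m" and ?c = "Poly_Mapping.lookup f m"
    have "int (?l 0 + ?l 1 + ?l 2) = int n"
      using assms that by (simp add: homogeneous_def sum_3)
    then have n: "n = ?l 0 + ?l 1 + ?l 2" by simp
    let ?h = "\<lambda>k. if k = ?l 2 then const ?c * var 0 ^ ?l 0 * var 1 ^ ?l 1 else 0"
    have "\<forall>k\<le>n. binary_form (n - k) (?h k)"
      using binary_form_monomial[of "?l 0" "n - ?l 2" ?c] n by simp
    moreover have "Poly_Mapping.single m ?c = (\<Sum>k\<le>n. var 2 ^ k * ?h k)"
    proof -
      have "(\<Sum>k\<le>n. var 2 ^ k * ?h k) = (\<Sum>k\<le>n. if k = ?l 2 then var 2 ^ k * (const ?c * var 0 ^ ?l 0 * var 1 ^ ?l 1) else 0)"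
        by (intro sum.cong) auto
      also have "\<dots> = var 2 ^ ?l 2 * (const ?c * var 0 ^ ?l 0 * var 1 ^ ?l 1)"
        using n by simp
      finally show ?thesis by (simp add: single_eq_const_mult prod_3 mult_ac)
    qed
    ultimately show ?thesis unfolding D_def by (intro CollectI exI[of _ ?h] conjI)
  qed
  have "(\<Sum>m\<in>M. Poly_Mapping.single m (Poly_Mapping.lookup f m)) \<in> D" if "M \<subseteq> Poly_Mapping.keys f" for M
    using finite_subset[OF that finite_keys] that
    by (induction M) (auto intro!: Dadd D0 Dsingle)
  from this[of "Poly_Mapping.keys f"] have "f \<in> D" by (simp add: mpoly3_sum[symmetric])
  then show thesis using that by (auto simp: D_def)
qed

section \<open>Four concurrent lines\<close>

text \<open>In \<open>k * p = d * e\<close> the prime \<open>p\<close> must divide \<open>e\<close>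
  and can be cancelled. The divisor \<open>d\<close> is later a square or the quadric
  \<open>L\<close>.\<close>

lemma prime_elem_dvd_mult_cancel:
  fixes d :: "'a :: idom"
  assumes "prime_elem p" "\<not> p dvd d" "d dvd k * p" shows "d dvd k"
proof -
  obtain e where e: "k * p = d * e" using assms(3) by (elim dvdE)
  then have "p dvd d * e" by (metis dvd_triv_right)
  then obtain e' where "e = p * e'" using assms(1,2) prime_elem_dvd_multD by blast
  then have "k * p = (d * e') * p" using e by (simp add: mult_ac)
  then have "k = d * e'" using assms(1) by (simp add: prime_elem_def)
  then show ?thesis by simp
qed

lemma dvd_mult_prod_primes_cancel:
  fixes d :: "'a :: idom" and n :: nat
  assumes "\<And>i. i < n \<Longrightarrow> prime_elem (l i)" "\<And>i. i < n \<Longrightarrow> \<not> l i dvd d"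
    and "d dvd k * (\<Prod>i<n. l i)"
  shows "d dvd k"
  using assms
proof (induction n)
  case (Suc n)
  have "d dvd k * (\<Prod>i<n. l i) * l n" using Suc.prems(3) by (simp add: mult_ac)
  then have "d dvd k * (\<Prod>i<n. l i)"
    using prime_elem_dvd_mult_cancel Suc.prems(1,2)[of n] by blast
  then show ?case using Suc by simp
qed simp

text \<open>Once \<open>w\<close> is the product of the earlier primes times \<open>u\<close>, the
  last prime divides none of the earlier ones and hence divides \<open>u\<close>.\<close>

lemma prod_primes_dvd:
  fixes w :: "'a :: idom" and n :: nat
  assumes "\<And>i. i < n \<Longrightarrow> prime_elem (l i)" "\<And>i. i < n \<Longrightarrow> l i dvd w"
    and "\<And>i j. i < n \<Longrightarrow> j < n \<Longrightarrow> i \<noteq> j \<Longrightarrow> \<not> l i dvd l j"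
  shows "(\<Prod>i<n. l i) dvd w"
  using assms
proof (induction n)
  case (Suc n)
  then have "(\<Prod>i<n. l i) dvd w" by simp
  then obtain u where u: "w = (\<Prod>i<n. l i) * u" by (elim dvdE)
  have "\<not> l n dvd (\<Prod>i<m. l i)" if "m \<le> n" for m
    using that
  proof (induction m)
    case 0
    show ?case using Suc.prems(1)[of n] by (simp add: prime_elem_def)
  next
    case (Suc m)
    then show ?case
      using Suc.prems Suc.IH \<open>\<And>i. i < Suc n \<Longrightarrow> prime_elem (l i)\<close>[of n]
        \<open>\<And>i j. i < Suc n \<Longrightarrow> j < Suc n \<Longrightarrow> i \<noteq> j \<Longrightarrow> \<not> l i dvd l j\<close>[of n m]
      by (auto dest: prime_elem_dvd_multD)
  qed
  then have "\<not> l n dvd (\<Prod>i<n. l i)" by simp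
  moreover have "l n dvd (\<Prod>i<n. l i) * u" using Suc.prems(2)[of n] u by simp
  ultimately have "l n dvd u" using Suc.prems(1)[of n] prime_elem_dvd_multD by blast
  then show ?case unfolding u by (simp add: mult_dvd_mono)
qed simp

section \<open>Small matrices, and the arrangement in adapted coordinates\<close>

lemma mult_mat_vec_3:
  assumes "x \<in> carrier_vec 3"
  shows "mat_of_rows_list 3 rs *\<^sub>v x = vec_of_list (map (\<lambda>r. r ! 0 * x $ 0 + r ! 1 * x $ 1 + r ! 2 * x $ 2) rs)"
  using assms
  by (intro eq_vecI)
    (auto simp: mat_of_rows_list_def scalar_prod_def numeral_3_eq_3 vec_of_list_index numeral_2_eq_2)

lemma mult_mat_vec_1:
  fixes x :: "'a :: comm_semiring_0 vec"
  assumes "x \<in> carrier_vec 1"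
  shows "mat_of_rows_list 1 rs *\<^sub>v x = vec_of_list (map (\<lambda>r. r ! 0 * x $ 0) rs)"
  using assms
  by (intro eq_vecI) (auto simp: mat_of_rows_list_def scalar_prod_def vec_of_list_index)

lemma vec_3_eq_iff:
  "x \<in> carrier_vec 3 \<Longrightarrow> x = vec_of_list [a, b, c] \<longleftrightarrow> x $ 0 = a \<and> x $ 1 = b \<and> x $ 2 = c"
  by (auto simp: vec_eq_iff numeral_3_eq_3 numeral_2_eq_2 less_Suc_eq)

lemma vec_1_eq_iff: "x \<in> carrier_vec 1 \<Longrightarrow> x = vec_of_list [a] \<longleftrightarrow> x $ 0 = a"
  by (auto simp: vec_eq_iff)

lemma homogeneous_multI: "homogeneous k f \<Longrightarrow> homogeneous l g \<Longrightarrow> n = k + l \<Longrightarrow> homogeneous n (f * g)"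
  using homogeneous_mult by blast

lemma homogeneous_powerI: "homogeneous k f \<Longrightarrow> m = int n * k \<Longrightarrow> homogeneous m (f ^ n)"
  using homogeneous_power by blast

text \<open>What is kept of the quartic and its bitangents once the common point is
  \<open>(0, 0, 1)\<close>: \<open>discriminant\<close> makes the lines the zeros of
  \<open>A\<^sup>2 - 4 * B\<close>, and \<open>coprime\<close> says that \<open>B\<close> and the
  Jacobian determinant of \<open>A, B\<close> have no common zero. Binary forms do not involve
  \<open>z\<close>, so points with \<open>z = 0\<close> suffice.\<close>

locale quadruple_point =
  fixes A B :: mpoly3 and a b :: "nat \<Rightarrow> complex" and c :: complex
  assumes A: "binary_form 2 A" and B: "binary_form 4 B"
    and ab: "i < 4 \<Longrightarrow> a i \<noteq> 0 \<or> b i \<noteq> 0"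
    and distinct: "i < 4 \<Longrightarrow> j < 4 \<Longrightarrow> i \<noteq> j \<Longrightarrow> b i * a j \<noteq> a i * b j"
    and c: "c \<noteq> 0"
    and discriminant: "A\<^sup>2 - 4 * B = const c * (\<Prod>i<4. line (a i) (b i))"
    and coprime: "s \<noteq> 0 \<or> t \<noteq> 0 \<Longrightarrow> eval (pt s t 0) B = 0 \<Longrightarrow>
      eval (pt s t 0) (partial_deriv 0 A * partial_deriv 1 B - partial_deriv 1 A * partial_deriv 0 B) \<noteq> 0"
begin

abbreviation x :: mpoly3 where "x \<equiv> var 0"
abbreviation y :: mpoly3 where "y \<equiv> var 1"
abbreviation z :: mpoly3 where "z \<equiv> var 2"
abbreviation l :: "nat \<Rightarrow> mpoly3" where "l i \<equiv> line (a i) (b i)"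

definition Q :: mpoly3 where "Q = z ^ 4 + z ^ 2 * A + B"
definition G :: mpoly3 where "G = A\<^sup>2 - 4 * B"
definition L :: mpoly3 where "L = 2 * z ^ 2 + A"
definition J :: mpoly3 where
  "J = partial_deriv 0 A * partial_deriv 1 B - partial_deriv 1 A * partial_deriv 0 B"
definition F :: mpoly3 where "F = Q * (\<Prod>i<4. l i)"

lemma G_eq: "G = const c * (\<Prod>i<4. l i)" by (simp add: G_def discriminant)

lemma four_Q: "4 * Q = L\<^sup>2 - G"
  by (simp add: Q_def L_def G_def power2_eq_square power4_eq_xxxx algebra_simps)

lemma euler_A: "x * partial_deriv 0 A + y * partial_deriv 1 A = 2 * A"
  using euler_homogeneous[OF binary_form_homogeneous[OF A]] partial_deriv_binary_form[OF A]
  by (simp add: sum_3)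

lemma euler_B: "x * partial_deriv 0 B + y * partial_deriv 1 B = 4 * B"
  using euler_homogeneous[OF binary_form_homogeneous[OF B]] partial_deriv_binary_form[OF B]
  by (simp add: sum_3)

lemma deriv_Q:
  "partial_deriv 0 Q = z\<^sup>2 * partial_deriv 0 A + partial_deriv 0 B"
  "partial_deriv 1 Q = z\<^sup>2 * partial_deriv 1 A + partial_deriv 1 B"
  "partial_deriv 2 Q = 2 * z * L"
  using partial_deriv_binary_form[OF A] partial_deriv_binary_form[OF B]
  by (simp_all add: Q_def L_def partial_deriv_mult partial_deriv_power algebra_simps
      power2_eq_square power3_eq_cube)

lemma deriv_G:
  "partial_deriv 0 G = 2 * A * partial_deriv 0 A - 4 * partial_deriv 0 B"
  "partial_deriv 1 G = 2 * A * partial_deriv 1 A - 4 * partial_deriv 1 B"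
  "partial_deriv 2 G = 0"
  using partial_deriv_binary_form[OF A] partial_deriv_binary_form[OF B]
  by (simp_all add: G_def partial_deriv_mult partial_deriv_power algebra_simps)

lemma euler_G: "x * partial_deriv 0 G + y * partial_deriv 1 G = 4 * G"
proof -
  have "x * partial_deriv 0 G + y * partial_deriv 1 G
      = 2 * A * (x * partial_deriv 0 A + y * partial_deriv 1 A) - 4 * (x * partial_deriv 0 B + y * partial_deriv 1 B)"
    by (simp add: deriv_G algebra_simps)
  also have "\<dots> = 2 * A * (2 * A) - 4 * (4 * B)" by (simp only: euler_A euler_B)
  also have "\<dots> = 4 * G" by (simp add: G_def power2_eq_square algebra_simps)
  finally show ?thesis .
qed

lemma euler_Q: "x * partial_deriv 0 Q + y * partial_deriv 1 Q = 4 * Q - 2 * z\<^sup>2 * L"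
proof -
  have "x * partial_deriv 0 Q + y * partial_deriv 1 Q
      = z\<^sup>2 * (x * partial_deriv 0 A + y * partial_deriv 1 A) + (x * partial_deriv 0 B + y * partial_deriv 1 B)"
    by (simp add: deriv_Q algebra_simps)
  also have "\<dots> = z\<^sup>2 * (2 * A) + 4 * B" by (simp only: euler_A euler_B)
  also have "\<dots> = 4 * Q - 2 * z\<^sup>2 * L"
    by (simp add: Q_def L_def power2_eq_square power4_eq_xxxx algebra_simps)
  finally show ?thesis .
qed

text \<open>For fixed \<open>z\<close> both \<open>Q\<close> and \<open>G\<close> are polynomials in
  \<open>A\<close> and \<open>B\<close>. Their Jacobian determinant in \<open>x, y\<close> is
  \<open>J\<close> times the one in \<open>A, B\<close>, and the latter is
  \<open>- 4 * z\<^sup>2 - 2 * A = - 2 * L\<close>.\<close>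

lemma jacobian_Q_G:
  "partial_deriv 0 Q * partial_deriv 1 G - partial_deriv 1 Q * partial_deriv 0 G = - 2 * J * L"
  by (simp add: deriv_Q deriv_G J_def L_def algebra_simps power2_eq_square)

lemma deriv_F:
  "const c * partial_deriv 0 F = partial_deriv 0 Q * G + Q * partial_deriv 0 G"
  "const c * partial_deriv 1 F = partial_deriv 1 Q * G + Q * partial_deriv 1 G"
  "const c * partial_deriv 2 F = 2 * z * L * G"
proof -
  \<comment> \<open>The factor \<open>const c\<close> turns the product of the lines into
    \<open>G\<close>, whose derivatives are explicit in those of \<open>A\<close> and
    \<open>B\<close>.\<close>
  have "const c * F = Q * G" by (simp add: F_def G_eq mult_ac)
  then have "partial_deriv i (const c * F) = partial_deriv i (Q * G)" for i by simp
  then have *: "const c * partial_deriv i F = partial_deriv i Q * G + Q * partial_deriv i G" for i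
    by (simp add: partial_deriv_mult)
  show "const c * partial_deriv 0 F = partial_deriv 0 Q * G + Q * partial_deriv 0 G"
    "const c * partial_deriv 1 F = partial_deriv 1 Q * G + Q * partial_deriv 1 G" by (rule *)+
  show "const c * partial_deriv 2 F = 2 * z * L * G" by (simp add: * deriv_Q deriv_G)
qed

lemma prime_l: "i < 4 \<Longrightarrow> prime_elem (l i)"
  by (rule prime_elem_line) (rule ab)

lemma l_dvd_G: "i < 4 \<Longrightarrow> l i dvd G"
  unfolding G_eq by (intro dvd_mult dvd_prodI) auto

lemma l_not_dvd_l: "i < 4 \<Longrightarrow> j < 4 \<Longrightarrow> i \<noteq> j \<Longrightarrow> \<not> l i dvd l j"
  using line_dvd_eval[of "a i" "b i" "l j" "pt (a i) (b i) 0"] distinct[of j i] by auto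

text \<open>At the points \<open>(a i, b i, w)\<close> of the line \<open>A\<close> does not depend
  on \<open>w\<close>, so the values of \<open>L\<close> for \<open>w = 0\<close> and
  \<open>w = 1\<close> differ by 2.\<close>

lemma l_not_dvd_L:
  assumes "i < 4" shows "\<not> l i dvd L"
proof
  assume "l i dvd L"
  then have *: "eval (pt (a i) (b i) w) L = 0" for w
    by (rule line_dvd_eval) simp
  have "eval (pt (a i) (b i) 1) A = eval (pt (a i) (b i) 0) A"
    using eval_binary_form[OF A, of "pt (a i) (b i) 1" 0] by simp
  then show False
    using *[of 0] *[of 1] by (simp add: L_def eval_add eval_mult eval.hom_power eval.hom_numeral)
qed

lemma l_not_dvd_Q:
  assumes "i < 4" shows "\<not> l i dvd Q"
proof
  assume "l i dvd Q"
  then have "l i dvd 4 * Q + G" using l_dvd_G[OF assms] by (intro dvd_add dvd_mult)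
  then have "l i dvd L * L" using four_Q by (simp add: power2_eq_square)
  then show False using prime_l[OF assms] l_not_dvd_L[OF assms] prime_elem_dvd_multD by blast
qed

text \<open>Only one factor of \<open>G\<close> vanishes at \<open>(a i, b i)\<close>, so the
  gradient of \<open>G\<close> there is a nonzero multiple of \<open>(b i, - a i)\<close>.\<close>

lemma l_not_dvd_deriv_G:
  assumes i: "i < 4" shows "\<not> (l i dvd partial_deriv 0 G \<and> l i dvd partial_deriv 1 G)"
proof
  assume *: "l i dvd partial_deriv 0 G \<and> l i dvd partial_deriv 1 G"
  define h where "h = const c * (\<Prod>j\<in>{..<4} - {i}. l j)"
  have G: "G = l i * h"
    using i by (simp add: G_eq h_def prod.remove[of "{..<4}" i] mult_ac)
  let ?P = "pt (a i) (b i) 0"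
  have "eval ?P h \<noteq> 0"
    using c distinct[of _ i] i by (auto simp: h_def eval_mult eval.hom_prod)
  have "eval ?P (partial_deriv 0 G) = 0" "eval ?P (partial_deriv 1 G) = 0"
    using * line_dvd_eval[of "a i" "b i" _ ?P] by auto
  then have "b i * eval ?P h = 0" "a i * eval ?P h = 0"
    by (simp_all add: G partial_deriv_mult line_def eval_add eval_mult eval.hom_minus eval.hom_uminus)
  with \<open>eval ?P h \<noteq> 0\<close> show False using ab[OF i] by simp
qed

lemma L_neq_0: "L \<noteq> 0" using l_not_dvd_L[of 0] by auto

lemma B_neq_0: "B \<noteq> 0" using coprime[of 1 0] by auto

lemma G_neq_0: "G \<noteq> 0"
  unfolding G_eq using c prime_l by (auto simp: prime_elem_def)

lemma Q_neq_0: "Q \<noteq> 0" using l_not_dvd_Q[of 0] by auto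

lemma F_neq_0: "F \<noteq> 0"
  unfolding F_def using Q_neq_0 prime_l by (auto simp: prime_elem_def)

lemma subst_zero_z_B: "subst zero_z B = B"
  by (rule subst_binary_form[OF B]) simp_all

lemma subst_zero_z_Q: "subst zero_z Q = B"
  by (simp add: Q_def subst.subst_poly_add subst.subst_poly_mult subst.subst.hom_power subst_zero_z_B)

lemma z_not_dvd_Q: "\<not> z dvd Q"
  by (simp add: var2_dvd_iff subst_zero_z_Q B_neq_0)

lemma z_not_dvd_J: "\<not> z dvd J"
proof
  assume "z dvd J"
  have "binary_form (Suc 3) B" using B by simp
  then obtain s t where st: "s \<noteq> 0 \<or> t \<noteq> 0" "\<And>u. eval (pt s t u) B = 0"
    by (rule binary_form_root) blast
  have "eval (pt s t 0) z dvd eval (pt s t 0) J" using \<open>z dvd J\<close> by (rule eval.hom_dvd)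
  then show False using coprime[OF st] by (simp add: J_def)
qed

text \<open>No line divides \<open>g\<close>, since each occurs only once in \<open>F\<close>; hence
  \<open>g\<^sup>2\<close> divides \<open>Q\<close>. Then \<open>g\<close> divides \<open>Q\<close>
  and its derivative \<open>2 * z * L\<close>, hence \<open>L\<close>, hence
  \<open>L\<^sup>2 - 4 * Q = G\<close>, a constant times the lines, and so \<open>g\<close> is a
  unit.\<close>

lemma squarefree_F: "squarefree F"
  unfolding squarefree_def
proof (intro allI impI)
  fix g assume g: "g\<^sup>2 dvd F"
  have l_g: "\<not> l i dvd g" if i: "i < 4" for i
  proof
    assume "l i dvd g"
    then have "l i * l i dvd g\<^sup>2" unfolding power2_eq_square by (intro mult_dvd_mono)
    then have "l i * l i dvd F" using g by (rule dvd_trans)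
    also have "F = l i * (Q * (\<Prod>j\<in>{..<4} - {i}. l j))"
      using i by (simp add: F_def prod.remove[of "{..<4}" i] mult_ac)
    finally have "l i dvd Q * (\<Prod>j\<in>{..<4} - {i}. l j)"
      using prime_l[OF i] by (simp add: prime_elem_def)
    then have "l i dvd (\<Prod>j\<in>{..<4} - {i}. l j)"
      using prime_l[OF i] l_not_dvd_Q[OF i] prime_elem_dvd_multD by blast
    then have "eval (pt (a i) (b i) 0) (\<Prod>j\<in>{..<4} - {i}. l j) = 0"
      by (rule line_dvd_eval) simp
    then show False using distinct[of _ i] i by (auto simp: eval.hom_prod)
  qed
  then have "\<not> l i dvd g\<^sup>2" if "i < 4" for i
    using that prime_l prime_elem_dvd_power by blast
  then have "g\<^sup>2 dvd Q"
    using g dvd_mult_prod_primes_cancel[of 4 l "g\<^sup>2" Q] prime_l by (simp add: F_def)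
  then obtain h where h: "Q = g\<^sup>2 * h" by (elim dvdE)
  then have "g dvd Q" by (simp add: power2_eq_square)
  have "partial_deriv 2 Q = g * (2 * partial_deriv 2 g * h + g * partial_deriv 2 h)"
    unfolding h by (simp add: partial_deriv_mult power2_eq_square algebra_simps)
  then have "g dvd 2 * z * L" using deriv_Q(3) by (metis dvd_triv_left)
  then have "g dvd const (1 / 2) * (2 * z * L)" by (rule dvd_mult)
  moreover have "const (1 / 2) * 2 = const (1 / 2 * 2)" by (simp only: const.hom_mult const.hom_numeral)
  then have "const (1 / 2) * 2 = 1" by (simp only: const.hom_one) simp
  moreover have "const (1 / 2) * (2 * z * L) = const (1 / 2) * 2 * (L * z)" by (simp only: mult_ac)
  ultimately have "g dvd L * z" by (simp only: mult_1_left)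
  moreover have "\<not> z dvd g" using z_not_dvd_Q \<open>g dvd Q\<close> dvd_trans by blast
  ultimately have "g dvd L" using prime_elem_dvd_mult_cancel prime_elem_var by blast
  then have "g dvd L\<^sup>2 - 4 * Q" using \<open>g dvd Q\<close> by (intro dvd_diff) (auto simp: power2_eq_square)
  then have "g dvd const c * (\<Prod>i<4. l i)" using four_Q G_eq by simp
  then have "g dvd const c" using dvd_mult_prod_primes_cancel[of 4 l g "const c"] prime_l l_g by blast
  moreover have "const c * const (1 / c) = 1" using c by (simp add: const.hom_mult[symmetric])
  ultimately show "g dvd 1" by (metis dvd_mult2)
qed

end

no_notation fps_nth (infixl \<open>$\<close> 75)

lemma mat_imageI: "v \<in> carrier_vec (dim_col M) \<Longrightarrow> M *\<^sub>v v \<in> mat_image M"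
  by (auto simp: mat_image_def)

lemma const_quarter: "const (1 / 4) * 4 = 1"
proof -
  have "const (1 / 4) * 4 = const (1 / 4 * 4)" by (simp only: const.hom_mult const.hom_numeral)
  then show ?thesis by (simp only: const.hom_one) simp
qed

lemma divide_by_4: "\<exists>k. w = 4 * (k :: mpoly3)"
proof
  show "w = 4 * (const (1 / 4) * w)" using const_quarter by (simp add: mult_ac)
qed

lemma zero_vec_3: "0\<^sub>v 3 = vec_of_list [0, 0, 0 :: 'a :: zero]"
  by (rule eq_vecI) (auto simp: vec_of_list_index numeral_3_eq_3 less_Suc_eq)

lemma zero_vec_1: "0\<^sub>v 1 = vec_of_list [0 :: 'a :: zero]"
  by (rule eq_vecI) (auto simp: vec_of_list_index)

lemma vec_of_list_3_eq_iff:
  "vec_of_list [a1, a2, a3] = vec_of_list [b1, b2, b3] \<longleftrightarrow> a1 = b1 \<and> a2 = b2 \<and> a3 = b3"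
  by (metis list.inject list_vec)

lemma vec_of_list_1_eq_iff: "vec_of_list [a1] = vec_of_list [b1] \<longleftrightarrow> a1 = b1"
  by (metis list.inject list_vec)

lemma homogeneous_line: "homogeneous 1 (line s t)"
  unfolding line_def
  by (intro homogeneous_diff homogeneous_multI[OF homogeneous_const homogeneous_var]) simp_all

lemma graded_map_elements:
  assumes "graded_map src tgt M" "\<forall>s\<in>set src. \<forall>t\<in>set tgt. s < t"
  shows "elements_mat M \<subseteq> irrelevant_ideal"
proof
  fix f assume "f \<in> elements_mat M"
  then obtain i j where "f = M $$ (i, j)" "i < length tgt" "j < length src"
    using assms(1) by (auto simp: elements_mat_def graded_map_def)
  then have "homogeneous (tgt ! i - src ! j) f" "tgt ! i - src ! j > 0"
    using assms by (auto simp: graded_map_def)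
  then show "f \<in> irrelevant_ideal" by (rule homogeneous_in_irrelevant_ideal)
qed

section \<open>The syzygy module of the gradient\<close>

context quadruple_point
begin

lemma syzygy_iff:
  "s0 * partial_deriv 0 F + s1 * partial_deriv 1 F + s2 * partial_deriv 2 F = 0 \<longleftrightarrow>
   Q * (s0 * partial_deriv 0 G + s1 * partial_deriv 1 G)
     + G * (s0 * partial_deriv 0 Q + s1 * partial_deriv 1 Q + 2 * z * L * s2) = 0"
proof -
  have "const c * (s0 * partial_deriv 0 F + s1 * partial_deriv 1 F + s2 * partial_deriv 2 F)
    = s0 * (const c * partial_deriv 0 F) + s1 * (const c * partial_deriv 1 F) + s2 * (const c * partial_deriv 2 F)"
    by (simp add: algebra_simps)
  also have "\<dots> = Q * (s0 * partial_deriv 0 G + s1 * partial_deriv 1 G)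
     + G * (s0 * partial_deriv 0 Q + s1 * partial_deriv 1 Q + 2 * z * L * s2)"
    unfolding deriv_F by (simp add: algebra_simps)
  finally show ?thesis using c by (metis const_eq_0_iff mult_eq_0_iff)
qed

text \<open>Every derivation preserving the four lines \<open>G = 0\<close> is a combination of the Euler
  derivation and of the Hamiltonian derivation of \<open>G\<close>.\<close>

lemma logarithmic_decomposition:
  assumes "\<And>i. i < 4 \<Longrightarrow> l i dvd s0 * partial_deriv 0 G + s1 * partial_deriv 1 G"
  obtains k m where "s0 = m * partial_deriv 1 G + k * x" "s1 = - m * partial_deriv 0 G + k * y"
proof -
  let ?T = "s0 * partial_deriv 0 G + s1 * partial_deriv 1 G" and ?w = "y * s0 - x * s1"
  have "l i dvd ?w" if i: "i < 4" for i
  proof -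
    \<comment> \<open>Cramer's rule for \<open>?T\<close> and Euler's relation: both
      \<open>?T\<close> and \<open>G\<close> vanish modulo the line, hence so does the determinant
      \<open>?w\<close> times each derivative of \<open>G\<close>.\<close>
    have "partial_deriv 0 G * ?w = y * ?T - s1 * (4 * G)" "partial_deriv 1 G * ?w = s0 * (4 * G) - x * ?T"
      unfolding euler_G[symmetric] by (simp_all add: algebra_simps)
    then have "l i dvd partial_deriv 0 G * ?w" "l i dvd partial_deriv 1 G * ?w"
      using assms[OF i] l_dvd_G[OF i] by (simp_all add: dvd_diff)
    then show ?thesis
      using prime_l[OF i] l_not_dvd_deriv_G[OF i] prime_elem_dvd_multD by blast
  qed
  then have "(\<Prod>i<4. l i) dvd ?w"
    by (intro prod_primes_dvd prime_l l_not_dvd_l)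
  then obtain u where u: "?w = (\<Prod>i<4. l i) * u" by (elim dvdE)
  \<comment> \<open>The Hamiltonian derivation \<open>(G\<^sub>y, - G\<^sub>x)\<close> has
    determinant \<open>4 * G\<close> against \<open>(x, y)\<close>. Subtracting \<open>m\<close>
    times it makes the determinant vanish and leaves a multiple of \<open>(x, y)\<close>.\<close>
  obtain m where m: "?w = 4 * G * m"
  proof -
    obtain u' where u': "u = 4 * u'" using divide_by_4 by blast
    have cc: "const c * const (1 / c) = 1" using c by (simp add: const.hom_mult[symmetric])
    have "4 * G * (const (1 / c) * u') = (const c * const (1 / c)) * ((\<Prod>i<4. l i) * (4 * u'))"
      by (simp only: G_eq mult_ac)
    also have "\<dots> = ?w" by (simp only: cc u u' mult_1_left)
    finally show thesis by (intro that[of "const (1 / c) * u'"]) (rule sym)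
  qed
  have eq: "y * (s0 - m * partial_deriv 1 G) = x * (s1 + m * partial_deriv 0 G)"
    using m unfolding euler_G[symmetric] by (simp add: algebra_simps)
  then have "x dvd y * (s0 - m * partial_deriv 1 G)" by simp
  moreover have "\<not> x dvd y"
  proof
    assume "x dvd y"
    then have "eval (pt 0 1 0) x dvd eval (pt 0 1 0) y" by (rule eval.hom_dvd)
    then show False by simp
  qed
  ultimately have "x dvd s0 - m * partial_deriv 1 G"
    using prime_elem_var prime_elem_dvd_multD by blast
  then obtain k where k: "s0 - m * partial_deriv 1 G = x * k" by (elim dvdE)
  then have "x * (s1 + m * partial_deriv 0 G) = x * (y * k)" using eq by (simp add: mult_ac)
  then have "s1 + m * partial_deriv 0 G = y * k" by simp
  with k show thesis by (intro that[of m k]) (simp_all add: algebra_simps)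
qed

text \<open>Applied to \<open>G\<close> and \<open>Q\<close>, the Euler part contributes
  \<open>4 * k * G\<close> and \<open>k * (4 * Q - 2 * z\<^sup>2 * L)\<close>, the Hamiltonian part
  0 and \<open>- 2 * m * J * L\<close>. The whole expression acquires the factor
  \<open>2 * G\<close>, which cancels.\<close>

lemma syzygy_decomposed_iff:
  assumes "s0 = m * partial_deriv 1 G + k * x" "s1 = - m * partial_deriv 0 G + k * y"
  shows "s0 * partial_deriv 0 F + s1 * partial_deriv 1 F + s2 * partial_deriv 2 F = 0
    \<longleftrightarrow> 4 * k * Q = L * (k * z\<^sup>2 + m * J - z * s2)"
proof -
  have 1: "s0 * partial_deriv 0 G + s1 * partial_deriv 1 G = k * (4 * G)"
    unfolding assms euler_G[symmetric] by (simp add: algebra_simps)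
  have "s0 * partial_deriv 0 Q + s1 * partial_deriv 1 Q
      = k * (x * partial_deriv 0 Q + y * partial_deriv 1 Q)
        + m * (partial_deriv 0 Q * partial_deriv 1 G - partial_deriv 1 Q * partial_deriv 0 G)"
    unfolding assms by (simp add: algebra_simps)
  also have "\<dots> = k * (4 * Q - 2 * z\<^sup>2 * L) - 2 * m * J * L"
    unfolding euler_Q jacobian_Q_G by (simp add: algebra_simps)
  finally have 2: "s0 * partial_deriv 0 Q + s1 * partial_deriv 1 Q = k * (4 * Q - 2 * z\<^sup>2 * L) - 2 * m * J * L" .
  have "Q * (s0 * partial_deriv 0 G + s1 * partial_deriv 1 G)
     + G * (s0 * partial_deriv 0 Q + s1 * partial_deriv 1 Q + 2 * z * L * s2)
     = 2 * G * (4 * k * Q - L * (k * z\<^sup>2 + m * J - z * s2))"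
    unfolding 1 2 by (simp add: algebra_simps)
  then show ?thesis unfolding syzygy_iff using G_neq_0 by simp
qed

text \<open>Modulo \<open>L\<close> the form \<open>4 * Q\<close> is \<open>- G\<close>, so
  \<open>L\<close> divides \<open>k * G\<close>. The four lines are primes not dividing
  \<open>L\<close> and are cancelled one by one.\<close>

lemma L_dvd_cancel:
  assumes "L dvd 4 * k * Q" shows "L dvd k"
proof -
  have "4 * k * Q = k * (4 * Q)" by (simp only: mult_ac)
  also have "\<dots> = L * (k * L) - k * G" unfolding four_Q by (simp add: power2_eq_square algebra_simps)
  finally have "4 * k * Q = L * (k * L) - k * G" .
  then have "L dvd k * G" using assms by (metis dvd_diff_right_iff dvd_triv_left)
  then have "L dvd (k * const c) * (\<Prod>i<4. l i)" by (simp add: G_eq mult_ac)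
  then have "L dvd k * const c"
    by (rule dvd_mult_prod_primes_cancel[rotated 2]) (auto simp: prime_l l_not_dvd_L)
  then have "L dvd k * const c * const (1 / c)" by (rule dvd_mult2)
  moreover have "const c * const (1 / c) = 1" using c by (simp add: const.hom_mult[symmetric])
  ultimately show ?thesis by (simp add: mult.assoc)
qed

text \<open>Regularity of \<open>z, 4 * Q, J\<close> is tested at \<open>z = 0\<close>: the relation
  there reads \<open>m J = 4 n B\<close>, and \<open>B\<close> has no zero in common with
  \<open>J\<close>, so \<open>B\<close> divides \<open>m\<close>. Lifting the quotient leaves errors
  divisible by \<open>z\<close>.\<close>

lemma koszul_mod_z:
  assumes "z * t = m * J - 4 * n * Q"
  obtains e m' n' where "m = 4 * Q * e + z * m'" "n = J * e + z * n'"
proof -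
  let ?\<sigma> = "subst zero_z"
  have \<sigma>: "?\<sigma> m * ?\<sigma> J = 4 * ?\<sigma> n * B"
  proof -
    have "?\<sigma> (z * t) = ?\<sigma> (m * J - 4 * n * Q)" using assms by simp
    then show ?thesis
      by (simp add: subst.subst_poly_mult subst.subst.hom_minus subst.subst.hom_numeral subst_zero_z_Q)
  qed
  have "B dvd ?\<sigma> m"
  proof (rule binary_form_coprime_dvd[OF B])
    show "B dvd ?\<sigma> m * ?\<sigma> J" unfolding \<sigma> by simp
    fix s t :: complex assume st: "s \<noteq> 0 \<or> t \<noteq> 0" "eval (pt s t 0) B = 0"
    have "(\<lambda>i. eval (pt s t 0) (zero_z i)) = pt s t 0" by (rule pt_eqI) simp_all
    then have "eval (pt s t 0) (?\<sigma> J) = eval (pt s t 0) J" by (simp add: eval_subst)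
    then show "eval (pt s t 0) (?\<sigma> J) \<noteq> 0" using coprime[OF st] by (simp add: J_def)
  qed
  then obtain e' where e': "?\<sigma> m = B * e'" by (elim dvdE)
  obtain e where e: "e' = 4 * e" using divide_by_4 by blast
  have m: "?\<sigma> m = 4 * B * e" using e' e by (simp add: mult_ac)
  \<comment> \<open>Idempotence serves to show that \<open>e\<close> is free of \<open>z\<close>;
    only then does \<open>4 * Q * e\<close> reduce to \<open>4 * B * e\<close> at
    \<open>z = 0\<close>.\<close>
  have idem: "?\<sigma> (?\<sigma> f) = ?\<sigma> f" for f
  proof -
    have "(\<lambda>i. ?\<sigma> (zero_z i)) = zero_z" by (rule ext) (simp add: zero_z_def)
    then show ?thesis by (simp add: subst_subst)
  qed
  have "4 * B * ?\<sigma> e = ?\<sigma> (4 * B * e)"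
    by (simp only: subst.subst_poly_mult subst.subst.hom_numeral subst_zero_z_B)
  also have "\<dots> = 4 * B * e" unfolding m[symmetric] by (rule idem)
  finally have "4 * B * ?\<sigma> e = 4 * B * e" .
  then have \<sigma>e: "?\<sigma> e = e" using B_neq_0 by simp
  have "4 * B * (?\<sigma> n) = ?\<sigma> m * ?\<sigma> J" unfolding \<sigma> by (simp only: mult_ac)
  also have "\<dots> = 4 * B * (?\<sigma> J * e)" unfolding m by (simp only: mult_ac)
  finally have "4 * B * (?\<sigma> n) = 4 * B * (?\<sigma> J * e)" .
  then have n: "?\<sigma> n = ?\<sigma> J * e" using B_neq_0 by simp
  have "?\<sigma> (m - 4 * Q * e) = 0" "?\<sigma> (n - J * e) = 0"
    by (simp_all add: subst.subst_poly_mult subst.subst.hom_minus subst.subst.hom_numeral subst_zero_z_Q m n \<sigma>e)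
  then have "z dvd m - 4 * Q * e" "z dvd n - J * e" by (simp_all only: var2_dvd_iff)
  then obtain m' n' where "m - 4 * Q * e = z * m'" "n - J * e = z * n'" by (elim dvdE)
  then show thesis by (intro that[of e m' n']) (simp_all add: algebra_simps)
qed

text \<open>With \<open>(s0, s1) = m (G\<^sub>y, - G\<^sub>x) + k (x, y)\<close>, the syzygy condition forces \<open>k = L n\<close> and becomes
  \<open>z s2 = n L z\<^sup>2 + m J - 4 n Q\<close>.  As \<open>4 Q, J, z\<close> is a regular sequence, its solutions are generated
  by the three Koszul relations, which give the columns of the matrix below; the last syzygy is the second
  Koszul map.\<close>

definition syz :: "mpoly3 mat" where
  "syz = mat_of_rows_list 3
    [[L * z * x, z * partial_deriv 1 G, L * J * x + 4 * Q * partial_deriv 1 G],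
     [L * z * y, - (z * partial_deriv 0 G), L * J * y - 4 * Q * partial_deriv 0 G],
     [L * z\<^sup>2 - 4 * Q, J, J * L * z]]"

definition rel :: "mpoly3 mat" where
  "rel = mat_of_rows_list 1 [[- J], [- (4 * Q)], [z]]"

definition grad :: "mpoly3 mat" where
  "grad = mat_of_rows_list 3 [[partial_deriv 0 F, partial_deriv 1 F, partial_deriv 2 F]]"

section \<open>Exactness of the resolution\<close>

lemma carrier:
  "grad \<in> carrier_mat 1 3" "syz \<in> carrier_mat 3 3" "rel \<in> carrier_mat 3 1"
  by (simp_all add: grad_def syz_def rel_def mat_of_rows_list_def numeral_3_eq_3)

lemma dim_simps [simp]:
  "dim_col grad = 3" "dim_row grad = 1" "dim_col syz = 3" "dim_row syz = 3" "dim_col rel = 1" "dim_row rel = 3"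
  using carrier_matD[OF carrier(1)] carrier_matD[OF carrier(2)] carrier_matD[OF carrier(3)] by blast+

text \<open>The entries of \<open>v\<close> weight the Koszul relations: \<open>v $ 0\<close> and
  \<open>v $ 1\<close> those of \<open>z\<close> with \<open>4 * Q\<close> and with
  \<open>J\<close>, and \<open>v $ 2\<close> the one of \<open>4 * Q\<close> with \<open>J\<close>.
  The product is displayed in the form that \<open>syzygy_decomposed_iff\<close> expects.\<close>

lemma syz_mult:
  assumes "v \<in> carrier_vec 3"
  defines "k \<equiv> L * (J * v $ 2 + z * v $ 0)" and "m \<equiv> 4 * Q * v $ 2 + z * v $ 1"
  shows "syz *\<^sub>v v = vec_of_list [m * partial_deriv 1 G + k * x, - m * partial_deriv 0 G + k * y,
    L * z * (J * v $ 2 + z * v $ 0) + J * v $ 1 - 4 * Q * v $ 0]"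
  unfolding syz_def mult_mat_vec_3[OF assms(1)] k_def m_def
  by (simp add: algebra_simps power2_eq_square)

lemma grad_mult:
  assumes "v \<in> carrier_vec 3"
  shows "grad *\<^sub>v v = vec_of_list [v $ 0 * partial_deriv 0 F + v $ 1 * partial_deriv 1 F + v $ 2 * partial_deriv 2 F]"
  unfolding grad_def mult_mat_vec_3[OF assms] by (simp add: mult_ac)

lemma rel_mult:
  assumes "v \<in> carrier_vec 1"
  shows "rel *\<^sub>v v = vec_of_list [- (J * v $ 0), - (4 * Q * v $ 0), z * v $ 0]"
  unfolding rel_def mult_mat_vec_1[OF assms] by simp

lemma image_grad: "mat_image grad = {v \<in> carrier_vec 1. v $ 0 \<in> jacobian_ideal F}"
proof (intro equalityI subsetI)
  fix u assume "u \<in> mat_image grad"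
  then obtain v where v: "v \<in> carrier_vec 3" "u = grad *\<^sub>v v" by (auto simp: mat_image_def simp del: One_nat_def)
  have u: "u = vec_of_list [v $ 0 * partial_deriv 0 F + v $ 1 * partial_deriv 1 F + v $ 2 * partial_deriv 2 F]"
    unfolding v(2) by (rule grad_mult[OF v(1)])
  have "u $ 0 \<in> jacobian_ideal F"
    unfolding jacobian_ideal_def ideal_gen_triple
    by (rule exI[of _ "\<lambda>i. if i = 0 then v $ 0 else if i = 1 then v $ 1 else v $ 2"])
      (simp add: u sum_3)
  moreover have "u \<in> carrier_vec 1" unfolding u by (rule carrier_vecI) simp
  ultimately show "u \<in> {v \<in> carrier_vec 1. v $ 0 \<in> jacobian_ideal F}" by blast
next
  fix u assume u: "u \<in> {v \<in> carrier_vec 1. v $ 0 \<in> jacobian_ideal F}"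
  then have "u $ 0 \<in> jacobian_ideal F" by blast
  then obtain g where g: "u $ 0 = (\<Sum>i\<in>UNIV. g i * partial_deriv i F)"
    unfolding jacobian_ideal_def ideal_gen_triple by blast
  let ?v = "vec_of_list [g 0, g 1, g 2]"
  have v: "?v \<in> carrier_vec 3" by (rule carrier_vecI) simp
  have eq: "u = grad *\<^sub>v ?v"
  proof -
    have "?v $ 0 = g 0" "?v $ 1 = g 1" "?v $ 2 = g 2"
      by (simp_all add: vec_of_list_index numeral_2_eq_2)
    moreover have "u \<in> carrier_vec 1" using u by blast
    ultimately show ?thesis
      unfolding grad_mult[OF v] by (subst vec_1_eq_iff) (simp_all only: g sum_3)
  qed
  show "u \<in> mat_image grad" unfolding eq by (rule mat_imageI) (simp only: dim_simps v)
qed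

lemma image_syz: "mat_image syz = mat_kernel grad"
proof (intro equalityI subsetI)
  fix u assume "u \<in> mat_image syz"
  then obtain v where v: "v \<in> carrier_vec 3" "u = syz *\<^sub>v v" by (auto simp: mat_image_def simp del: One_nat_def)
  define k where "k = L * (J * v $ 2 + z * v $ 0)"
  define m where "m = 4 * Q * v $ 2 + z * v $ 1"
  define s2 where "s2 = L * z * (J * v $ 2 + z * v $ 0) + J * v $ 1 - 4 * Q * v $ 0"
  have u: "u = vec_of_list [m * partial_deriv 1 G + k * x, - m * partial_deriv 0 G + k * y, s2]"
    unfolding v(2) syz_mult[OF v(1)] k_def m_def s2_def ..
  have "4 * k * Q = L * (k * z\<^sup>2 + m * J - z * s2)"
    by (simp add: k_def m_def s2_def algebra_simps power2_eq_square)
  then have "(m * partial_deriv 1 G + k * x) * partial_deriv 0 F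
      + (- m * partial_deriv 0 G + k * y) * partial_deriv 1 F + s2 * partial_deriv 2 F = 0"
    using syzygy_decomposed_iff[OF refl refl] by blast
  moreover have uc: "u \<in> carrier_vec 3" unfolding u by (rule carrier_vecI) simp
  moreover have "u $ 0 = m * partial_deriv 1 G + k * x" "u $ 1 = - m * partial_deriv 0 G + k * y" "u $ 2 = s2"
    by (simp_all add: u vec_of_list_index numeral_2_eq_2)
  ultimately show "u \<in> mat_kernel grad"
    by (simp add: mat_kernel_def grad_mult[OF uc] zero_vec_1 del: One_nat_def)
next
  fix u assume "u \<in> mat_kernel grad"
  then have uc: "u \<in> carrier_vec 3" and "grad *\<^sub>v u = 0\<^sub>v 1" by (auto simp: mat_kernel_def)
  then have rel: "u $ 0 * partial_deriv 0 F + u $ 1 * partial_deriv 1 F + u $ 2 * partial_deriv 2 F = 0"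
    by (simp only: grad_mult[OF uc] zero_vec_1 vec_of_list_1_eq_iff)
  have "l i dvd u $ 0 * partial_deriv 0 G + u $ 1 * partial_deriv 1 G" if i: "i < 4" for i
  proof -
    let ?T = "u $ 0 * partial_deriv 0 G + u $ 1 * partial_deriv 1 G"
      and ?W = "u $ 0 * partial_deriv 0 Q + u $ 1 * partial_deriv 1 Q + 2 * z * L * u $ 2"
    \<comment> \<open>The syzygy makes this sum zero, so a line dividing \<open>G\<close> divides
      \<open>Q * ?T\<close>; as it does not divide \<open>Q\<close>, it divides
      \<open>?T\<close>.\<close>
    have "l i dvd Q * ?T + G * ?W" by (simp only: rel[unfolded syzygy_iff] dvd_0_right)
    moreover have "l i dvd G * ?W" using l_dvd_G[OF i] by (rule dvd_mult2)
    ultimately have "l i dvd Q * ?T" by (simp only: dvd_add_left_iff)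
    then show ?thesis using prime_l[OF i] l_not_dvd_Q[OF i] prime_elem_dvd_multD by blast
  qed
  then obtain k m where km: "u $ 0 = m * partial_deriv 1 G + k * x" "u $ 1 = - m * partial_deriv 0 G + k * y"
    using logarithmic_decomposition by blast
  have kQ: "4 * k * Q = L * (k * z\<^sup>2 + m * J - z * u $ 2)"
    using rel syzygy_decomposed_iff[OF km] by blast
  then have "L dvd k" using L_dvd_cancel by (metis dvd_triv_left)
  then obtain n where k: "k = L * n" by (elim dvdE)
  have "L * (4 * n * Q) = L * (k * z\<^sup>2 + m * J - z * u $ 2)" using kQ by (simp add: k mult_ac)
  then have nQ: "4 * n * Q = k * z\<^sup>2 + m * J - z * u $ 2" using L_neq_0 by simp
  then have "z * (u $ 2 - L * n * z) = m * J - 4 * n * Q"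
    by (simp add: k algebra_simps power2_eq_square)
  then obtain e m' n' where mn: "m = 4 * Q * e + z * m'" "n = J * e + z * n'"
    by (rule koszul_mod_z)
  \<comment> \<open>The mixed terms \<open>4 * Q * J * e\<close> of \<open>m * J\<close> and
    \<open>4 * n * Q\<close> cancel, so that \<open>z\<close> can be divided out.\<close>
  have "z * (u $ 2) = z * (L * z * n + J * m' - 4 * Q * n')"
    using nQ unfolding mn k by (simp add: algebra_simps power2_eq_square)
  then have u2: "u $ 2 = L * z * n + J * m' - 4 * Q * n'" by simp
  let ?v = "vec_of_list [n', m', e]"
  have v: "?v \<in> carrier_vec 3" by (rule carrier_vecI) simp
  have eq: "u = syz *\<^sub>v ?v"
    unfolding syz_mult[OF v] using uc km u2
    by (subst vec_3_eq_iff) (simp_all add: vec_of_list_index numeral_2_eq_2 k mn algebra_simps)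
  show "u \<in> mat_image syz" unfolding eq by (rule mat_imageI) (simp only: dim_simps v)
qed

lemma image_rel: "mat_image rel = mat_kernel syz"
proof (intro equalityI subsetI)
  fix u assume "u \<in> mat_image rel"
  then obtain v where v: "v \<in> carrier_vec 1" "u = rel *\<^sub>v v" by (auto simp: mat_image_def simp del: One_nat_def)
  have u: "u = vec_of_list [- (J * v $ 0), - (4 * Q * v $ 0), z * v $ 0]"
    unfolding v(2) by (rule rel_mult[OF v(1)])
  have uc: "u \<in> carrier_vec 3" unfolding u by (rule carrier_vecI) simp
  have "u $ 0 = - (J * v $ 0)" "u $ 1 = - (4 * Q * v $ 0)" "u $ 2 = z * v $ 0"
    by (simp_all add: u vec_of_list_index numeral_2_eq_2)
  then have "syz *\<^sub>v u = 0\<^sub>v 3"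
    unfolding syz_mult[OF uc] zero_vec_3 by (simp add: algebra_simps)
  then show "u \<in> mat_kernel syz" using uc by (simp add: mat_kernel_def)
next
  fix u assume "u \<in> mat_kernel syz"
  then have uc: "u \<in> carrier_vec 3" and ker: "syz *\<^sub>v u = 0\<^sub>v 3" by (auto simp: mat_kernel_def)
  define n where "n = J * u $ 2 + z * u $ 0"
  define k where "k = L * n"
  define m where "m = 4 * Q * u $ 2 + z * u $ 1"
  have *: "m * partial_deriv 1 G + k * x = 0" "- m * partial_deriv 0 G + k * y = 0"
    using ker unfolding syz_mult[OF uc] zero_vec_3 vec_of_list_3_eq_iff m_def k_def n_def by blast+
  \<comment> \<open>Combining the two components with \<open>y\<close> and \<open>- x\<close>
    eliminates \<open>k\<close> and leaves Euler's relation for \<open>G\<close>.\<close>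
  have "m * (4 * G) = y * (m * partial_deriv 1 G + k * x) - x * (- m * partial_deriv 0 G + k * y)"
    unfolding euler_G[symmetric] by (simp add: algebra_simps)
  then have m: "m = 0" using * G_neq_0 by simp
  then have "k = 0" using *(1) by simp
  then have n: "n = 0" using L_neq_0 by (simp add: k_def)
  have "J * u $ 2 = z * - u $ 0" using n by (simp add: n_def eq_neg_iff_add_eq_0)
  then have "z dvd J * u $ 2" by simp
  then have "z dvd u $ 2" using z_not_dvd_J prime_elem_var prime_elem_dvd_multD by blast
  then obtain e where e: "u $ 2 = z * e" by (elim dvdE)
  have "z * (u $ 0) = z * - (J * e)" "z * (u $ 1) = z * - (4 * Q * e)"
    using n m by (simp_all add: n_def m_def e algebra_simps eq_neg_iff_add_eq_0)
  then have u: "u $ 0 = - (J * e)" "u $ 1 = - (4 * Q * e)" by (simp_all only: mult_cancel_left var_neq_0 simp_thms)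
  let ?v = "vec_of_list [e]"
  have v: "?v \<in> carrier_vec 1" by (rule carrier_vecI) simp
  have eq: "u = rel *\<^sub>v ?v"
    unfolding rel_mult[OF v] using uc u e by (subst vec_3_eq_iff) (simp_all add: vec_of_list_index)
  show "u \<in> mat_image rel" unfolding eq by (rule mat_imageI) (simp only: dim_simps v)
qed

lemma kernel_rel: "mat_kernel rel = {0\<^sub>v 1}"
proof (intro equalityI subsetI)
  fix v assume "v \<in> mat_kernel rel"
  then have v: "v \<in> carrier_vec 1" and "rel *\<^sub>v v = 0\<^sub>v 3" by (auto simp: mat_kernel_def)
  then have "z * v $ 0 = 0" unfolding rel_mult[OF v] zero_vec_3 vec_of_list_3_eq_iff by blast
  then have "v = 0\<^sub>v 1" unfolding zero_vec_1 using v by (subst vec_1_eq_iff) simp_all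
  then show "v \<in> {0\<^sub>v 1}" by simp
next
  have "rel *\<^sub>v 0\<^sub>v 1 = 0\<^sub>v 3" by (subst rel_mult) (simp_all add: zero_vec_3)
  moreover fix v assume "v \<in> {0\<^sub>v 1 :: mpoly3 vec}"
  ultimately show "v \<in> mat_kernel rel" by (simp add: mat_kernel_def)
qed

section \<open>Degrees of the entries and minimality\<close>

lemma homogeneous_A: "homogeneous 2 A" using binary_form_homogeneous[OF A] by simp

lemma homogeneous_B: "homogeneous 4 B" using binary_form_homogeneous[OF B] by simp

lemma homogeneous_Q: "homogeneous 4 Q"
  unfolding Q_def
  by (intro homogeneous_add homogeneous_B homogeneous_powerI[OF homogeneous_var]
      homogeneous_multI[OF homogeneous_powerI[OF homogeneous_var refl] homogeneous_A]) simp_all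

lemma homogeneous_G: "homogeneous 4 G"
  unfolding G_def
  by (intro homogeneous_diff homogeneous_powerI[OF homogeneous_A]
      homogeneous_multI[OF homogeneous_numeral homogeneous_B]) simp_all

lemma homogeneous_L: "homogeneous 2 L"
  unfolding L_def
  by (intro homogeneous_add homogeneous_A
      homogeneous_multI[OF homogeneous_numeral homogeneous_powerI[OF homogeneous_var refl]]) simp_all

lemma homogeneous_J: "homogeneous 4 J"
  unfolding J_def
  by (intro homogeneous_diff homogeneous_multI[OF homogeneous_partial_deriv[OF homogeneous_A]
        homogeneous_partial_deriv[OF homogeneous_B]]) simp_all

lemma homogeneous_F: "homogeneous 8 F"
  unfolding F_def
  by (rule homogeneous_multI[OF homogeneous_Q homogeneous_prod[of _ "\<lambda>_. 1"]])
    (simp_all add: homogeneous_line)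

lemma homogeneous_entries:
  "homogeneous 7 (partial_deriv i F)"
  "homogeneous 4 (L * z * var i)" "homogeneous 4 (z * partial_deriv i G)"
  "homogeneous 7 (L * J * var i)" "homogeneous 7 (4 * Q * partial_deriv i G)"
  "homogeneous 4 (L * z\<^sup>2 - 4 * Q)" "homogeneous 7 (J * L * z)"
  "homogeneous 4 (4 * Q)"
proof -
  note z = homogeneous_var[of 2] and i = homogeneous_var[of i]
  note Gi = homogeneous_partial_deriv[OF homogeneous_G, of i]
  show "homogeneous 7 (partial_deriv i F)"
    using homogeneous_partial_deriv[OF homogeneous_F] by simp
  show "homogeneous 4 (L * z * var i)"
    by (rule homogeneous_multI[OF homogeneous_multI[OF homogeneous_L z refl] i]) simp
  show "homogeneous 4 (z * partial_deriv i G)" by (rule homogeneous_multI[OF z Gi]) simp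
  show "homogeneous 7 (L * J * var i)"
    by (rule homogeneous_multI[OF homogeneous_multI[OF homogeneous_L homogeneous_J refl] i]) simp
  show Q: "homogeneous 4 (4 * Q)" by (rule homogeneous_multI[OF homogeneous_numeral homogeneous_Q]) simp
  show "homogeneous 7 (4 * Q * partial_deriv i G)" by (rule homogeneous_multI[OF Q Gi]) simp
  show "homogeneous 4 (L * z\<^sup>2 - 4 * Q)"
    by (rule homogeneous_diff[OF homogeneous_multI[OF homogeneous_L homogeneous_powerI[OF z refl]] Q]) simp
  show "homogeneous 7 (J * L * z)"
    by (rule homogeneous_multI[OF homogeneous_multI[OF homogeneous_J homogeneous_L refl] z]) simp
qed

text \<open>The twist \<open>-7\<close> is \<open>1 - d\<close> for \<open>d = 8\<close>. The
  columns of \<open>syz\<close> have degrees 4, 4, 7 and the entries of \<open>rel\<close> degrees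
  4, 4, 1, so the last generator sits in degree 11 + 4 = 14 + 1 = 15.\<close>

lemma graded_maps:
  "graded_map (replicate 3 (-7)) [0] grad"
  "graded_map [-11, -11, -14] (replicate 3 (-7)) syz"
  "graded_map [-15] [-11, -11, -14] rel"
proof -
  note entries = homogeneous_entries homogeneous_J
  have r: "replicate 3 (-7 :: int) = [-7, -7, -7]" by (simp add: numeral_3_eq_3)
  show "graded_map (replicate 3 (-7)) [0] grad"
    using entries carrier(1) unfolding graded_map_def r
    by (simp add: All_less_Suc grad_def mat_of_rows_list_def numeral_3_eq_3)
  show "graded_map [-11, -11, -14] (replicate 3 (-7)) syz"
    using entries carrier(2) unfolding graded_map_def r
    by (simp add: All_less_Suc syz_def mat_of_rows_list_def numeral_3_eq_3
        homogeneous_add homogeneous_diff homogeneous_uminus)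
  show "graded_map [-15] [-11, -11, -14] rel"
    using entries carrier(3) unfolding graded_map_def
    by (simp add: All_less_Suc rel_def mat_of_rows_list_def numeral_3_eq_3 homogeneous_uminus)
qed

lemma minimal_resolution:
  "minimal_graded_free_resolution (jacobian_ideal F)
    [[0], replicate 3 (-7), [-11, -11, -14], [-15]] [grad, syz, rel]"
proof -
  have el: "elements_mat grad \<subseteq> irrelevant_ideal" "elements_mat syz \<subseteq> irrelevant_ideal"
    "elements_mat rel \<subseteq> irrelevant_ideal"
    using graded_map_elements[OF graded_maps(1)] graded_map_elements[OF graded_maps(2)]
      graded_map_elements[OF graded_maps(3)] by simp_all
  have 1: "(\<forall>i<length [grad, syz, rel]. P i) \<longleftrightarrow> P 0 \<and> P 1 \<and> P 2" for P
    by (auto simp: All_less_Suc numeral_2_eq_2)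
  have 2: "(\<forall>i. Suc i < length [grad, syz, rel] \<longrightarrow> P i) \<longleftrightarrow> P 0 \<and> P 1" for P
    by (auto simp: less_Suc_eq)
  show ?thesis
    unfolding minimal_graded_free_resolution_def 1 2
    using el graded_maps image_grad image_syz image_rel kernel_rel
    by (simp add: numeral_2_eq_2)
qed

lemma plus_one_generated_F: "plus_one_generated F 4 4 7"
proof -
  have "reduced_curve 8 F"
    using F_neq_0 homogeneous_F squarefree_F by (simp add: reduced_curve_def)
  moreover have "minimal_graded_free_resolution (jacobian_ideal F)
      [[0], replicate 3 (1 - int 8), map (\<lambda>k. 1 - int 8 - int k) [4, 4, 7], map (\<lambda>e. - e) [15]] [grad, syz, rel]"
    using minimal_resolution by simp
  ultimately have "syzygy_curve 8 F [4, 4, 7]"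
    unfolding syzygy_curve_def by (auto intro!: exI[of _ "[15]"] exI[of _ "[grad, syz, rel]"])
  then show ?thesis by (auto simp: plus_one_generated_def)
qed

end

section \<open>Smoothness and hyperflexes of the Klein quartic\<close>

definition klein :: "complex \<Rightarrow> complex \<Rightarrow> complex \<Rightarrow> complex \<Rightarrow> complex" where
  "klein lam x y z = x ^ 4 + y ^ 4 + z ^ 4 + lam * (x\<^sup>2 * y\<^sup>2 + x\<^sup>2 * z\<^sup>2 + y\<^sup>2 * z\<^sup>2)"

text \<open>With \<open>6 * \<mu>\<close> as parameter the restricted quartic carries the binomial
  coefficients 1, 4, 6, 4, 1, which cancel against those of the fourth power.\<close>

lemma klein_hyperflex_coefficients:
  fixes \<alpha> \<beta> m n \<mu> :: complex
  assumes "\<And>x y. klein (6 * \<mu>) x y (\<alpha> * x + \<beta> * y) = (m * x + n * y) ^ 4"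
  shows "1 + \<alpha> ^ 4 + 6 * \<mu> * \<alpha>\<^sup>2 = m ^ 4"
    and "\<alpha> * \<beta> * (\<alpha>\<^sup>2 + 3 * \<mu>) = m ^ 3 * n"
    and "\<alpha>\<^sup>2 * \<beta>\<^sup>2 + \<mu> * (1 + \<alpha>\<^sup>2 + \<beta>\<^sup>2) = m\<^sup>2 * n\<^sup>2"
    and "\<alpha> * \<beta> * (\<beta>\<^sup>2 + 3 * \<mu>) = m * n ^ 3"
    and "1 + \<beta> ^ 4 + 6 * \<mu> * \<beta>\<^sup>2 = n ^ 4"
proof -
  define d0 where "d0 = 1 + \<alpha> ^ 4 + 6 * \<mu> * \<alpha>\<^sup>2 - m ^ 4"
  define d1 where "d1 = \<alpha> * \<beta> * (\<alpha>\<^sup>2 + 3 * \<mu>) - m ^ 3 * n"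
  define d2 where "d2 = \<alpha>\<^sup>2 * \<beta>\<^sup>2 + \<mu> * (1 + \<alpha>\<^sup>2 + \<beta>\<^sup>2) - m\<^sup>2 * n\<^sup>2"
  define d3 where "d3 = \<alpha> * \<beta> * (\<beta>\<^sup>2 + 3 * \<mu>) - m * n ^ 3"
  define d4 where "d4 = 1 + \<beta> ^ 4 + 6 * \<mu> * \<beta>\<^sup>2 - n ^ 4"
  have "klein (6 * \<mu>) x y (\<alpha> * x + \<beta> * y) - (m * x + n * y) ^ 4
    = d0 * x ^ 4 + 4 * d1 * x ^ 3 * y + 6 * d2 * x\<^sup>2 * y\<^sup>2 + 4 * d3 * x * y ^ 3 + d4 * y ^ 4" for x y
    unfolding klein_def d0_def d1_def d2_def d3_def d4_def by Groebner_Basis.algebra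
  then have e: "d0 * x ^ 4 + 4 * d1 * x ^ 3 * y + 6 * d2 * x\<^sup>2 * y\<^sup>2 + 4 * d3 * x * y ^ 3 + d4 * y ^ 4 = 0" for x y
    using assms by simp
  have 0: "d0 = 0" "d4 = 0" using e[of 1 0] e[of 0 1] by simp_all
  then show "1 + \<alpha> ^ 4 + 6 * \<mu> * \<alpha>\<^sup>2 = m ^ 4" "1 + \<beta> ^ 4 + 6 * \<mu> * \<beta>\<^sup>2 = n ^ 4"
    by (simp_all add: d0_def d4_def)
  have 1: "4 * d1 + 6 * d2 + 4 * d3 = 0" using e[of 1 1] 0 by simp
  have 2: "- (4 * d1) + 6 * d2 - 4 * d3 = 0" using e[of 1 "- 1"] 0 by simp
  have 3: "8 * d1 + 24 * d2 + 32 * d3 = 0" using e[of 1 2] 0 by simp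
  have "d2 = 0" "d3 = 0" "d1 = 0" using 1 2 3 by Groebner_Basis.algebra+
  then show "\<alpha> * \<beta> * (\<alpha>\<^sup>2 + 3 * \<mu>) = m ^ 3 * n"
    "\<alpha>\<^sup>2 * \<beta>\<^sup>2 + \<mu> * (1 + \<alpha>\<^sup>2 + \<beta>\<^sup>2) = m\<^sup>2 * n\<^sup>2"
    "\<alpha> * \<beta> * (\<beta>\<^sup>2 + 3 * \<mu>) = m * n ^ 3"
    by (simp_all add: d1_def d2_def d3_def)
qed

text \<open>The coefficients of a fourth power, freed of binomial factors, satisfy
  \<open>a0 a4 = a1 a3 = a2\<^sup>2\<close>, \<open>a0 a2 = a1\<^sup>2\<close> and
  \<open>a2 a4 = a3\<^sup>2\<close>. In these relations only the squares \<open>u\<close> and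
  \<open>v\<close> of \<alpha> and \<beta> occur, and every branch of their solution contradicts the
  equation of \<mu>, which is that of \<open>lam = 6 * \<mu>\<close>.\<close>

lemma no_hyperflex_chart:
  fixes \<alpha> \<beta> m n \<mu> :: complex
  assumes \<mu>: "2 * \<mu>\<^sup>2 + \<mu> + 1 = 0"
    and "\<And>x y. klein (6 * \<mu>) x y (\<alpha> * x + \<beta> * y) = (m * x + n * y) ^ 4"
  shows False
proof -
  note C = klein_hyperflex_coefficients[OF assms(2)]
  define u where "u = \<alpha>\<^sup>2"
  define v where "v = \<beta>\<^sup>2"
  define p where "p = u * v"
  define a2 where "a2 = p + \<mu> * (1 + u + v)"
  have \<mu>0: "\<mu> \<noteq> 0" using \<mu> by auto
  have a1: "(\<alpha> * \<beta> * (\<alpha>\<^sup>2 + 3 * \<mu>))\<^sup>2 = p * (u + 3 * \<mu>)\<^sup>2"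
    and a3: "(\<alpha> * \<beta> * (\<beta>\<^sup>2 + 3 * \<mu>))\<^sup>2 = p * (v + 3 * \<mu>)\<^sup>2"
    and a13: "(\<alpha> * \<beta> * (\<alpha>\<^sup>2 + 3 * \<mu>)) * (\<alpha> * \<beta> * (\<beta>\<^sup>2 + 3 * \<mu>)) = p * (u + 3 * \<mu>) * (v + 3 * \<mu>)"
    by (simp_all add: p_def u_def v_def power2_eq_square)
  have c0: "1 + u\<^sup>2 + 6 * \<mu> * u = m ^ 4" and c2: "a2 = m\<^sup>2 * n\<^sup>2" and c4: "1 + v\<^sup>2 + 6 * \<mu> * v = n ^ 4"
    using C(1,3,5) by (simp_all add: a2_def p_def u_def v_def)
  have E0: "(1 + u\<^sup>2 + 6 * \<mu> * u) * (1 + v\<^sup>2 + 6 * \<mu> * v) = a2\<^sup>2"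
    unfolding c0 c2 c4 by Groebner_Basis.algebra
  have E2: "p * (u + 3 * \<mu>) * (v + 3 * \<mu>) = a2\<^sup>2"
    unfolding a13[symmetric] C(2,4) c2 by Groebner_Basis.algebra
  have E1: "(1 + u\<^sup>2 + 6 * \<mu> * u) * a2 = p * (u + 3 * \<mu>)\<^sup>2"
    unfolding a1[symmetric] C(2) c0 c2 by Groebner_Basis.algebra
  have E3: "(1 + v\<^sup>2 + 6 * \<mu> * v) * a2 = p * (v + 3 * \<mu>)\<^sup>2"
    unfolding a3[symmetric] C(4) c4 c2 by Groebner_Basis.algebra
  \<comment> \<open>Inserting \<open>a2\<close> cancels \<open>u\<^sup>2 + 6 * \<mu> * u\<close>
    against the square in \<open>E1\<close>. Thus \<open>F1\<close> and \<open>F3\<close> share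
    their term in \<open>p\<close>, and their difference factors.\<close>
  have F1: "p * (1 - 9 * \<mu>\<^sup>2) + \<mu> * (1 + u + v) * (1 + u\<^sup>2 + 6 * \<mu> * u) = 0"
    using E1 unfolding a2_def p_def by Groebner_Basis.algebra
  have F3: "p * (1 - 9 * \<mu>\<^sup>2) + \<mu> * (1 + u + v) * (1 + v\<^sup>2 + 6 * \<mu> * v) = 0"
    using E3 unfolding a2_def p_def by Groebner_Basis.algebra
  have "\<mu> * (1 + u + v) * ((u - v) * (u + v + 6 * \<mu>)) = 0"
    using F1 F3 by Groebner_Basis.algebra
  then have "1 + u + v = 0 \<or> u - v = 0 \<or> u + v + 6 * \<mu> = 0"
    using \<mu>0 by (simp only: mult_eq_0_iff simp_thms)
  then consider "1 + u + v = 0" | "u - v = 0" | "u + v + 6 * \<mu> = 0" by blast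
  then show False
  proof cases
    case 1
    \<comment> \<open>By the equation of \<mu>, \<open>1 - 9 * \<mu>\<^sup>2\<close> equals
      \<open>(11 + 9 * \<mu>) / 2\<close>.\<close>
    then have "p * (11 + 9 * \<mu>) = 0" using F1 \<mu> by Groebner_Basis.algebra
    moreover have "11 + 9 * \<mu> \<noteq> 0"
    proof
      assume "11 + 9 * \<mu> = 0"
      then show False using \<mu> by Groebner_Basis.algebra
    qed
    ultimately have p: "p = 0" by simp
    then have "(2 - 6 * \<mu>) = 0"
    proof -
      consider "u = 0" "v = - 1" | "v = 0" "u = - 1"
        using p 1 by (auto simp: p_def eq_neg_iff_add_eq_0 add.commute)
      then show ?thesis using E0 1 p by cases (simp_all add: a2_def)
    qed
    then show False using \<mu> by Groebner_Basis.algebra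
  next
    case 2
    \<comment> \<open>For \<open>u = v\<close> both sides of \<open>E2\<close>, and later of
      \<open>E0\<close>, are squares, so each equation splits into two factors.\<close>
    have "(u * (u + 3 * \<mu>) - a2) * (u * (u + 3 * \<mu>) + a2) = 0"
      using E2 2 unfolding p_def by Groebner_Basis.algebra
    then have "\<mu> * (u - 1) * (2 * u\<^sup>2 + 5 * \<mu> * u + \<mu>) = 0"
      using 2 unfolding a2_def p_def by Groebner_Basis.algebra
    then consider "u = 1" | "2 * u\<^sup>2 + 5 * \<mu> * u + \<mu> = 0" using \<mu>0 by auto
    then show False
    proof cases
      case 1
      then have "(1 + 3 * \<mu>)\<^sup>2 = 0" using F1 2 unfolding p_def by Groebner_Basis.algebra
      then have "1 + 3 * \<mu> = 0" by simp
      then show False using \<mu> by Groebner_Basis.algebra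
    next
      case q: 2
      have "(1 + 4 * \<mu> * u - \<mu>) * (2 * u\<^sup>2 + 8 * \<mu> * u + 1 + \<mu>) = 0"
        using E0 2 unfolding a2_def p_def by Groebner_Basis.algebra
      then consider "1 + 4 * \<mu> * u - \<mu> = 0" | "2 * u\<^sup>2 + 8 * \<mu> * u + 1 + \<mu> = 0" by auto
      then show False
      proof cases
        case 1
        have "18 * \<mu> ^ 3 - 9 * \<mu>\<^sup>2 - 2 * \<mu> + 1 = 0" using 1 q by Groebner_Basis.algebra
        then have "9 * \<mu> - 19 = 0" using \<mu> by Groebner_Basis.algebra
        then show False using \<mu> by Groebner_Basis.algebra
      next
        case 2
        then have "3 * \<mu> * u + 1 = 0" using q by Groebner_Basis.algebra
        then have "9 * \<mu> ^ 3 - 15 * \<mu>\<^sup>2 + 2 = 0" using q by Groebner_Basis.algebra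
        then have "21 * \<mu> + 47 = 0" using \<mu> by Groebner_Basis.algebra
        then show False using \<mu> by Groebner_Basis.algebra
      qed
    qed
  next
    case 3
    \<comment> \<open>Now \<open>u\<^sup>2 + 6 * \<mu> * u = - p\<close>, likewise for
      \<open>v\<close>, and \<open>a2 = p + 4 * \<mu> + 3\<close>; again \<open>E0\<close> compares
      two squares.\<close>
    have "(1 - p)\<^sup>2 = (p + 4 * \<mu> + 3)\<^sup>2"
      using E0 3 \<mu> unfolding a2_def p_def by Groebner_Basis.algebra
    then have "(2 * p + 4 * \<mu> + 2) * (4 * \<mu> + 4) = 0" by Groebner_Basis.algebra
    moreover have "4 * \<mu> + 4 \<noteq> 0"
    proof
      assume "4 * \<mu> + 4 = 0"
      then show False using \<mu> by Groebner_Basis.algebra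
    qed
    ultimately have "2 * p + 4 * \<mu> + 2 = 0" by simp
    moreover have "p * (- 7 * \<mu> - 3) = 2 * (16 * \<mu> + 1)"
      using E2 3 \<mu> unfolding a2_def p_def by Groebner_Basis.algebra
    ultimately have "13 * \<mu> + 3 = 0" using \<mu> by Groebner_Basis.algebra
    then show False using \<mu> by Groebner_Basis.algebra
  qed
qed

text \<open>If the first two coordinates of the two points are independent, their line is a graph
  \<open>z = \<alpha> x + \<beta> y\<close>. Cramer's rule gives \<alpha>, \<beta> and the linear
  form whose fourth power the quartic becomes, against \<open>no_hyperflex_chart\<close>.\<close>

lemma klein_hyperflex_collinear_aux:
  assumes lam: "lam\<^sup>2 + 3 * lam + 18 = 0"
    and h: "\<And>s w. klein lam (s * d0 + w * p0) (s * d1 + w * p1) (s * d2 + w * p2) = w ^ 4"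
  shows "d0 * p1 = d1 * p0"
proof (rule ccontr)
  assume "d0 * p1 \<noteq> d1 * p0"
  define \<delta> where "\<delta> = d0 * p1 - d1 * p0"
  have \<delta>: "\<delta> \<noteq> 0" using \<open>d0 * p1 \<noteq> d1 * p0\<close> by (simp add: \<delta>_def)
  define \<alpha> where "\<alpha> = (p1 * d2 - d1 * p2) / \<delta>"
  define \<beta> where "\<beta> = (d0 * p2 - p0 * d2) / \<delta>"
  have "klein (6 * (lam / 6)) x y (\<alpha> * x + \<beta> * y) = (- d1 / \<delta> * x + d0 / \<delta> * y) ^ 4" for x y
  proof -
    define s where "s = (x * p1 - y * p0) / \<delta>"
    define w where "w = (d0 * y - d1 * x) / \<delta>"
    have "\<delta> * (s * d0 + w * p0) = \<delta> * x" "\<delta> * (s * d1 + w * p1) = \<delta> * y"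
      using \<delta> by (simp_all add: s_def w_def distrib_left) (simp_all add: \<delta>_def algebra_simps)
    then have xy: "s * d0 + w * p0 = x" "s * d1 + w * p1 = y" using \<delta> by simp_all
    have "\<delta> * (s * d2 + w * p2) = \<delta> * (\<alpha> * x + \<beta> * y)"
      using \<delta> by (simp add: s_def w_def \<alpha>_def \<beta>_def distrib_left) (simp add: algebra_simps)
    then have z: "s * d2 + w * p2 = \<alpha> * x + \<beta> * y" using \<delta> by simp
    have "w = - d1 / \<delta> * x + d0 / \<delta> * y"
      using \<delta> by (simp add: w_def field_simps)
    then show ?thesis using h[of s w] unfolding xy z by simp
  qed
  moreover have "2 * (lam / 6)\<^sup>2 + lam / 6 + 1 = (lam\<^sup>2 + 3 * lam + 18) / 18"
    by (simp add: power2_eq_square add_divide_distrib)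
  then have "2 * (lam / 6)\<^sup>2 + lam / 6 + 1 = 0" using lam by simp
  ultimately show False using no_hyperflex_chart by blast
qed

text \<open>The quartic is symmetric in its variables, so the argument applies to each pair of
  coordinates. Together the equations make the two vectors linearly dependent.\<close>

lemma klein_hyperflex_collinear:
  assumes lam: "lam\<^sup>2 + 3 * lam + 18 = 0"
    and h: "\<And>s w. klein lam (s * d0 + w * p0) (s * d1 + w * p1) (s * d2 + w * p2) = w ^ 4"
  shows "d0 * p1 = d1 * p0" "d0 * p2 = d2 * p0" "d1 * p2 = d2 * p1"
proof -
  have swap: "klein lam x y z = klein lam x z y" "klein lam x y z = klein lam y z x" for x y z
    by (simp_all add: klein_def algebra_simps)
  show "d0 * p1 = d1 * p0" using klein_hyperflex_collinear_aux[OF lam h] .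
  show "d0 * p2 = d2 * p0"
    by (rule klein_hyperflex_collinear_aux[OF lam, of d0 p0 d2 p2 d1 p1])
      (metis h swap(1))
  show "d1 * p2 = d2 * p1"
    by (rule klein_hyperflex_collinear_aux[OF lam, of d1 p1 d2 p2 d0 p0])
      (metis h swap(2))
qed

text \<open>On the nonzero coordinates the equations form a linear system in the squares. With two
  or three unknowns it is singular only if \<open>lam\<close> is 2, -2 or -1, and none of these
  solves the equation for \<open>lam\<close>.\<close>

lemma klein_smooth:
  fixes x y z lam :: complex
  assumes lam: "lam\<^sup>2 + 3 * lam + 18 = 0"
    and x: "x * (2 * x\<^sup>2 + lam * (y\<^sup>2 + z\<^sup>2)) = 0"
    and y: "y * (2 * y\<^sup>2 + lam * (x\<^sup>2 + z\<^sup>2)) = 0"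
    and z: "z * (2 * z\<^sup>2 + lam * (x\<^sup>2 + y\<^sup>2)) = 0"
  shows "x = 0 \<and> y = 0 \<and> z = 0"
proof -
  have ne: "lam - 2 \<noteq> 0" "lam + 2 \<noteq> 0" "lam + 1 \<noteq> 0"
  proof -
    show "lam - 2 \<noteq> 0" proof assume "lam - 2 = 0" then show False using lam by Groebner_Basis.algebra qed
    show "lam + 2 \<noteq> 0" proof assume "lam + 2 = 0" then show False using lam by Groebner_Basis.algebra qed
    show "lam + 1 \<noteq> 0" proof assume "lam + 1 = 0" then show False using lam by Groebner_Basis.algebra qed
  qed
  have two: "u = 0" if "2 * u\<^sup>2 + lam * v\<^sup>2 = 0" "2 * v\<^sup>2 + lam * u\<^sup>2 = 0" for u v :: complex
  proof -
    have "(lam - 2) * ((lam + 2) * u\<^sup>2) = 0" using that by Groebner_Basis.algebra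
    then show ?thesis using ne by simp
  qed
  have three: False if "2 * x\<^sup>2 + lam * (y\<^sup>2 + z\<^sup>2) = 0" "2 * y\<^sup>2 + lam * (x\<^sup>2 + z\<^sup>2) = 0"
    "2 * z\<^sup>2 + lam * (x\<^sup>2 + y\<^sup>2) = 0" "x \<noteq> 0"
  proof -
    have "(lam + 1) * (x\<^sup>2 + y\<^sup>2 + z\<^sup>2) = 0" using that(1-3) by Groebner_Basis.algebra
    then have "x\<^sup>2 + y\<^sup>2 + z\<^sup>2 = 0" using ne by simp
    then have "(lam - 2) * x\<^sup>2 = 0" using that(1) by Groebner_Basis.algebra
    then show False using ne that(4) by simp
  qed
  show ?thesis
  proof (cases "x = 0"; cases "y = 0"; cases "z = 0")
    assume "x \<noteq> 0" "y \<noteq> 0" "z \<noteq> 0"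
    then show ?thesis using x y z three by simp
  next
    assume "x \<noteq> 0" "y \<noteq> 0" "z = 0"
    then show ?thesis using x y two[of x y] by simp
  next
    assume "x \<noteq> 0" "y = 0" "z \<noteq> 0"
    then show ?thesis using x z two[of x z] by simp
  next
    assume "x = 0" "y \<noteq> 0" "z \<noteq> 0"
    then show ?thesis using y z two[of y z] by simp
  qed (use x y z in simp_all)
qed

section \<open>Bitangents through a point\<close>

lemma homogeneous_klein_quartic: "homogeneous 4 (klein_quartic lam)"
proof -
  have q: "homogeneous 4 (var i ^ 2 * var j ^ 2)" for i j
    by (rule homogeneous_multI[OF homogeneous_powerI[OF homogeneous_var refl] homogeneous_powerI[OF homogeneous_var refl]]) simp
  show ?thesis
    unfolding klein_quartic_def Let_def
    by (intro homogeneous_add homogeneous_powerI[OF homogeneous_var]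
        homogeneous_multI[OF homogeneous_const homogeneous_add[OF homogeneous_add[OF q q] q]]) simp_all
qed

lemma eval_klein_quartic: "eval P (klein_quartic lam) = klein lam (P 0) (P 1) (P 2)"
  by (simp add: klein_quartic_def Let_def klein_def eval_add eval_mult eval.hom_power)

lemma klein_quartic_smooth:
  assumes lam: "lam ^ 2 + 3 * lam + 18 = 0"
    and "\<And>i. eval P (partial_deriv i (klein_quartic lam)) = 0"
  shows "P i = 0"
proof -
  have d: "eval P (partial_deriv 0 (klein_quartic lam)) = 2 * (P 0 * (2 * (P 0)\<^sup>2 + lam * ((P 1)\<^sup>2 + (P 2)\<^sup>2)))"
    "eval P (partial_deriv 1 (klein_quartic lam)) = 2 * (P 1 * (2 * (P 1)\<^sup>2 + lam * ((P 0)\<^sup>2 + (P 2)\<^sup>2)))"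
    "eval P (partial_deriv 2 (klein_quartic lam)) = 2 * (P 2 * (2 * (P 2)\<^sup>2 + lam * ((P 0)\<^sup>2 + (P 1)\<^sup>2)))"
    by (simp_all add: klein_quartic_def Let_def partial_deriv_mult partial_deriv_power eval_add eval_mult
        eval.hom_power eval.hom_numeral algebra_simps power2_eq_square power3_eq_cube)
  have "P 0 = 0 \<and> P 1 = 0 \<and> P 2 = 0"
    by (rule klein_smooth[OF lam]) (use assms(2)[of 0] assms(2)[of 1] assms(2)[of 2] d in simp_all)
  then show ?thesis using forall_3[of "\<lambda>i. P i = 0"] by blast
qed

lemma homogeneous_0_const:
  assumes "homogeneous 0 g" obtains c where "g = const c"
proof -
  have "homogeneous (int 0) g" using assms by simp
  then obtain h where "\<And>k. k \<le> 0 \<Longrightarrow> binary_form (0 - k) (h k)" "g = (\<Sum>k\<le>0. var 2 ^ k * h k)"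
    by (rule homogeneous_z_expansion) blast
  then show thesis using binary_form_0_const[of "h 0"] that by auto
qed

text \<open>The derivatives of a linear form are constants, and Euler's relation rebuilds the form
  from them.\<close>

lemma linear_form_expansion:
  assumes "homogeneous 1 l"
  obtains n where "l = (\<Sum>i\<in>UNIV. const (n i) * var i)"
proof -
  have "\<exists>c. partial_deriv i l = const c" for i
    using homogeneous_partial_deriv[OF assms, of i] homogeneous_0_const[of "partial_deriv i l"] by auto
  then obtain n where "\<And>i. partial_deriv i l = const (n i)" by metis
  then have "l = (\<Sum>i\<in>UNIV. const (n i) * var i)"
    using euler_homogeneous[OF assms] by (simp add: mult.commute)
  then show thesis by (rule that)
qed

lemma bitangent_order:
  assumes "bitangent f l" "R \<in> proj_zeros l" "T \<in> proj_zeros l" "\<not> same_point R T"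
  shows "restrict_line f R T \<noteq> 0" "Polynomial.order 0 (restrict_line f R T) \<in> {0, 2, 4}"
proof -
  obtain P P' where *: "\<forall>R \<in> proj_zeros l. \<forall>T \<in> proj_zeros l. \<not> same_point R T \<longrightarrow>
      restrict_line f R T \<noteq> 0 \<and> Polynomial.order 0 (restrict_line f R T) =
        (if same_point R P then 2 else 0) + (if same_point R P' then 2 else 0)"
    using assms(1) unfolding bitangent_def by blast
  show "restrict_line f R T \<noteq> 0" using * assms(2-4) by blast
  have "Polynomial.order 0 (restrict_line f R T) = (if same_point R P then 2 else 0) + (if same_point R P' then 2 else 0)"
    using * assms(2-4) by blast
  then show "Polynomial.order 0 (restrict_line f R T) \<in> {0, 2, 4}" by (simp split: if_splits)
qed

text \<open>An even order that is at least 1 is at least 2, and one that is at least 3 is at least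
  4.\<close>

lemma bitangent_coeff:
  assumes "bitangent f l" "R \<in> proj_zeros l" "T \<in> proj_zeros l" "\<not> same_point R T"
  defines "q \<equiv> restrict_line f R T"
  assumes "coeff q 0 = 0"
  shows "coeff q 1 = 0" "coeff q 2 = 0 \<Longrightarrow> coeff q 3 = 0"
proof -
  have q: "q \<noteq> 0" and o: "Polynomial.order 0 q \<in> {0, 2, 4}"
    using bitangent_order[OF assms(1-4)] by (simp_all add: q_def)
  have iff: "n \<le> Polynomial.order 0 q \<longleftrightarrow> (\<forall>k<n. coeff q k = 0)" for n
    using monom_1_dvd_iff[OF q, of n] monom_1_dvd_iff'[of n q] by blast
  have "1 \<le> Polynomial.order 0 q" unfolding iff using assms(6) by simp
  then have "2 \<le> Polynomial.order 0 q" using o by auto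
  then show 1: "coeff q 1 = 0" unfolding iff by simp
  assume "coeff q 2 = 0"
  then have "\<forall>k<3. coeff q k = 0"
    using 1 assms(6) by (simp add: All_less_Suc numeral_3_eq_3 numeral_2_eq_2)
  then have "3 \<le> Polynomial.order 0 q" unfolding iff .
  then have "4 \<le> Polynomial.order 0 q" using o by auto
  then show "coeff q 3 = 0" unfolding iff by simp
qed

text \<open>The hypothesis says that every root has multiplicity 2 or 4.\<close>

lemma depressed_quartic_square:
  fixes A B C :: complex
  assumes even: "\<And>r. r ^ 4 + A * r\<^sup>2 + C * r + B = 0 \<Longrightarrow>
    4 * r ^ 3 + 2 * A * r + C = 0 \<and> (6 * r\<^sup>2 + A = 0 \<longrightarrow> 4 * r = 0)"
  shows "C = 0 \<and> A\<^sup>2 = 4 * B"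
proof -
  have "\<not> constant (poly [:B, C, A, 0, 1:])" by (simp add: constant_degree)
  then obtain r where "poly [:B, C, A, 0, 1:] r = 0" using fundamental_theorem_of_algebra by blast
  then have r: "r ^ 4 + A * r\<^sup>2 + C * r + B = 0"
    by (simp add: algebra_simps power2_eq_square power4_eq_xxxx)
  have r1: "4 * r ^ 3 + 2 * A * r + C = 0" using even[OF r] by blast
  \<comment> \<open>Dividing out the double root \<open>r\<close> leaves
    \<open>X\<^sup>2 + 2 * r * X + A + 3 * r\<^sup>2\<close>; \<open>q\<close> is one of its roots,
    so the hypothesis applies to it as well.\<close>
  define q where "q = - r + csqrt (- 2 * r\<^sup>2 - A)"
  have "(csqrt (- 2 * r\<^sup>2 - A))\<^sup>2 = - 2 * r\<^sup>2 - A" by (rule power2_csqrt)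
  then have "(q + r)\<^sup>2 = - 2 * r\<^sup>2 - A" by (simp only: q_def) simp
  then have q: "q\<^sup>2 + 2 * r * q + A + 3 * r\<^sup>2 = 0" by Groebner_Basis.algebra
  have "q ^ 4 + A * q\<^sup>2 + C * q + B = 0" using q r r1 by Groebner_Basis.algebra
  then have q1: "4 * q ^ 3 + 2 * A * q + C = 0" using even by blast
  show ?thesis
  proof (cases "q = r")
    case True
    have A: "6 * r\<^sup>2 + A = 0" using q unfolding True by Groebner_Basis.algebra
    then have "r = 0" using even[OF r] by simp
    then show ?thesis using A r r1 by simp
  next
    case False
    \<comment> \<open>This is the difference of the two derivative conditions, with \<open>A\<close>
      expressed through \<open>q\<close> and \<open>r\<close>. The resulting \<open>q = - r\<close>
      makes the quartic \<open>(X\<^sup>2 - r\<^sup>2)\<^sup>2\<close>.\<close>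
    have "(q - r) * ((q - r) * (q + r)) = 0" using q q1 r1 by Groebner_Basis.algebra
    then have "q + r = 0" using False by simp
    then have A: "A + 2 * r\<^sup>2 = 0" using q by Groebner_Basis.algebra
    have "C = 0" using A r1 by Groebner_Basis.algebra
    moreover have "A\<^sup>2 - 4 * B = 0" using A r r1 by Groebner_Basis.algebra
    ultimately show ?thesis by simp
  qed
qed

lemma eval_linear_form: "eval T (\<Sum>i\<in>UNIV. const (n i) * var i) = (\<Sum>i\<in>UNIV. n i * T i)"
  by (simp add: eval.hom_sum eval_mult)

text \<open>Tangency makes the gradient at \<open>P\<close> vanish along the whole line. The
  gradient is nonzero by smoothness, so the line is the tangent at \<open>P\<close> and is
  determined by \<open>P\<close> alone.\<close>

lemma proj_zeros_bitangent_through_point_on_curve: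
  assumes lam: "lam ^ 2 + 3 * lam + 18 = 0"
    and l: "bitangent (klein_quartic lam) l" and P: "P \<in> proj_zeros l"
    and zero: "eval P (klein_quartic lam) = 0"
  shows "proj_zeros l = {T. (\<exists>i. T i \<noteq> 0) \<and>
    (\<Sum>i\<in>UNIV. eval P (partial_deriv i (klein_quartic lam)) * T i) = 0}"
proof -
  define N where "N i = eval P (partial_deriv i (klein_quartic lam))" for i
  have "\<exists>i. P i \<noteq> 0" using P by (simp add: proj_zeros_def)
  then obtain k where k: "N k \<noteq> 0"
    using klein_quartic_smooth[OF lam, of P] unfolding N_def by blast
  have l1: "homogeneous 1 l" "l \<noteq> 0" using l by (auto simp: bitangent_def is_line_def)
  then obtain n where n: "l = (\<Sum>i\<in>UNIV. const (n i) * var i)" using linear_form_expansion by blast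
  have NP: "(\<Sum>i\<in>UNIV. N i * P i) = 0"
  proof -
    have "eval P (\<Sum>i\<in>UNIV. var i * partial_deriv i (klein_quartic lam)) = eval P (of_int 4 * klein_quartic lam)"
      unfolding euler_homogeneous[OF homogeneous_klein_quartic] ..
    then show ?thesis using zero by (simp add: eval.hom_sum eval_mult N_def mult.commute)
  qed
  have NT: "(\<Sum>i\<in>UNIV. N i * T i) = 0" if T: "(\<Sum>i\<in>UNIV. n i * T i) = 0" for T
  proof (cases "\<exists>i. T i \<noteq> 0")
    case True
    then have T': "T \<in> proj_zeros l" using T by (simp add: proj_zeros_def n eval_linear_form)
    show ?thesis
    proof (cases "same_point P T")
      case True
      then obtain c where "\<And>i. T i = c * P i" by (auto simp: same_point_def)
      then have "(\<Sum>i\<in>UNIV. N i * T i) = c * (\<Sum>i\<in>UNIV. N i * P i)"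
        by (simp add: sum_distrib_left mult_ac)
      then show ?thesis using NP by simp
    next
      case False
      then show ?thesis
        using bitangent_coeff(1)[OF l P T' False] zero coeff_restrict_line[of "klein_quartic lam" P T]
        by (simp add: N_def mult.commute)
    qed
  qed simp
  have par: "N i * n j = N j * n i" for i j
  proof (cases "i = j")
    case False
    \<comment> \<open>This vector is a zero of the linear form with coefficients \<open>n\<close>;
      the gradient applied to it is a 2 by 2 minor of the rows \<open>N\<close> and
      \<open>n\<close>.\<close>
    let ?T = "\<lambda>m. if m = i then n j else if m = j then - n i else 0"
    have s: "(\<Sum>m\<in>UNIV. c m * ?T m) = c i * n j - c j * n i" for c :: "3 \<Rightarrow> complex"
    proof -
      have "(\<Sum>m\<in>UNIV. c m * ?T m) = (\<Sum>m\<in>{i, j}. c m * ?T m)"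
        by (intro sum.mono_neutral_right) auto
      then show ?thesis using False by simp
    qed
    have "(\<Sum>m\<in>UNIV. n m * ?T m) = 0" unfolding s by simp
    from NT[OF this] show ?thesis unfolding s by simp
  qed simp
  have "n k \<noteq> 0"
  proof
    assume "n k = 0"
    then have "n j = 0" for j using par[of k j] k by simp
    then show False using l1(2) by (simp add: n)
  qed
  have "N k * (\<Sum>i\<in>UNIV. n i * T i) = n k * (\<Sum>i\<in>UNIV. N i * T i)" (is "_ * ?a T = _ * ?b T") for T
    using par[of k] by (simp add: sum_distrib_left mult.assoc[symmetric] mult.commute[of "n k"])
  then have "N k * ?a T = 0 \<longleftrightarrow> n k * ?b T = 0" for T by simp
  then have "?a T = 0 \<longleftrightarrow> ?b T = 0" for T using k \<open>n k \<noteq> 0\<close> by simp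
  then show ?thesis by (simp add: proj_zeros_def n eval_linear_form N_def)
qed

section \<open>Coordinates at the common point\<close>

definition det3 :: "(3 \<Rightarrow> complex) \<Rightarrow> (3 \<Rightarrow> complex) \<Rightarrow> (3 \<Rightarrow> complex) \<Rightarrow> complex" where
  "det3 a b c = a 0 * (b 1 * c 2 - b 2 * c 1) + a 1 * (b 2 * c 0 - b 0 * c 2) + a 2 * (b 0 * c 1 - b 1 * c 0)"

text \<open>If \<open>N k\<close> is nonzero, two standard vectors orthogonal to \<open>N\<close>
  span its kernel, and their determinant with \<open>P\<close> is \<open>N k\<close> times the value
  of \<open>N\<close> on \<open>P\<close>.\<close>

lemma hyperplane_basis:
  fixes N P :: "3 \<Rightarrow> complex"
  assumes "(\<Sum>i\<in>UNIV. N i * P i) \<noteq> 0"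
  obtains e1 e2 where "(\<Sum>i\<in>UNIV. N i * e1 i) = 0" "(\<Sum>i\<in>UNIV. N i * e2 i) = 0" "det3 e1 e2 P \<noteq> 0"
proof -
  have NP: "N 0 * P 0 + N 1 * P 1 + N 2 * P 2 \<noteq> 0" using assms by (simp add: sum_3)
  then consider "N 0 \<noteq> 0" | "N 1 \<noteq> 0" | "N 2 \<noteq> 0" by fastforce
  then show thesis
  proof cases
    case 1
    have "det3 (pt (N 1) (- N 0) 0) (pt (N 2) 0 (- N 0)) P = N 0 * (N 0 * P 0 + N 1 * P 1 + N 2 * P 2)"
      by (simp add: det3_def algebra_simps)
    then show thesis using NP 1
      by (intro that[of "pt (N 1) (- N 0) 0" "pt (N 2) 0 (- N 0)"]) (simp_all add: sum_3)
  next
    case 2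
    have "det3 (pt (N 1) (- N 0) 0) (pt 0 (N 2) (- N 1)) P = N 1 * (N 0 * P 0 + N 1 * P 1 + N 2 * P 2)"
      by (simp add: det3_def algebra_simps)
    then show thesis using NP 2
      by (intro that[of "pt (N 1) (- N 0) 0" "pt 0 (N 2) (- N 1)"]) (simp_all add: sum_3)
  next
    case 3
    have "det3 (pt (N 2) 0 (- N 0)) (pt 0 (N 2) (- N 1)) P = N 2 * (N 0 * P 0 + N 1 * P 1 + N 2 * P 2)"
      by (simp add: det3_def algebra_simps)
    then show thesis using NP 3
      by (intro that[of "pt (N 2) 0 (- N 0)" "pt 0 (N 2) (- N 1)"]) (simp_all add: sum_3)
  qed
qed

definition coords :: "(3 \<Rightarrow> complex) \<Rightarrow> (3 \<Rightarrow> complex) \<Rightarrow> (3 \<Rightarrow> complex) \<Rightarrow> 3 \<Rightarrow> mpoly3" where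
  "coords e1 e2 e3 i = const (e1 i) * var 0 + const (e2 i) * var 1 + const (e3 i) * var 2"

lemma homogeneous_coords: "homogeneous 1 (coords e1 e2 e3 i)"
  unfolding coords_def
  by (intro homogeneous_add homogeneous_multI[OF homogeneous_const homogeneous_var]) simp_all

lemma linear_change_coords:
  assumes "det3 e1 e2 e3 \<noteq> 0"
  obtains w where "linear_change (coords e1 e2 e3) w"
proof -
  define d where "d = 1 / det3 e1 e2 e3"
  have d: "d * det3 e1 e2 e3 = 1" using assms by (simp add: d_def)
  \<comment> \<open>The rows of the inverse matrix are the cross products of pairs of columns,
    divided by the determinant. As \<open>coords\<close> takes columns, \<open>w\<close> receives
    the transposed entries.\<close>
  define m1 where "m1 = pt (d * (e2 1 * e3 2 - e2 2 * e3 1)) (d * (e2 2 * e3 0 - e2 0 * e3 2)) (d * (e2 0 * e3 1 - e2 1 * e3 0))"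
  define m2 where "m2 = pt (d * (e3 1 * e1 2 - e3 2 * e1 1)) (d * (e3 2 * e1 0 - e3 0 * e1 2)) (d * (e3 0 * e1 1 - e3 1 * e1 0))"
  define m3 where "m3 = pt (d * (e1 1 * e2 2 - e1 2 * e2 1)) (d * (e1 2 * e2 0 - e1 0 * e2 2)) (d * (e1 0 * e2 1 - e1 1 * e2 0))"
  define w where "w = coords (pt (m1 0) (m2 0) (m3 0)) (pt (m1 1) (m2 1) (m3 1)) (pt (m1 2) (m2 2) (m3 2))"
  have comp: "subst (coords a1 a2 a3) (coords b1 b2 b3 i)
    = const (b1 i * a1 0 + b2 i * a1 1 + b3 i * a1 2) * var 0
    + const (b1 i * a2 0 + b2 i * a2 1 + b3 i * a2 2) * var 1
    + const (b1 i * a3 0 + b2 i * a3 1 + b3 i * a3 2) * var 2" for a1 a2 a3 b1 b2 b3 i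
    unfolding coords_def
    by (simp add: subst.subst_poly_add subst.subst_poly_mult const.hom_add const.hom_mult algebra_simps)
  have cols:
    "m1 0 * e1 0 + m1 1 * e1 1 + m1 2 * e1 2 = d * det3 e1 e2 e3" "m1 0 * e2 0 + m1 1 * e2 1 + m1 2 * e2 2 = 0" "m1 0 * e3 0 + m1 1 * e3 1 + m1 2 * e3 2 = 0"
    "m2 0 * e1 0 + m2 1 * e1 1 + m2 2 * e1 2 = 0" "m2 0 * e2 0 + m2 1 * e2 1 + m2 2 * e2 2 = d * det3 e1 e2 e3" "m2 0 * e3 0 + m2 1 * e3 1 + m2 2 * e3 2 = 0"
    "m3 0 * e1 0 + m3 1 * e1 1 + m3 2 * e1 2 = 0" "m3 0 * e2 0 + m3 1 * e2 1 + m3 2 * e2 2 = 0" "m3 0 * e3 0 + m3 1 * e3 1 + m3 2 * e3 2 = d * det3 e1 e2 e3"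
    by (simp_all add: m1_def m2_def m3_def det3_def algebra_simps)
  have rows:
    "e1 0 * m1 0 + e2 0 * m2 0 + e3 0 * m3 0 = d * det3 e1 e2 e3" "e1 0 * m1 1 + e2 0 * m2 1 + e3 0 * m3 1 = 0" "e1 0 * m1 2 + e2 0 * m2 2 + e3 0 * m3 2 = 0"
    "e1 1 * m1 0 + e2 1 * m2 0 + e3 1 * m3 0 = 0" "e1 1 * m1 1 + e2 1 * m2 1 + e3 1 * m3 1 = d * det3 e1 e2 e3" "e1 1 * m1 2 + e2 1 * m2 2 + e3 1 * m3 2 = 0"
    "e1 2 * m1 0 + e2 2 * m2 0 + e3 2 * m3 0 = 0" "e1 2 * m1 1 + e2 2 * m2 1 + e3 2 * m3 1 = 0" "e1 2 * m1 2 + e2 2 * m2 2 + e3 2 * m3 2 = d * det3 e1 e2 e3"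
    by (simp_all add: m1_def m2_def m3_def det3_def algebra_simps)
  have i: "i = 0 \<or> i = 1 \<or> i = 2" for i :: 3
    using forall_3[of "\<lambda>i. i = 0 \<or> i = 1 \<or> i = 2"] by simp
  have "subst (coords e1 e2 e3) (w i) = var i" for i
  proof -
    have "subst (coords e1 e2 e3) (w 0) = var 0" "subst (coords e1 e2 e3) (w 1) = var 1"
      "subst (coords e1 e2 e3) (w 2) = var 2"
      unfolding w_def comp by (simp_all add: cols d)
    then show ?thesis using i[of i] by auto
  qed
  moreover have "subst w (coords e1 e2 e3 i) = var i" for i
  proof -
    have "subst w (coords e1 e2 e3 0) = var 0" "subst w (coords e1 e2 e3 1) = var 1"
      "subst w (coords e1 e2 e3 2) = var 2"
      unfolding w_def comp by (simp_all add: rows d)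
    then show ?thesis using i[of i] by auto
  qed
  ultimately show thesis
    by (intro that[of w], unfold_locales) (simp_all add: homogeneous_coords w_def)
qed

context linear_change
begin

lemma eval_w: "eval (\<lambda>i. eval X (v i)) (w k) = X k"
  unfolding eval_subst[symmetric] by simp

lemma eval_v_inj:
  assumes "\<And>i. eval X (v i) = eval Y (v i)" shows "X = Y"
proof
  fix k
  have "(\<lambda>i. eval X (v i)) = (\<lambda>i. eval Y (v i))" using assms by blast
  then show "X k = Y k" using eval_w[of X k] eval_w[of Y k] by simp
qed

lemma singular_point_subst:
  assumes "\<And>j. eval X (partial_deriv j (subst v f)) = 0"
  shows "eval (\<lambda>i. eval X (v i)) (partial_deriv i f) = 0"
proof -
  let ?Y = "\<lambda>i. eval X (v i)"
  have "partial_deriv i f = partial_deriv i (subst w (subst v f))" by simp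
  also have "\<dots> = (\<Sum>j\<in>UNIV. partial_deriv i (w j) * subst w (partial_deriv j (subst v f)))"
    by (rule partial_deriv_subst)
  finally have "eval ?Y (partial_deriv i f)
      = (\<Sum>j\<in>UNIV. eval ?Y (partial_deriv i (w j)) * eval ?Y (subst w (partial_deriv j (subst v f))))"
    by (simp add: eval.hom_sum eval_mult)
  moreover have "eval ?Y (subst w g) = eval X g" for g by (simp add: eval_subst eval_w)
  ultimately show ?thesis using assms by simp
qed

end

lemma binary_formI:
  assumes "homogeneous (int n) h" "subst zero_z h = h"
  shows "binary_form n h"
proof -
  obtain g where g: "\<And>k. k \<le> n \<Longrightarrow> binary_form (n - k) (g k)" "h = (\<Sum>k\<le>n. var 2 ^ k * g k)"
    using homogeneous_z_expansion[OF assms(1)] by blast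
  have "subst zero_z (var 2 ^ k * g k) = (if k = 0 then subst zero_z (g 0) else 0)" for k
    by (simp add: subst.subst_poly_mult subst.subst.hom_power)
  then have "subst zero_z h = subst zero_z (g 0)"
    by (simp add: g(2) subst.subst.hom_sum)
  moreover have "subst zero_z (g 0) = g 0" using g(1)[of 0] by (rule subst_binary_form) simp_all
  ultimately show ?thesis using assms(2) g(1)[of 0] by simp
qed

text \<open>Splitting off \<open>n\<close> of the zeros leaves a constant, which the last zero
  forces to be 0.\<close>

lemma binary_form_eq_0:
  assumes "binary_form n h"
    and "\<And>i. i \<le> n \<Longrightarrow> a i \<noteq> 0 \<or> b i \<noteq> 0"
    and "\<And>i. i \<le> n \<Longrightarrow> eval (pt (a i) (b i) 0) h = 0"
    and "\<And>i j. i \<le> n \<Longrightarrow> j \<le> n \<Longrightarrow> i \<noteq> j \<Longrightarrow> b i * a j \<noteq> a i * b j"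
  shows "h = 0"
proof -
  obtain g where g: "binary_form 0 g" "h = (\<Prod>i<n. line (a i) (b i)) * g"
    by (rule binary_form_prod_lines[of 0 n h a b]) (use assms in auto)
  obtain c where c: "g = const c" using binary_form_0_const[OF g(1)] by blast
  have "eval (pt (a n) (b n) 0) (\<Prod>i<n. line (a i) (b i)) \<noteq> 0"
    using assms(4)[of _ n] by (auto simp: eval.hom_prod)
  then have "c = 0" using assms(3)[of n] by (simp add: g(2) c eval_mult)
  then show ?thesis by (simp add: g(2) c)
qed

text \<open>The representative of \<open>P\<close> with value 1 makes the quartic monic in
  \<open>z\<close>. In coordinates adapted to \<open>P\<close> the data satisfy
  \<open>quadruple_point\<close>, and the conclusion is carried back along the change of
  coordinates.\<close>

lemma plus_one_generated_klein_normalized: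
  assumes lam: "lam ^ 2 + 3 * lam + 18 = 0"
    and bit: "\<And>i. i < 4 \<Longrightarrow> bitangent (klein_quartic lam) (l i)"
    and P: "\<And>i. i < 4 \<Longrightarrow> P \<in> proj_zeros (l i)"
    and inj: "\<And>i j. i < 4 \<Longrightarrow> j < 4 \<Longrightarrow> proj_zeros (l i) = proj_zeros (l j) \<Longrightarrow> i = (j :: nat)"
    and one: "eval P (klein_quartic lam) = 1"
  shows "plus_one_generated (klein_quartic lam * (\<Prod>i<4. l i)) 4 4 7"
proof -
  define f where "f = klein_quartic lam"
  \<comment> \<open>\<open>N\<close> gives the polar line of \<open>P\<close>. Taking
    \<open>e1\<close> and \<open>e2\<close> on it removes the term in \<open>z\<^sup>3\<close>;
    \<open>P\<close> is off this line because \<open>N\<close> takes the value 4 at it by Euler's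
    relation.\<close>
  define N where "N i = eval P (partial_deriv i f)" for i
  have "(\<Sum>i\<in>UNIV. N i * P i) = 4"
  proof -
    have "eval P (\<Sum>i\<in>UNIV. var i * partial_deriv i f) = eval P (of_int 4 * f)"
      unfolding f_def euler_homogeneous[OF homogeneous_klein_quartic] ..
    then show ?thesis
      using one by (simp add: eval.hom_sum eval_mult eval.hom_numeral N_def mult.commute f_def)
  qed
  then have "(\<Sum>i\<in>UNIV. N i * P i) \<noteq> 0" by simp
  then obtain e1 e2 where e: "(\<Sum>i\<in>UNIV. N i * e1 i) = 0" "(\<Sum>i\<in>UNIV. N i * e2 i) = 0"
    and det: "det3 e1 e2 P \<noteq> 0" by (rule hyperplane_basis)
  define v where "v = coords e1 e2 P"
  obtain w where "linear_change v w" using linear_change_coords[OF det] unfolding v_def by blast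
  then interpret linear_change v w .
  define E where "E s t r = (\<lambda>i. eval (pt s t r) (v i))" for s t r
  have E: "E s t r i = s * e1 i + t * e2 i + r * P i" for s t r i
    by (simp add: E_def v_def coords_def eval_add eval_mult mult.commute)
  have E_inj: "s = s' \<and> t = t' \<and> r = r'" if "E s t r = E s' t' r'" for s t r s' t' r'
  proof -
    have "pt s t r = pt s' t' r'"
      using that unfolding E_def by (intro eval_v_inj) (rule fun_cong)
    then have "pt s t r i = pt s' t' r' i" for i by simp
    from this[of 0] this[of 1] this[of 2] show ?thesis by simp
  qed
  have E_P: "E 0 0 1 = P" by (rule ext) (simp add: E)
  have E_zero: "E 0 0 0 = (\<lambda>_. 0)" by (rule ext) (simp add: E)

  have "homogeneous (int 4) (subst v f)"
    using homogeneous_subst[OF homogeneous_klein_quartic homogeneous_v] by (simp add: f_def)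
  then obtain h where h: "\<And>k. k \<le> 4 \<Longrightarrow> binary_form (4 - k) (h k)" "subst v f = (\<Sum>k\<le>4. var 2 ^ k * h k)"
    using homogeneous_z_expansion by blast
  have bf: "binary_form 4 (h 0)" "binary_form 3 (h 1)" "binary_form 2 (h 2)" "binary_form 1 (h 3)" "binary_form 0 (h 4)"
    using h(1)[of 0] h(1)[of 1] h(1)[of 2] h(1)[of 3] h(1)[of 4] by simp_all
  have sum5: "(\<Sum>k\<le>4. g k) = g 0 + g 1 + g 2 + g 3 + g 4" for g :: "nat \<Rightarrow> 'a :: comm_monoid_add"
    by (simp add: eval_nat_numeral)
  have f_sum: "subst v f = h 0 + var 2 * h 1 + var 2 ^ 2 * h 2 + var 2 ^ 3 * h 3 + var 2 ^ 4 * h 4"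
    using h(2) unfolding sum5 by simp
  define H where "H k s t = eval (pt s t 0) (h k)" for k s t
  have H: "eval (pt s t r) (h k) = H k s t" if "k \<le> 4" for k s t r
    using eval_binary_form[OF h(1)[OF that], of "pt s t r" 0] by (simp add: H_def)
  have H_scale: "H k (\<tau> * s) (\<tau> * t) = \<tau> ^ (4 - k) * H k s t" if "k \<le> 4" for k \<tau> s t
  proof -
    have "pt (\<tau> * s) (\<tau> * t) 0 = (\<lambda>i. \<tau> * pt s t 0 i)" by (rule pt_eqI[symmetric]) simp_all
    then show ?thesis
      unfolding H_def using eval_scale[OF binary_form_homogeneous[OF h(1)[OF that]]] by simp
  qed
  have val: "eval (E s t r) f = H 0 s t + r * H 1 s t + r ^ 2 * H 2 s t + r ^ 3 * H 3 s t + r ^ 4 * H 4 s t" for s t r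
  proof -
    have "eval (E s t r) f = eval (pt s t r) (subst v f)" by (simp add: E_def eval_subst)
    then show ?thesis by (simp add: f_sum eval_add eval_mult eval.hom_power H)
  qed
  have h4: "h 4 = 1"
  proof -
    obtain c where c: "h 4 = const c" using binary_form_0_const[OF bf(5)] by blast
    have "H k 0 0 = 0" if "k < 4" for k
    proof -
      have z: "(0 :: complex) ^ (4 - k) = 0" using that by (intro zero_power) simp
      have "H k (0 * 0) (0 * 0) = 0 ^ (4 - k) * H k 0 0" using that by (intro H_scale) simp
      then show ?thesis by (simp only: z mult_zero_left)
    qed
    moreover have "H 4 0 0 = c" by (simp add: H_def c)
    ultimately have "c = 1" using val[of 0 0 1] one by (simp add: E_P f_def)
    then show ?thesis by (simp add: c)
  qed
  then have H4: "H 4 s t = 1" for s t by (simp add: H_def)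
  have H3: "H 3 s t = 0" for s t
  proof -
    \<comment> \<open>Expanded from \<open>P\<close> towards \<open>E s t 0\<close>, the quartic has
      linear coefficient \<open>H 3 s t\<close>; this is also its derivative at \<open>P\<close>
      along a vector of the polar line, hence zero.\<close>
    let ?q = "restrict_line f P (E s t 0)"
    have "poly ?q \<tau> = poly [:1, H 3 s t, H 2 s t, H 1 s t, H 0 s t:] \<tau>" for \<tau>
    proof -
      have "(\<lambda>i. P i + \<tau> * E s t 0 i) = E (\<tau> * s) (\<tau> * t) 1"
        by (rule ext) (simp add: E algebra_simps)
      then have "poly ?q \<tau> = eval (E (\<tau> * s) (\<tau> * t) 1) f" by (simp add: poly_restrict_line)
      then show ?thesis
        by (simp add: val H_scale H4 algebra_simps power2_eq_square power3_eq_cube power4_eq_xxxx)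
    qed
    then have "poly ?q = poly [:1, H 3 s t, H 2 s t, H 1 s t, H 0 s t:]" by (rule ext)
    then have "?q = [:1, H 3 s t, H 2 s t, H 1 s t, H 0 s t:]" by (simp only: poly_eq_poly_eq_iff)
    then have "H 3 s t = coeff ?q 1" by simp
    also have "\<dots> = s * (\<Sum>i\<in>UNIV. N i * e1 i) + t * (\<Sum>i\<in>UNIV. N i * e2 i)"
      unfolding coeff_restrict_line by (simp add: E N_def sum_3 algebra_simps)
    finally show ?thesis using e by simp
  qed
  have h3: "h 3 = 0"
    by (rule binary_form_eq_0[OF bf(4), of "\<lambda>i. if i = 0 then 1 else 0" "\<lambda>i. if i = 0 then 0 else 1"])
      (auto simp: H_def[symmetric] H3 le_Suc_eq)

  have "\<exists>a b. subst v (l i) = line a b" if i: "i < 4" for i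
  proof -
    have "homogeneous 1 (subst v (l i))"
      using bit[OF i] by (intro homogeneous_subst homogeneous_v) (simp add: bitangent_def is_line_def)
    then obtain n where n: "subst v (l i) = (\<Sum>j\<in>UNIV. const (n j) * var j)" by (rule linear_form_expansion)
    have "eval (pt 0 0 1) (subst v (l i)) = eval P (l i)"
      unfolding eval_subst using E_P by (simp add: E_def)
    then have "n 2 = 0" using P[OF i] unfolding n eval_linear_form by (simp add: sum_3 proj_zeros_def)
    then have "subst v (l i) = line (- n 1) (n 0)"
      unfolding n by (simp add: sum_3 line_def const.hom_uminus)
    then show ?thesis by blast
  qed
  then obtain a b where ab: "\<And>i. i < 4 \<Longrightarrow> subst v (l i) = line (a i) (b i)" by metis
  have ab0: "a i \<noteq> 0 \<or> b i \<noteq> 0" if i: "i < 4" for i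
  proof (rule ccontr)
    assume "\<not> (a i \<noteq> 0 \<or> b i \<noteq> 0)"
    then have "subst v (l i) = 0" using ab[OF i] by (simp add: line_def)
    then have "subst w (subst v (l i)) = 0" by simp
    then show False using bit[OF i] by (simp add: bitangent_def is_line_def)
  qed
  have distinct: "b i * a j \<noteq> a i * b j" if ij: "i < 4" "j < 4" "i \<noteq> j" for i j
  proof
    assume eq: "b i * a j = a i * b j"
    obtain \<kappa> where \<kappa>: "a i = \<kappa> * a j" "b i = \<kappa> * b j"
    proof (cases "a j = 0")
      case True
      then have "b j \<noteq> 0" using ab0[OF ij(2)] by simp
      then show thesis using that[of "b i / b j"] eq True by simp
    next
      case False
      then show thesis using that[of "a i / a j"] eq by (simp add: field_simps)
    qed
    have "line (a i) (b i) = const \<kappa> * line (a j) (b j)"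
      by (simp add: \<kappa> line_def const.hom_mult algebra_simps)
    then have "subst w (subst v (l i)) = const \<kappa> * subst w (subst v (l j))"
      using ab ij by (simp add: subst.subst_poly_mult)
    then have l: "l i = const \<kappa> * l j" by simp
    have "\<kappa> \<noteq> 0" using ab0[OF ij(1)] \<kappa> by auto
    then have "proj_zeros (l i) = proj_zeros (l j)" by (simp add: l proj_zeros_def eval_mult)
    then show False using inj ij by blast
  qed

  \<comment> \<open>With \<open>P\<close> as the second point, the parameter of the restriction is a
    shift of \<open>r\<close>, so the coefficients are the Taylor coefficients of the depressed
    quartic at its root \<open>r\<close>.\<close>
  have tangent: "H 1 (a i) (b i) = 0 \<and> (H 2 (a i) (b i))\<^sup>2 = 4 * H 0 (a i) (b i)" if i: "i < 4" for i
  proof (rule depressed_quartic_square)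
    let ?A = "H 2 (a i) (b i)" and ?C = "H 1 (a i) (b i)" and ?B = "H 0 (a i) (b i)"
    fix r assume r: "r ^ 4 + ?A * r\<^sup>2 + ?C * r + ?B = 0"
    let ?R = "E (a i) (b i) r"
    have "\<exists>j. ?R j \<noteq> 0"
    proof (rule ccontr)
      assume "\<nexists>j. ?R j \<noteq> 0"
      then have "?R = E 0 0 0" unfolding E_zero by (intro ext) simp
      then show False using E_inj ab0[OF i] by blast
    qed
    moreover have "eval ?R (l i) = 0"
    proof -
      have "eval ?R (l i) = eval (pt (a i) (b i) r) (subst v (l i))" by (simp add: E_def eval_subst)
      then show ?thesis using ab[OF i] by simp
    qed
    ultimately have R: "?R \<in> proj_zeros (l i)" by (simp add: proj_zeros_def)
    have not_same: "\<not> same_point ?R P"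
    proof
      assume "same_point ?R P"
      then obtain c where c: "c \<noteq> 0" "\<And>j. P j = c * ?R j" by (auto simp: same_point_def)
      have "E 0 0 1 = E (c * a i) (c * b i) (c * r)"
        unfolding E_P by (rule ext) (simp add: c(2), simp add: E algebra_simps)
      then show False using E_inj c(1) ab0[OF i] by fastforce
    qed
    let ?q = "restrict_line f ?R P"
    have "poly ?q \<tau> = poly [:r ^ 4 + ?A * r\<^sup>2 + ?C * r + ?B, 4 * r ^ 3 + 2 * ?A * r + ?C, 6 * r\<^sup>2 + ?A, 4 * r, 1:] \<tau>" for \<tau>
    proof -
      have "(\<lambda>j. ?R j + \<tau> * P j) = E (a i) (b i) (r + \<tau>)"
        by (rule ext) (simp add: E algebra_simps)
      then have "poly ?q \<tau> = eval (E (a i) (b i) (r + \<tau>)) f" by (simp add: poly_restrict_line)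
      then show ?thesis
        by (simp add: val H4 H3 algebra_simps power2_eq_square power3_eq_cube power4_eq_xxxx)
    qed
    then have "poly ?q = poly [:r ^ 4 + ?A * r\<^sup>2 + ?C * r + ?B, 4 * r ^ 3 + 2 * ?A * r + ?C, 6 * r\<^sup>2 + ?A, 4 * r, 1:]"
      by (rule ext)
    then have q: "?q = [:r ^ 4 + ?A * r\<^sup>2 + ?C * r + ?B, 4 * r ^ 3 + 2 * ?A * r + ?C, 6 * r\<^sup>2 + ?A, 4 * r, 1:]"
      by (simp only: poly_eq_poly_eq_iff)
    have "coeff ?q 0 = 0" using r by (simp add: q)
    note even = bitangent_coeff[OF bit[OF i, folded f_def] R P[OF i] not_same this]
    then show "4 * r ^ 3 + 2 * ?A * r + ?C = 0 \<and> (6 * r\<^sup>2 + ?A = 0 \<longrightarrow> 4 * r = 0)"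
      by (simp add: q numeral_3_eq_3 numeral_2_eq_2)
  qed
  have h1: "h 1 = 0"
  proof (rule binary_form_eq_0[OF bf(2), of a b])
    fix i :: nat assume "i \<le> 3"
    then have i: "i < 4" by simp
    show "a i \<noteq> 0 \<or> b i \<noteq> 0" by (rule ab0[OF i])
    show "eval (pt (a i) (b i) 0) (h 1) = 0" using tangent[OF i] by (simp only: H_def)
    show "b i * a j \<noteq> a i * b j" if "j \<le> 3" "i \<noteq> j" for j
      using distinct[OF i, of j] that by simp
  qed

  define A where "A = h 2"
  define B where "B = h 0"
  have A: "binary_form 2 A" and B: "binary_form 4 B" using bf by (simp_all add: A_def B_def)
  have f': "subst v f = var 2 ^ 4 + var 2 ^ 2 * A + B"
    unfolding f_sum h1 h3 h4 A_def B_def by simp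
  have smooth: "X = pt 0 0 0" if sing: "\<And>j. eval X (partial_deriv j (subst v f)) = 0" for X
  proof -
    have "eval (\<lambda>i. eval X (v i)) (partial_deriv i f) = 0" for i
      using sing by (rule singular_point_subst)
    then have "eval X (v i) = 0" for i unfolding f_def by (rule klein_quartic_smooth[OF lam])
    then show ?thesis
      using E_zero by (intro eval_v_inj) (simp add: E_def fun_eq_iff)
  qed

  have "binary_form 4 (A\<^sup>2 - 4 * B)"
  proof (rule binary_formI)
    have "homogeneous 4 (A\<^sup>2 - 4 * B)"
      using binary_form_homogeneous[OF A] binary_form_homogeneous[OF B]
      by (intro homogeneous_diff homogeneous_powerI[where k = 2] homogeneous_multI[OF homogeneous_numeral]) simp_all
    then show "homogeneous (int 4) (A\<^sup>2 - 4 * B)" by simp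
    show "subst zero_z (A\<^sup>2 - 4 * B) = A\<^sup>2 - 4 * B"
      using subst_binary_form[OF A, of zero_z] subst_binary_form[OF B, of zero_z]
      by (simp add: subst.subst.hom_minus subst.subst.hom_power subst.subst_poly_mult subst.subst.hom_numeral)
  qed
  moreover have "eval (pt (a i) (b i) 0) (A\<^sup>2 - 4 * B) = 0" if "i < 4" for i
    using tangent[OF that] by (simp add: A_def B_def H_def eval.hom_minus eval.hom_power eval_mult eval.hom_numeral)
  ultimately obtain g where g: "binary_form 0 g" "A\<^sup>2 - 4 * B = (\<Prod>i<4. line (a i) (b i)) * g"
    using binary_form_prod_lines[of 0 4 "A\<^sup>2 - 4 * B" a b] ab0 distinct by auto
  obtain c where c: "g = const c" using binary_form_0_const[OF g(1)] by blast
  have dA: "partial_deriv 2 A = 0" and dB: "partial_deriv 2 B = 0"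
    using partial_deriv_binary_form A B by blast+
  have "c \<noteq> 0"
  proof
    text \<open>Otherwise the quartic is a double conic.\<close>
    assume "c = 0"
    then have "4 * B = A\<^sup>2" using g(2) c by simp
    then have "4 * subst v f = (2 * var 2 ^ 2 + A) ^ 2"
      unfolding f' by (simp add: power2_eq_square power4_eq_xxxx algebra_simps)
    then have "partial_deriv j (4 * subst v f) = partial_deriv j ((2 * var 2 ^ 2 + A) ^ 2)" for j by simp
    then have d: "4 * partial_deriv j (subst v f) = 2 * (2 * var 2 ^ 2 + A) * partial_deriv j (2 * var 2 ^ 2 + A)" for j
      by (simp only: partial_deriv_mult partial_deriv_power partial_deriv_numeral) simp
    \<comment> \<open>A point with first coordinate 1 on the conic
      \<open>2 z\<^sup>2 + A = 0\<close>; the gradient of the squared form vanishes there, against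
      smoothness.\<close>
    define X where "X = pt 1 0 (csqrt (- H 2 1 0 / 2))"
    have "(csqrt (- H 2 1 0 / 2))\<^sup>2 = - H 2 1 0 / 2" by (rule power2_csqrt)
    then have X0: "eval X (2 * var 2 ^ 2 + A) = 0"
      by (simp add: X_def A_def H eval_add eval_mult eval.hom_power eval.hom_numeral)
    have "eval X (4 * partial_deriv j (subst v f)) = 0" for j
      unfolding d eval_mult X0 by simp
    then have "X = pt 0 0 0" by (intro smooth) (simp add: eval_mult eval.hom_numeral)
    then have "X 0 = 0" by simp
    then show False by (simp add: X_def)
  qed
  moreover have "eval (pt s t 0) (partial_deriv 0 A * partial_deriv 1 B - partial_deriv 1 A * partial_deriv 0 B) \<noteq> 0"
    if st: "s \<noteq> 0 \<or> t \<noteq> 0" and B0: "eval (pt s t 0) B = 0" for s t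
  proof
    let ?e = "eval (pt s t 0)"
    assume J: "?e (partial_deriv 0 A * partial_deriv 1 B - partial_deriv 1 A * partial_deriv 0 B) = 0"
    define Ax Ay Bx By where "Ax = ?e (partial_deriv 0 A)" and "Ay = ?e (partial_deriv 1 A)"
      and "Bx = ?e (partial_deriv 0 B)" and "By = ?e (partial_deriv 1 B)"
    have J': "Ax * By - Ay * Bx = 0"
      using J by (simp add: Ax_def Ay_def Bx_def By_def eval.hom_minus eval_mult)
    have eA: "s * Ax + t * Ay - 2 * ?e A = 0"
    proof -
      have "?e (\<Sum>i\<in>UNIV. var i * partial_deriv i A) = ?e (of_int (int 2) * A)"
        using euler_homogeneous[OF binary_form_homogeneous[OF A]] by simp
      then show ?thesis by (simp add: sum_3 eval_add eval_mult eval.hom_numeral Ax_def Ay_def)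
    qed
    have eB: "s * Bx + t * By = 0"
    proof -
      have "?e (\<Sum>i\<in>UNIV. var i * partial_deriv i B) = ?e (of_int (int 4) * B)"
        using euler_homogeneous[OF binary_form_homogeneous[OF B]] by simp
      then show ?thesis by (simp add: sum_3 eval_add eval_mult eval.hom_numeral Bx_def By_def B0)
    qed
    \<comment> \<open>Since \<open>B\<close> vanishes at the point, its gradient is orthogonal to
      \<open>(s, t)\<close>, and \<open>J'\<close> makes the gradients of \<open>A\<close> and
      \<open>B\<close> dependent. Euler's relation for \<open>A\<close> then kills both
      products.\<close>
    have "2 * (?e A * Bx) = 0" "2 * (?e A * By) = 0"
      using J' eA eB by Groebner_Basis.algebra+
    \<comment> \<open>A zero of the gradient of \<open>B\<close> would give a singular point of the
      quartic with \<open>z = 0\<close>.\<close>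
    moreover have "Bx \<noteq> 0 \<or> By \<noteq> 0"
    proof (rule ccontr)
      assume "\<not> (Bx \<noteq> 0 \<or> By \<noteq> 0)"
      then have "?e (partial_deriv 0 (subst v f)) = 0" "?e (partial_deriv 1 (subst v f)) = 0"
        "?e (partial_deriv 2 (subst v f)) = 0"
        unfolding f' by (simp_all add: partial_deriv_mult partial_deriv_power dA dB eval_add eval_mult
            eval.hom_power eval.hom_numeral Bx_def By_def)
      then have "\<And>j. ?e (partial_deriv j (subst v f)) = 0"
        using forall_3[of "\<lambda>j. ?e (partial_deriv j (subst v f)) = 0"] by blast
      then have "pt s t 0 = pt 0 0 0" by (rule smooth)
      then have "pt s t 0 0 = 0" "pt s t 0 1 = 0" by simp_all
      then show False using st by simp
    qed
    ultimately have A0: "?e A = 0" by auto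
    text \<open>So the line through \<open>P\<close> and this point would be a hyperflex line.\<close>
    define D where "D = E s t 0"
    have hyper: "klein lam (\<sigma> * D 0 + \<rho> * P 0) (\<sigma> * D 1 + \<rho> * P 1) (\<sigma> * D 2 + \<rho> * P 2) = \<rho> ^ 4" for \<sigma> \<rho>
    proof -
      have "E (\<sigma> * s) (\<sigma> * t) \<rho> = (\<lambda>i. \<sigma> * D i + \<rho> * P i)"
        by (rule ext) (simp add: D_def E algebra_simps)
      then have "klein lam (\<sigma> * D 0 + \<rho> * P 0) (\<sigma> * D 1 + \<rho> * P 1) (\<sigma> * D 2 + \<rho> * P 2) = eval (E (\<sigma> * s) (\<sigma> * t) \<rho>) f"
        by (simp add: f_def eval_klein_quartic)
      also have "H 1 = (\<lambda>_ _. 0)" by (intro ext) (simp only: H_def h1 eval.hom_zero)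
      then have "eval (E (\<sigma> * s) (\<sigma> * t) \<rho>) f = \<rho> ^ 4"
        using A0 B0 by (simp add: val H_scale H3 H4 del: One_nat_def) (simp add: H_def A_def B_def del: One_nat_def)
      finally show ?thesis .
    qed
    note col = klein_hyperflex_collinear[OF lam hyper]
    have "\<exists>k. P k \<noteq> 0" using P[of 0] by (simp add: proj_zeros_def)
    then obtain k where k: "P k \<noteq> 0" by blast
    have "D i * P k = D k * P i" for i
    proof -
      have "\<forall>i k. D i * P k = D k * P i" using col by (simp add: forall_3 mult.commute)
      then show ?thesis by blast
    qed
    then have D: "D i = D k / P k * P i" for i using k by (simp add: field_simps)
    have "E s t 0 i = E 0 0 (D k / P k) i" for i
      using D[of i] unfolding E[of 0 0 "D k / P k" i] by (simp only: D_def mult_zero_left add_0)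
    then have "E s t 0 = E 0 0 (D k / P k)" by (rule ext)
    then show False using E_inj st by blast
  qed
  ultimately have "quadruple_point A B a b c"
    using A B ab0 distinct g(2) c by unfold_locales (auto simp: mult.commute)
  then interpret q: quadruple_point A B a b c .
  have "subst v (klein_quartic lam * (\<Prod>i<4. l i)) = q.F"
    using f' ab by (simp add: q.F_def q.Q_def f_def subst.subst_poly_mult subst.subst.hom_prod)
  then show ?thesis using q.plus_one_generated_F plus_one_generated_subst by metis
qed

theorem proposition4p11:
  fixes lam :: complex and l :: "nat \<Rightarrow> mpoly3"
  assumes "lam ^ 2 + 3 * lam + 18 = 0"
    and "\<forall>i < 4. bitangent (klein_quartic lam) (l i)"
    and "inj_on (\<lambda>i. proj_zeros (l i)) {..<4}"
    and "\<exists>P. \<forall>i < 4. P \<in> proj_zeros (l i)"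
  shows "plus_one_generated (klein_quartic lam * (\<Prod>i<4. l i)) 4 4 7"
proof -
  obtain P where P: "\<And>i. i < 4 \<Longrightarrow> P \<in> proj_zeros (l i)" using assms(4) by blast
  have inj: "i = j" if "i < 4" "j < 4" "proj_zeros (l i) = proj_zeros (l j)" for i j
    using inj_onD[OF assms(3)] that by simp
  let ?d = "eval P (klein_quartic lam)"
  \<comment> \<open>Otherwise \<open>l 0\<close> and \<open>l 1\<close> would both be the tangent
    line at \<open>P\<close>.\<close>
  have d: "?d \<noteq> 0"
  proof
    assume "?d = 0"
    then have "proj_zeros (l 0) = proj_zeros (l 1)"
      using proj_zeros_bitangent_through_point_on_curve[OF assms(1) _ P] assms(2) by simp
    then show False using inj[of 0 1] by simp
  qed
  \<comment> \<open>The reciprocal of a fourth root of \<open>?d\<close>, since the quartic scales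
    with the fourth power.\<close>
  define \<kappa> where "\<kappa> = 1 / csqrt (csqrt ?d)"
  have "(csqrt (csqrt ?d)) ^ 4 = ((csqrt (csqrt ?d))\<^sup>2)\<^sup>2"
    by (simp only: power_mult[symmetric]) simp
  also have "\<dots> = ?d" unfolding power2_csqrt ..
  finally have "\<kappa> ^ 4 * ?d = 1" using d by (simp add: \<kappa>_def power_divide)
  then have one: "eval (\<lambda>i. \<kappa> * P i) (klein_quartic lam) = 1"
    using eval_scale[of 4 "klein_quartic lam" \<kappa> P] homogeneous_klein_quartic by simp
  have "\<kappa> \<noteq> 0" using d by (simp add: \<kappa>_def)
  then have "(\<lambda>i. \<kappa> * P i) \<in> proj_zeros (l i)" if "i < 4" for i
    using P[OF that] assms(2) that eval_scale[of 1 "l i" \<kappa> P]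
    by (simp add: proj_zeros_def bitangent_def is_line_def)
  then show ?thesis
    using plus_one_generated_klein_normalized[OF assms(1) _ _ inj one] assms(2) by blast
qed

end
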